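(* Let $\omega$ be a non-quasianalytic weight function such that $\log(1+t)=o(\omega(t))$ as $t\to\infty$. Then $(\mathcal{O}'_{C,\omega}(\mathbb{R}^N),\star)$ is a convolution topological algebra; that is, $T\star S\in\mathcal{O}'_{C,\omega}(\mathbb{R}^N)$ for all $T,S\in\mathcal{O}'_{C,\omega}(\mathbb{R}^N)$, $\mathcal{O}'_{C,\omega}(\mathbb{R}^N)$ is an algebra under $\star$, and the bilinear map $\mathcal{O}'_{C,\omega}(\mathbb{R}^N)\times\mathcal{O}'_{C,\omega}(\mathbb{R}^N)\to\mathcal{O}'_{C,\omega}(\mathbb{R}^N)$, $(T,S)\mapsto T\star S$, is (jointly) continuous for the strong dual topology.
   Context: Weights. A non-quasianalytic weight function is a continuous increasing function $\omega:[0,\infty)\to[0,\infty)$ such that: ($\alpha$) there is $K\ge 1$ with $\omega(2t)\le K(1+\omega(t))$ for all $t\ge 0$; ($\beta$) $\int_1^\infty \frac{\omega(t)}{1+t^2}\,dt<\infty$; ($\gamma$) there are $a\in\mathbb{R}$, $b>0$ with $\omega(t)\ge a+b\log(1+t)$ for all $t\ge 0$; ($\delta$) $\varphi_\omega(t)=\omega(e^t)$ is convex. It is assumed (normalization) that $\omega$ vanishes on $[0,1]$. For $x\in\mathbb{R}^N$, $\omega(x):=\omega(|x|)$. The Young conjugate is $\varphi^*_\omega(s):=\sup_{t\ge 0}\{st-\varphi_\omega(t)\}$, $s\ge 0$ (the value $+\infty$ is allowed, with $\exp(-\infty)=0$). Spaces. $\mathcal{S}_\omega(\mathbb{R}^N)$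 is the set of all $f\in L^1(\mathbb{R}^N)$ such that $f,\hat f\in C^\infty(\mathbb{R}^N)$ and $\|\exp(\lambda\omega)\partial^\alpha f\|_\infty<\infty$, $\|\exp(\lambda\omega)\partial^\alpha\hat f\|_\infty<\infty$ for all $\lambda>0$, $\alpha\in\mathbb{N}_0^N$; it is a Fréchet space with the norms $q_{m,n}(f):=\sup_{\alpha}\|\exp(n\omega)\partial^\alpha f\|_\infty\exp\left(-m\varphi^*_\omega\left(\frac{|\alpha|}{m}\right)\right)$, $m,n\in\mathbb{N}$. For $m,n\in\mathbb{N}$ let $\mathcal{O}^m_{n,\omega}(\mathbb{R}^N)$ be the space of all $f\in C^\infty(\mathbb{R}^N)$ with $r_{m,n}(f):=\sup_{\alpha\in\mathbb{N}_0^N}\sup_{x\in\mathbb{R}^N}|\partial^\alpha f(x)|\exp\left(-n\omega(x)-m\varphi^*_\omega\left(\frac{|\alpha|}{m}\right)\right)<\infty$, with norm $r_{m,n}$. Set $\mathcal{O}_{C,\omega}(\mathbb{R}^N):=\bigcup_{n}\bigcap_{m}\mathcal{O}^m_{n,\omega}(\mathbb{R}^N)$ with the topology of the locally convex inductive limit over $n$ of the projective limits $\mathcal{O}_{n,\omega}(\mathbb{R}^N):=\mathrm{proj}_m\,\mathcal{O}^m_{n,\omega}(\mathbb{R}^N)$. $\mathcal{S}'_\omega(\mathbb{R}^N)$ and $\mathcal{O}'_{C,\omega}(\mathbb{R}^N)$ denote strong duals. The inclusion $\mathcal{S}_\omega(\mathbb{R}^N)\hookrightarrow\mathcal{O}_{C,\omega}(\mathbb{R}^N)$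 is continuous with dense range, so $\mathcal{O}'_{C,\omega}(\mathbb{R}^N)$ is regarded (by restriction) as a subspace of $\mathcal{S}'_\omega(\mathbb{R}^N)$. Convolution. For a functional $R$ and a function $f$, $(R\star f)(x):=\langle R_y, f(x-y)\rangle$. Put $\check f(x):=f(-x)$ and $\check T(f):=T(\check f)$. For $T\in\mathcal{O}'_{C,\omega}(\mathbb{R}^N)$ and $f\in\mathcal{S}_\omega(\mathbb{R}^N)$ it is known that $\check T\star f\in\mathcal{S}_\omega(\mathbb{R}^N)$, with $f\mapsto\check T\star f$ continuous on $\mathcal{S}_\omega(\mathbb{R}^N)$. For $T\in\mathcal{O}'_{C,\omega}(\mathbb{R}^N)$ and $S\in\mathcal{S}'_\omega(\mathbb{R}^N)$ the convolution $T\star S\in\mathcal{S}'_\omega(\mathbb{R}^N)$ is defined by $\langle T\star S,f\rangle:=\langle S,\check T\star f\rangle$, $f\in\mathcal{S}_\omega(\mathbb{R}^N)$. The statement $T\star S\in\mathcal{O}'_{C,\omega}(\mathbb{R}^N)$ means that this functional extends (uniquely) to a continuous functional on $\mathcal{O}_{C,\omega}(\mathbb{R}^N)$. *)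

theory Defs
  imports "HOL-Analysis.Analysis" "HOL-Library.Landau_Symbols"
begin

text \<open>
  All vector spaces below (function spaces as well as spaces of functionals) consist of functions
  of type \<open>'x \<Rightarrow> complex\<close> with the pointwise operations.
\<close>

text \<open>
  The locally convex topology on the vector space \<open>V\<close> generated by the seminorms in \<open>P\<close>, which
  have to be finite on \<open>V\<close> but may take the value \<open>\<infinity>\<close> elsewhere.
\<close>
definition seminorm_topology ::
    "('x \<Rightarrow> complex) set \<Rightarrow> (('x \<Rightarrow> complex) \<Rightarrow> ereal) set \<Rightarrow> ('x \<Rightarrow> complex) topology" where
  "seminorm_topology V P = topology_generated_by
     (insert V {{g \<in> V. p (\<lambda>x. g x - f x) < ereal e} | f p e. f \<in> V \<and> p \<in> P \<and> 0 < e})"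

lemma topspace_seminorm_topology [simp]: "topspace (seminorm_topology V P) = V"
  unfolding seminorm_topology_def topology_generated_by_topspace by auto

definition seminorm_on :: "('x \<Rightarrow> complex) set \<Rightarrow> (('x \<Rightarrow> complex) \<Rightarrow> real) \<Rightarrow> bool" where
  "seminorm_on V p \<longleftrightarrow>
     (\<forall>f\<in>V. \<forall>g\<in>V. p (\<lambda>x. f x + g x) \<le> p f + p g) \<and>
     (\<forall>c. \<forall>f\<in>V. p (\<lambda>x. c * f x) = cmod c * p f)"

text \<open>
  The locally convex inductive limit of an increasing family of spaces: the finest locally convex
  topology on the union for which all inclusions are continuous, i.e. the one generated by all
  seminorms whose restriction to every step is continuous.
\<close>
definition lc_inductive_limit ::
    "'i set \<Rightarrow> ('i \<Rightarrow> ('x \<Rightarrow> complex) topology) \<Rightarrow> ('x \<Rightarrow> complex) topology" where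
  "lc_inductive_limit I E =
     (let V = (\<Union>i\<in>I. topspace (E i)) in
      seminorm_topology V
        {(\<lambda>f. ereal (p f)) | p. seminorm_on V p \<and> (\<forall>i\<in>I. continuous_map (E i) euclideanreal p)})"

definition bounded_in :: "('x \<Rightarrow> complex) topology \<Rightarrow> ('x \<Rightarrow> complex) set \<Rightarrow> bool" where
  "bounded_in X B \<longleftrightarrow> B \<subseteq> topspace X \<and>
     (\<forall>U. openin X U \<and> (\<lambda>x. 0) \<in> U \<longrightarrow>
        (\<exists>r>0. \<forall>c. r \<le> cmod c \<longrightarrow> B \<subseteq> (\<lambda>g x. c * g x) ` U))"

text \<open>Functionals are set to \<open>0\<close> outside the space, so that equality of functionals is equality
  of HOL functions.\<close>
definition dual_space :: "('x \<Rightarrow> complex) topology \<Rightarrow> (('x \<Rightarrow> complex) \<Rightarrow> complex) set" where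
  "dual_space X = {T.
     (\<forall>f\<in>topspace X. \<forall>g\<in>topspace X. T (\<lambda>x. f x + g x) = T f + T g) \<and>
     (\<forall>c. \<forall>f\<in>topspace X. T (\<lambda>x. c * f x) = c * T f) \<and>
     continuous_map X euclidean T \<and>
     (\<forall>f. f \<notin> topspace X \<longrightarrow> T f = 0)}"

definition strong_dual :: "('x \<Rightarrow> complex) topology \<Rightarrow> (('x \<Rightarrow> complex) \<Rightarrow> complex) topology" where
  "strong_dual X = seminorm_topology (dual_space X)
     {(\<lambda>T. SUP f\<in>B. ereal (cmod (T f))) | B. bounded_in X B}"

definition complex_algebra_on ::
    "('x \<Rightarrow> complex) set \<Rightarrow> (('x \<Rightarrow> complex) \<Rightarrow> ('x \<Rightarrow> complex) \<Rightarrow> ('x \<Rightarrow> complex)) \<Rightarrow> bool" where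
  "complex_algebra_on A m \<longleftrightarrow>
     (\<lambda>x. 0) \<in> A \<and>
     (\<forall>S\<in>A. \<forall>T\<in>A. (\<lambda>x. S x + T x) \<in> A) \<and>
     (\<forall>c. \<forall>T\<in>A. (\<lambda>x. c * T x) \<in> A) \<and>
     (\<forall>S\<in>A. \<forall>T\<in>A. m S T \<in> A) \<and>
     (\<forall>R\<in>A. \<forall>S\<in>A. \<forall>T\<in>A. m (\<lambda>x. R x + S x) T = (\<lambda>x. m R T x + m S T x)) \<and>
     (\<forall>R\<in>A. \<forall>S\<in>A. \<forall>T\<in>A. m R (\<lambda>x. S x + T x) = (\<lambda>x. m R S x + m R T x)) \<and>
     (\<forall>c. \<forall>S\<in>A. \<forall>T\<in>A. m (\<lambda>x. c * S x) T = (\<lambda>x. c * m S T x)) \<and>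
     (\<forall>c. \<forall>S\<in>A. \<forall>T\<in>A. m S (\<lambda>x. c * T x) = (\<lambda>x. c * m S T x)) \<and>
     (\<forall>R\<in>A. \<forall>S\<in>A. \<forall>T\<in>A. m (m R S) T = m R (m S T))"

definition partial :: "'n::finite \<Rightarrow> (real^'n \<Rightarrow> complex) \<Rightarrow> real^'n \<Rightarrow> complex" where
  "partial i f x = vector_derivative (\<lambda>t. f (x + t *\<^sub>R axis i 1)) (at 0)"

fun C_k :: "nat \<Rightarrow> (real^'n::finite \<Rightarrow> complex) \<Rightarrow> bool" where
  "C_k 0 f \<longleftrightarrow> continuous_on UNIV f"
| "C_k (Suc k) f \<longleftrightarrow> continuous_on UNIV f \<and>
     (\<forall>i. (\<forall>x. (\<lambda>t. f (x + t *\<^sub>R axis i 1)) differentiable (at 0)) \<and> C_k k (partial i f))"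

definition smooth :: "(real^'n::finite \<Rightarrow> complex) \<Rightarrow> bool" where
  "smooth f \<longleftrightarrow> (\<forall>k. C_k k f)"

text \<open>An enumeration of the coordinates; it fixes the order in which \<open>mderiv\<close> takes the partial
  derivatives, which is immaterial for smooth functions.\<close>
definition coords :: "'n::finite list" where
  "coords = (SOME is. distinct is \<and> set is = UNIV)"

definition mderiv :: "('n::finite \<Rightarrow> nat) \<Rightarrow> (real^'n \<Rightarrow> complex) \<Rightarrow> real^'n \<Rightarrow> complex" where
  "mderiv \<alpha> f = foldr (\<lambda>i. partial i ^^ \<alpha> i) coords f"

definition mlength :: "('n::finite \<Rightarrow> nat) \<Rightarrow> nat" where
  "mlength \<alpha> = (\<Sum>i\<in>UNIV. \<alpha> i)"

definition fourier :: "(real^'n::finite \<Rightarrow> complex) \<Rightarrow> real^'n \<Rightarrow> complex" where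
  "fourier f \<xi> = (LINT x|lborel. cis (- (x \<bullet> \<xi>)) * f x)"

text \<open>Only the values on \<open>[0,\<infinity>)\<close> of a weight function matter.\<close>
definition nonquasianalytic_weight :: "(real \<Rightarrow> real) \<Rightarrow> bool" where
  "nonquasianalytic_weight \<omega> \<longleftrightarrow>
     continuous_on {0..} \<omega> \<and> mono_on {0..} \<omega> \<and> (\<forall>t\<ge>0. 0 \<le> \<omega> t) \<and>
     (\<exists>K\<ge>1. \<forall>t\<ge>0. \<omega> (2 * t) \<le> K * (1 + \<omega> t)) \<and>
     set_integrable lborel {1..} (\<lambda>t. \<omega> t / (1 + t\<^sup>2)) \<and>
     (\<exists>a. \<exists>b>0. \<forall>t\<ge>0. a + b * ln (1 + t) \<le> \<omega> t) \<and>
     convex_on UNIV (\<lambda>t. \<omega> (exp t)) \<and>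
     (\<forall>t\<in>{0..1}. \<omega> t = 0)"

definition young_conj :: "(real \<Rightarrow> real) \<Rightarrow> real \<Rightarrow> ereal" where
  "young_conj \<omega> s = (SUP t\<in>{0..}. ereal (s * t - \<omega> (exp t)))"

text \<open>Never applied to the value \<open>\<infinity>\<close> below.\<close>
definition exp_ereal :: "ereal \<Rightarrow> real" where
  "exp_ereal x = (if x = -\<infinity> then 0 else exp (real_of_ereal x))"

definition S_set :: "(real \<Rightarrow> real) \<Rightarrow> (real^'n::finite \<Rightarrow> complex) set" where
  "S_set \<omega> = {f. integrable lborel f \<and> smooth f \<and> smooth (fourier f) \<and>
     (\<forall>l>0. \<forall>\<alpha>. bdd_above (range (\<lambda>x. exp (l * \<omega> (norm x)) * cmod (mderiv \<alpha> f x))) \<and>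
                 bdd_above (range (\<lambda>x. exp (l * \<omega> (norm x)) * cmod (mderiv \<alpha> (fourier f) x))))}"

definition q_norm :: "(real \<Rightarrow> real) \<Rightarrow> nat \<Rightarrow> nat \<Rightarrow> (real^'n::finite \<Rightarrow> complex) \<Rightarrow> ereal" where
  "q_norm \<omega> m n f = (SUP \<alpha>.
     (SUP x. ereal (exp (real n * \<omega> (norm x)) * cmod (mderiv \<alpha> f x))) *
     ereal (exp_ereal (- (ereal (real m) * young_conj \<omega> (real (mlength \<alpha>) / real m)))))"

definition S_space :: "(real \<Rightarrow> real) \<Rightarrow> (real^'n::finite \<Rightarrow> complex) topology" where
  "S_space \<omega> = seminorm_topology (S_set \<omega>) {q_norm \<omega> m n | m n. 1 \<le> m \<and> 1 \<le> n}"

definition r_norm :: "(real \<Rightarrow> real) \<Rightarrow> nat \<Rightarrow> nat \<Rightarrow> (real^'n::finite \<Rightarrow> complex) \<Rightarrow> ereal" where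
  "r_norm \<omega> m n f = (SUP \<alpha>. SUP x. ereal (cmod (mderiv \<alpha> f x) *
     exp_ereal (- ereal (real n * \<omega> (norm x))
                - ereal (real m) * young_conj \<omega> (real (mlength \<alpha>) / real m))))"

definition O_mn_set :: "(real \<Rightarrow> real) \<Rightarrow> nat \<Rightarrow> nat \<Rightarrow> (real^'n::finite \<Rightarrow> complex) set" where
  "O_mn_set \<omega> m n = {f. smooth f \<and> r_norm \<omega> m n f < \<infinity>}"

text \<open>The projective limit over \<open>m\<close>.\<close>
definition O_n_space :: "(real \<Rightarrow> real) \<Rightarrow> nat \<Rightarrow> (real^'n::finite \<Rightarrow> complex) topology" where
  "O_n_space \<omega> n = seminorm_topology (\<Inter>m\<in>{1..}. O_mn_set \<omega> m n) {r_norm \<omega> m n | m. 1 \<le> m}"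

definition OC_space :: "(real \<Rightarrow> real) \<Rightarrow> (real^'n::finite \<Rightarrow> complex) topology" where
  "OC_space \<omega> = lc_inductive_limit {1..} (O_n_space \<omega>)"

definition S_dual :: "(real \<Rightarrow> real) \<Rightarrow> ((real^'n::finite \<Rightarrow> complex) \<Rightarrow> complex) topology" where
  "S_dual \<omega> = strong_dual (S_space \<omega>)"

definition OC_dual :: "(real \<Rightarrow> real) \<Rightarrow> ((real^'n::finite \<Rightarrow> complex) \<Rightarrow> complex) topology" where
  "OC_dual \<omega> = strong_dual (OC_space \<omega>)"

lemma topspace_strong_dual [simp]: "topspace (strong_dual X) = dual_space X"
  by (simp add: strong_dual_def)

text \<open>Restriction of functionals to \<open>S_set \<omega>\<close>; it identifies \<open>OC_dual \<omega>\<close> with a subspace of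
  \<open>S_dual \<omega>\<close>.\<close>
definition restr_S ::
    "(real \<Rightarrow> real) \<Rightarrow> ((real^'n::finite \<Rightarrow> complex) \<Rightarrow> complex) \<Rightarrow> (real^'n \<Rightarrow> complex) \<Rightarrow> complex" where
  "restr_S \<omega> T = (\<lambda>f. if f \<in> S_set \<omega> then T f else 0)"

definition star ::
    "((real^'n::finite \<Rightarrow> complex) \<Rightarrow> complex) \<Rightarrow> (real^'n \<Rightarrow> complex) \<Rightarrow> real^'n \<Rightarrow> complex" where
  "star R f = (\<lambda>x. R (\<lambda>y. f (x - y)))"

definition reflect :: "(real^'n::finite \<Rightarrow> complex) \<Rightarrow> real^'n \<Rightarrow> complex" where
  "reflect f = (\<lambda>x. f (- x))"

definition reflect_dual ::
    "((real^'n::finite \<Rightarrow> complex) \<Rightarrow> complex) \<Rightarrow> (real^'n \<Rightarrow> complex) \<Rightarrow> complex" where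
  "reflect_dual T = (\<lambda>f. T (reflect f))"

text \<open>The convolution of \<open>T\<close> in \<open>OC_dual \<omega>\<close> and \<open>S\<close> in \<open>S_dual \<omega>\<close>.\<close>
definition conv ::
    "(real \<Rightarrow> real) \<Rightarrow> ((real^'n::finite \<Rightarrow> complex) \<Rightarrow> complex) \<Rightarrow>
      ((real^'n \<Rightarrow> complex) \<Rightarrow> complex) \<Rightarrow> (real^'n \<Rightarrow> complex) \<Rightarrow> complex" where
  "conv \<omega> T S = (\<lambda>f. if f \<in> S_set \<omega> then S (star (reflect_dual T) f) else 0)"

text \<open>The convolution of \<open>T\<close> and \<open>S\<close> in \<open>OC_dual \<omega>\<close>: the element of \<open>OC_dual \<omega>\<close> that extends
  \<open>conv \<omega> T S\<close>, where \<open>S\<close> is regarded as an element of \<open>S_dual \<omega>\<close>.\<close>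
definition conv_OC ::
    "(real \<Rightarrow> real) \<Rightarrow> ((real^'n::finite \<Rightarrow> complex) \<Rightarrow> complex) \<Rightarrow>
      ((real^'n \<Rightarrow> complex) \<Rightarrow> complex) \<Rightarrow> (real^'n \<Rightarrow> complex) \<Rightarrow> complex" where
  "conv_OC \<omega> T S =
     (THE U. U \<in> topspace (OC_dual \<omega>) \<and> restr_S \<omega> U = conv \<omega> T (restr_S \<omega> S))"

end

theory Submission
  imports Defs
begin

text \<open>
  The product of \<open>T\<close> and \<open>S\<close> is the functional \<open>f \<mapsto> S\<^sub>x (T\<^sub>y (f (x + y)))\<close>. It makes sense on all of
  \<open>OC_space \<omega>\<close>, because \<open>\<omega> (x + y) \<le> K (1 + \<omega> x + \<omega> y)\<close>, and associativity and bilinearity are then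
  evident. It is the only extension of \<open>conv \<omega> T S\<close> because \<open>S_set \<omega>\<close> is dense in \<open>OC_space \<omega>\<close>.

  By Fourier inversion of \<open>y \<mapsto> f (x + y) exp (-|y|\<^sup>2 / 2)\<close>, derivative bounds for \<open>f\<close> are equivalent to decay
  of its short-time Fourier transform. This identifies \<open>S_set \<omega>\<close> with the set of all \<open>f\<close> with finite norms
  \<open>q_norm\<close>, and it shows that the inductive limit is regular: a bounded subset of \<open>OC_space \<omega>\<close> is
  bounded in some step \<open>O_n_space \<omega> n\<close>. For joint continuity, the translates of the derivatives of such
  a set, suitably normalised, form a bounded set \<open>B1\<close>, and
  \<open>sup\<^bsub>B\<^esub> |T \<star> S| \<le> sup\<^bsub>B1\<^esub> |T| \<cdot> sup\<^bsub>B2\<^esub> |S|\<close> for a second bounded set \<open>B2\<close>.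
\<close>

section \<open>Iterated partial derivatives\<close>

text \<open>A separately continuous bilinear map on strong duals is in general only hypocontinuous.
  For joint continuity, \<open>B\<close> must lie in one step, and the bounds for derivatives of
  order j + k must split into a factor for j and one for k, uniformly in m. That \<open>B\<close>
  lies in one step is no formal property of such limits: the topology of
  \<open>OC_space \<omega>\<close> is known only through the seminorms that are continuous on every
  step. The short-time Fourier transform turns membership in a step into a family of scalar bounds,
  and suprema of these are again such seminorms. Each condition on the weight has its place.
  Integrability makes \<open>\<omega>\<close> sublinear, so that \<open>W m k\<close> dominates
  \<open>k! e^k\<close> and Gaussians are admissible windows. The little-o condition makes
  \<open>W m\<close> finite and lets \<open>exp \<omega>\<close> absorb polynomials. Convexity
  permits a choice of the derivative order that is optimal for a given frequency. Doubling controls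
  translations: they replace n by n K, which is harmless in a union over n, and leave m
  unchanged.\<close>

definition axis_diff :: "(real^'n::finite \<Rightarrow> complex) \<Rightarrow> bool" where
  "axis_diff f \<longleftrightarrow> (\<forall>i x. (\<lambda>t. f (x + t *\<^sub>R axis i 1)) differentiable (at 0))"

text \<open>Words in the coordinates replace multi-indices: composition of derivatives is
  concatenation, and the Leibniz rule is an induction on lists. The bounds depend on the length of
  the word only, so for smooth functions both indexings give the same norms.\<close>

abbreviation Dw :: "'n::finite list \<Rightarrow> (real^'n \<Rightarrow> complex) \<Rightarrow> real^'n \<Rightarrow> complex" where
  "Dw w f \<equiv> foldr partial w f"

lemma axis_diff_has_vector_derivative:
  assumes "axis_diff f"
  shows "((\<lambda>t. f (x + t *\<^sub>R axis i 1)) has_vector_derivative partial i f (x + t *\<^sub>R axis i 1)) (at t)"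
proof -
  define y where "y = x + t *\<^sub>R axis i (1::real)"
  have "((\<lambda>s. f (y + s *\<^sub>R axis i 1)) has_vector_derivative partial i f y) (at (0::real))"
    using assms unfolding axis_diff_def partial_def by (simp add: vector_derivative_works)
  then have "((\<lambda>s. f (y + s *\<^sub>R axis i 1)) has_vector_derivative partial i f y) (at (t + (-t)))"
    by simp
  then have "(((\<lambda>s. f (y + s *\<^sub>R axis i 1)) \<circ> (\<lambda>s. s + (-t))) has_vector_derivative 1 *\<^sub>R partial i f y) (at t)"
    by (intro vector_diff_chain_at) (auto intro!: derivative_eq_intros simp: )
  moreover have "((\<lambda>s. f (y + s *\<^sub>R axis i 1)) \<circ> (\<lambda>s. s + (-t))) = (\<lambda>s. f (x + s *\<^sub>R axis i 1))"
    by (auto simp: y_def fun_eq_iff algebra_simps)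
  ultimately show ?thesis by (simp add: y_def)
qed

lemma partial_eqI:
  assumes "\<And>x. ((\<lambda>t. f (x + t *\<^sub>R axis i 1)) has_vector_derivative g x) (at 0)"
  shows "partial i f = g"
  unfolding partial_def using assms by (auto simp: fun_eq_iff intro: vector_derivative_at)

lemma axis_diffI:
  assumes "\<And>i x. ((\<lambda>t. f (x + t *\<^sub>R axis i 1)) has_vector_derivative g i x) (at 0)"
  shows "axis_diff f"
  unfolding axis_diff_def using differentiableI_vector[OF assms] by blast

lemma smooth_imp_axis_diff: "smooth f \<Longrightarrow> axis_diff f"
  unfolding smooth_def axis_diff_def by (metis C_k.simps(2))

lemma smooth_continuous: "smooth f \<Longrightarrow> continuous_on UNIV f"
  unfolding smooth_def by (metis C_k.simps(1))

lemma smooth_partial: "smooth f \<Longrightarrow> smooth (partial i f)"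
  unfolding smooth_def by (metis C_k.simps(2))

lemma smooth_Dw: "smooth f \<Longrightarrow> smooth (Dw w f)"
  by (induction w) (auto intro: smooth_partial)

text \<open>\<open>F\<close> is an invariant: the induction on k in \<open>C_k\<close> needs the
  claim for all partial derivatives at once, and closure of \<open>F\<close> under
  \<open>partial\<close> supplies it.\<close>

lemma smooth_coinduct:
  assumes "f \<in> F"
    and "\<And>f. f \<in> F \<Longrightarrow> continuous_on UNIV f" "\<And>f. f \<in> F \<Longrightarrow> axis_diff f"
    and "\<And>f i. f \<in> F \<Longrightarrow> partial i f \<in> F"
  shows "smooth f"
proof -
  have "C_k k f" if "f \<in> F" for k f
    using that by (induction k arbitrary: f) (use assms in \<open>auto simp: axis_diff_def\<close>)
  then show ?thesis using assms(1) by (auto simp: smooth_def)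
qed

lemma has_vector_derivative_partial:
  "smooth f \<Longrightarrow> ((\<lambda>t. f (x + t *\<^sub>R axis i 1)) has_vector_derivative partial i f (x + t *\<^sub>R axis i 1)) (at t)"
  by (intro axis_diff_has_vector_derivative smooth_imp_axis_diff)

lemma has_vector_derivative_partial_0:
  "smooth f \<Longrightarrow> ((\<lambda>t. f (x + t *\<^sub>R axis i 1)) has_vector_derivative partial i f x) (at 0)"
  using has_vector_derivative_partial[of f x i 0] by simp

lemma real_mean_value_bound:
  fixes f :: "real \<Rightarrow> complex"
  assumes "\<And>s. \<bar>s\<bar> \<le> \<bar>t\<bar> \<Longrightarrow> (f has_vector_derivative f' s) (at s)"
    and "\<And>s. \<bar>s\<bar> \<le> \<bar>t\<bar> \<Longrightarrow> cmod (f' s) \<le> B"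
  shows "cmod (f t - f 0) \<le> B * \<bar>t\<bar>"
proof -
  have "norm (f t - f 0) \<le> B * norm (t - 0)"
  proof (rule differentiable_bound)
    show "convex {-\<bar>t\<bar>..\<bar>t\<bar>}" by simp
    show "(f has_derivative (\<lambda>h. h *\<^sub>R f' s)) (at s within {-\<bar>t\<bar>..\<bar>t\<bar>})" if "s \<in> {-\<bar>t\<bar>..\<bar>t\<bar>}" for s
      using assms(1)[of s] that by (auto simp: has_vector_derivative_def intro: has_derivative_at_withinI)
    show "onorm (\<lambda>h. h *\<^sub>R f' s) \<le> B" if "s \<in> {-\<bar>t\<bar>..\<bar>t\<bar>}" for s
      using assms(2)[of s] that by (intro onorm_le) (simp add: mult.commute[of B] mult_left_mono abs_le_iff)
  qed auto
  then show ?thesis by simp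
qed

text \<open>Taylor's formula of second order along an axis, from two mean value estimates; hence the
  constant B instead of B / 2.\<close>

lemma partial_remainder_bound:
  assumes "smooth f" and B: "\<And>s. \<bar>s\<bar> \<le> \<bar>t\<bar> \<Longrightarrow> cmod (partial i (partial i f) (x + s *\<^sub>R axis i 1)) \<le> B"
  shows "cmod (f (x + t *\<^sub>R axis i 1) - f x - of_real t * partial i f x) \<le> B * t\<^sup>2"
proof -
  let ?e = "axis i (1::real)"
  have D: "cmod (partial i f (x + s *\<^sub>R ?e) - partial i f x) \<le> B * \<bar>t\<bar>" if "\<bar>s\<bar> \<le> \<bar>t\<bar>" for s
  proof -
    have "cmod (partial i f (x + s *\<^sub>R ?e) - partial i f (x + 0 *\<^sub>R ?e)) \<le> B * \<bar>s\<bar>"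
      by (rule real_mean_value_bound[OF has_vector_derivative_partial])
        (use B that assms(1) in \<open>auto intro: smooth_partial\<close>)
    also have "\<dots> \<le> B * \<bar>t\<bar>"
    proof (rule mult_left_mono[OF that])
      show "0 \<le> B" using B[of 0] norm_ge_zero[of "partial i (partial i f) (x + 0 *\<^sub>R axis i 1)"] by linarith
    qed
    finally show ?thesis by simp
  qed
  have "cmod ((f (x + t *\<^sub>R ?e) - t *\<^sub>R partial i f x) - (f (x + 0 *\<^sub>R ?e) - 0 *\<^sub>R partial i f x)) \<le> (B * \<bar>t\<bar>) * \<bar>t\<bar>"
  proof (rule real_mean_value_bound)
    fix s assume "\<bar>s\<bar> \<le> \<bar>t\<bar>"
    show "((\<lambda>s. f (x + s *\<^sub>R ?e) - s *\<^sub>R partial i f x) has_vector_derivative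
        (partial i f (x + s *\<^sub>R ?e) - partial i f x)) (at s)"
      by (auto intro!: derivative_eq_intros has_vector_derivative_partial assms)
  qed (use D in auto)
  then show ?thesis
    by (simp add: algebra_simps power2_eq_square scaleR_conv_of_real)
qed

text \<open>The coordinates are changed one at a time. All intermediate points lie in the box
  \<bar>y_j - x_j\<bar> \<le> \<bar>h_j\<bar>, so the derivatives have to be bounded only
  there.\<close>

lemma axis_diff_lipschitz:
  fixes f :: "real^'n::finite \<Rightarrow> complex"
  assumes f: "axis_diff f"
    and B: "\<And>i y. (\<And>j. \<bar>y $ j - x $ j\<bar> \<le> \<bar>h $ j\<bar>) \<Longrightarrow> cmod (partial i f y) \<le> B"
  shows "cmod (f (x + h) - f x) \<le> B * (\<Sum>i\<in>UNIV. \<bar>h $ i\<bar>)"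
proof -
  have "cmod (f (x + (\<Sum>i\<in>S. (h $ i) *\<^sub>R axis i 1)) - f x) \<le> B * (\<Sum>i\<in>S. \<bar>h $ i\<bar>)" if "finite S" for S
    using that
  proof (induction S)
    case (insert k S)
    let ?z = "\<Sum>i\<in>S. (h $ i) *\<^sub>R axis i (1::real)"
    have z: "?z $ j = (if j \<in> S then h $ j else 0)" for j
      using insert by (simp add: axis_def if_distrib if_distribR sum.delta cong: if_cong)
    have "cmod (f (x + ?z + (h $ k) *\<^sub>R axis k 1) - f (x + ?z + 0 *\<^sub>R axis k 1)) \<le> B * \<bar>h $ k\<bar>"
    proof (rule real_mean_value_bound)
      fix s assume s: "\<bar>s\<bar> \<le> \<bar>h $ k\<bar>"
      show "((\<lambda>s. f (x + ?z + s *\<^sub>R axis k 1)) has_vector_derivative partial k f (x + ?z + s *\<^sub>R axis k 1)) (at s)"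
        by (rule axis_diff_has_vector_derivative[OF f])
      show "cmod (partial k f (x + ?z + s *\<^sub>R axis k 1)) \<le> B"
        using s insert by (intro B) (simp only: vector_add_component z vector_scaleR_component, auto simp: axis_def)
    qed
    then have "cmod (f (x + (h $ k *\<^sub>R axis k 1 + ?z)) - f (x + ?z)) \<le> B * \<bar>h $ k\<bar>"
      by (simp add: algebra_simps)
    then have "cmod (f (x + (h $ k *\<^sub>R axis k 1 + ?z)) - f x) \<le> B * \<bar>h $ k\<bar> + B * (\<Sum>i\<in>S. \<bar>h $ i\<bar>)"
      using insert.IH norm_triangle_le_diff by (smt (verit) norm_diff_triangle_le)
    then show ?case using insert by (simp add: algebra_simps)
  qed simp
  from this[of UNIV] show ?thesis
    using basis_expansion[of h] by (simp add: scalar_mult_eq_scaleR)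
qed

text \<open>Existence of partial derivatives does not imply continuity, but locally bounded ones
  make f locally Lipschitz.\<close>

lemma axis_diff_continuous:
  fixes f :: "real^'n::finite \<Rightarrow> complex"
  assumes f: "axis_diff f"
    and B: "\<And>x. \<exists>B. \<forall>i y. dist x y < 1 \<longrightarrow> cmod (partial i f y) \<le> B"
  shows "continuous_on UNIV f"
proof -
  have "isCont f x" for x
  proof -
    obtain B where B: "\<And>i y. dist x y < 1 \<Longrightarrow> cmod (partial i f y) \<le> B" using B by blast
    have B0: "B \<ge> 0" using B[of x undefined] by (simp, meson norm_ge_zero order_trans)
    let ?N = "real CARD('n)"
    \<comment> \<open>With N coordinates, a radius below 1 / (1 + N) keeps the whole box of
      intermediate points inside the unit ball around x, where B is valid.\<close>
    have *: "cmod (f (x + h) - f x) \<le> B * (?N * norm h)" if h: "norm h < inverse (1 + ?N)" for h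
    proof -
      have "cmod (f (x + h) - f x) \<le> B * (\<Sum>i\<in>UNIV. \<bar>h $ i\<bar>)"
      proof (rule axis_diff_lipschitz[OF f])
        fix i y assume y: "\<And>j. \<bar>y $ j - x $ j\<bar> \<le> \<bar>h $ j\<bar>"
        have "norm (y - x) \<le> (\<Sum>j\<in>UNIV. \<bar>(y - x) $ j\<bar>)" by (rule norm_le_l1_cart)
        also have "\<dots> \<le> (\<Sum>j\<in>(UNIV::'n set). norm h)"
          using y component_le_norm_cart[of h] by (intro sum_mono) (auto intro: order_trans)
        also have "\<dots> = ?N * norm h" by simp
        also have "\<dots> \<le> ?N * inverse (1 + ?N)" using h by (intro mult_left_mono) auto
        also have "\<dots> < 1" by (simp add: field_simps)
        finally show "cmod (partial i f y) \<le> B" by (intro B) (simp add: dist_norm norm_minus_commute)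
      qed
      also have "\<dots> \<le> B * (\<Sum>i\<in>(UNIV::'n set). norm h)"
        using component_le_norm_cart[of h] B0 by (intro mult_left_mono sum_mono) auto
      finally show ?thesis by simp
    qed
    have "((\<lambda>h. f (x + h) - f x) \<longlongrightarrow> 0) (at 0)"
    proof (rule Lim_null_comparison)
      show "\<forall>\<^sub>F h in at 0. norm (f (x + h) - f x) \<le> B * (?N * norm h)"
        unfolding eventually_at
        by (rule exI[of _ "inverse (1 + ?N)"]) (use * in \<open>auto simp: add_pos_nonneg\<close>)
      show "((\<lambda>h. B * (?N * norm h)) \<longlongrightarrow> 0) (at (0::real^'n))"
        by (auto intro!: tendsto_eq_intros)
    qed
    then have "((\<lambda>h. f (x + h)) \<longlongrightarrow> f x) (at 0)" using LIM_zero_iff by blast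
    then show ?thesis by (simp add: isCont_iff)
  qed
  then show ?thesis by (simp add: continuous_at_imp_continuous_on)
qed

text \<open>Local bounds for the members of \<open>F\<close> apply to their partial derivatives as
  well and so yield continuity. For Fourier integrals and for functionals applied to translates such
  bounds are at hand, while continuity is not.\<close>

lemma smooth_coinduct_bounded:
  assumes "f \<in> F" and ad: "\<And>f. f \<in> F \<Longrightarrow> axis_diff f"
    and p: "\<And>f i. f \<in> F \<Longrightarrow> partial i f \<in> F"
    and B: "\<And>f x. f \<in> F \<Longrightarrow> \<exists>B. \<forall>y. dist x y < 1 \<longrightarrow> cmod (f y) \<le> B"
  shows "smooth f"
proof (rule smooth_coinduct[OF assms(1) _ ad p])
  fix f assume f: "f \<in> F"
  show "continuous_on UNIV f"
  proof (rule axis_diff_continuous[OF ad[OF f]])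
    fix x
    obtain b where b: "\<And>i y. dist x y < 1 \<Longrightarrow> cmod (partial i f y) \<le> b i"
      using B[OF p[OF f]] by metis
    have "cmod (partial i f y) \<le> (\<Sum>i\<in>UNIV. \<bar>b i\<bar>)" if "dist x y < 1" for i y
    proof -
      have "cmod (partial i f y) \<le> \<bar>b i\<bar>" using b[OF that, of i] by linarith
      also have "\<dots> \<le> (\<Sum>i\<in>UNIV. \<bar>b i\<bar>)" by (rule member_le_sum) auto
      finally show ?thesis .
    qed
    then show "\<exists>B. \<forall>i y. dist x y < 1 \<longrightarrow> cmod (partial i f y) \<le> B" by blast
  qed
qed

subsection \<open>Algebraic rules\<close>

lemma partial_add: "smooth f \<Longrightarrow> smooth g \<Longrightarrow> partial i (\<lambda>x. f x + g x) = (\<lambda>x. partial i f x + partial i g x)"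
  by (intro partial_eqI has_vector_derivative_add has_vector_derivative_partial_0)

lemma partial_cmult: "smooth f \<Longrightarrow> partial i (\<lambda>x. c * f x) = (\<lambda>x. c * partial i f x)"
  by (intro partial_eqI has_vector_derivative_mult_right has_vector_derivative_partial_0)

lemma partial_mult: "smooth f \<Longrightarrow> smooth g \<Longrightarrow>
    partial i (\<lambda>x. f x * g x) = (\<lambda>x. f x * partial i g x + partial i f x * g x)"
  by (rule partial_eqI, rule has_vector_derivative_eq_rhs[OF has_vector_derivative_mult])
    (auto intro: has_vector_derivative_partial_0)

lemma partial_const: "partial i (\<lambda>x. c) = (\<lambda>x. 0)"
  by (intro partial_eqI) auto

lemma smooth_const: "smooth (\<lambda>x. c)"
  by (rule smooth_coinduct[of _ "range (\<lambda>c x. c)"])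
    (auto simp: partial_const axis_diff_def image_iff)

text \<open>One invariant serves both claims: finite sums of products of smooth functions are stable
  under the product rule, and f + g is f * 1 + 1 * g.\<close>

lemma smooth_sum_of_products:
  fixes f g :: "real^'n::finite \<Rightarrow> complex"
  assumes "smooth f" "smooth g"
  shows "smooth (\<lambda>x. f x * g x)" and "smooth (\<lambda>x. f x + g x)"
proof -
  define F where "F = {(\<lambda>x::real^'n. \<Sum>(u,v)\<leftarrow>l. u x * v x) | l. \<forall>(u,v)\<in>set l. smooth u \<and> smooth v}"
  have *: "continuous_on UNIV (\<lambda>x. \<Sum>(u,v)\<leftarrow>l. u x * v x) \<and> axis_diff (\<lambda>x. \<Sum>(u,v)\<leftarrow>l. u x * v x) \<and>
     (\<forall>i. partial i (\<lambda>x. \<Sum>(u,v)\<leftarrow>l. u x * v x) \<in> F)"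
    if "\<forall>(u,v)\<in>set l. smooth u \<and> smooth v" for l :: "((real^'n \<Rightarrow> complex) \<times> (real^'n \<Rightarrow> complex)) list"
  proof -
    have c: "continuous_on UNIV (\<lambda>x. \<Sum>(u,v)\<leftarrow>l. u x * v x)" using that
    proof (induction l)
      case (Cons a l)
      then show ?case
        by (cases a) (simp, intro continuous_on_add continuous_on_mult; simp add: smooth_continuous)
    qed simp
    have d: "((\<lambda>t. \<Sum>(u,v)\<leftarrow>l. u (x + t *\<^sub>R axis i 1) * v (x + t *\<^sub>R axis i 1)) has_vector_derivative
       (\<Sum>(u,v)\<leftarrow>concat (map (\<lambda>(u,v). [(u,partial i v),(partial i u,v)]) l). u x * v x)) (at 0)" for x i
      using that
    proof (induction l)
      case (Cons a l)
      then show ?case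
        by (cases a) (auto intro!: has_vector_derivative_eq_rhs[OF has_vector_derivative_add
              [OF has_vector_derivative_mult[OF has_vector_derivative_partial_0 has_vector_derivative_partial_0]]] simp: algebra_simps)
    qed simp
    have "partial i (\<lambda>x. \<Sum>(u,v)\<leftarrow>l. u x * v x) \<in> F" for i
      unfolding partial_eqI[OF d] F_def using that
      by (force intro: smooth_partial)
    then show ?thesis using c axis_diffI[OF d] by auto
  qed
  have F: "h \<in> F \<Longrightarrow> smooth h" for h
    by (erule smooth_coinduct) (auto simp: F_def dest!: * )
  show "smooth (\<lambda>x. f x * g x)"
    by (rule F) (use assms in \<open>force simp: F_def intro!: exI[of _ "[(f,g)]"]\<close>)
  show "smooth (\<lambda>x. f x + g x)"
    by (rule F) (use assms smooth_const[of 1] in \<open>force simp: F_def intro!: exI[of _ "[(f,\<lambda>x. 1), (\<lambda>x. 1, g)]"]\<close>)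
qed

lemmas smooth_mult = smooth_sum_of_products(1)
lemmas smooth_add = smooth_sum_of_products(2)

lemma smooth_cmult: "smooth f \<Longrightarrow> smooth (\<lambda>x. c * f x)"
  by (intro smooth_mult smooth_const)

lemma smooth_diff: "smooth f \<Longrightarrow> smooth g \<Longrightarrow> smooth (\<lambda>x. f x - g x)"
  using smooth_add[of f "\<lambda>x. -1 * g x"] smooth_cmult[of g "-1"] by simp

lemma Dw_add: "smooth f \<Longrightarrow> smooth g \<Longrightarrow> Dw w (\<lambda>x. f x + g x) = (\<lambda>x. Dw w f x + Dw w g x)"
  by (induction w) (auto simp: partial_add smooth_Dw)

lemma Dw_cmult: "smooth f \<Longrightarrow> Dw w (\<lambda>x. c * f x) = (\<lambda>x. c * Dw w f x)"
  by (induction w) (auto simp: partial_cmult smooth_Dw)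

lemma Dw_diff: "smooth f \<Longrightarrow> smooth g \<Longrightarrow> Dw w (\<lambda>x. f x - g x) = (\<lambda>x. Dw w f x - Dw w g x)"
  using Dw_add[of f "\<lambda>x. -1 * g x" w] Dw_cmult[of g w "-1"] smooth_cmult[of g "-1"] by simp

lemma partial_translate: "partial i (\<lambda>y. f (x + y)) = (\<lambda>y. partial i f (x + y))"
  by (simp add: partial_def add.assoc fun_eq_iff)

lemma Dw_translate: "Dw w (\<lambda>y. f (x + y)) = (\<lambda>y. Dw w f (x + y))"
  by (induction w) (auto simp: partial_translate)

lemma smooth_translate: "smooth f \<Longrightarrow> smooth (\<lambda>y. f (x + y))"
proof (rule smooth_coinduct[of _ "(\<lambda>f y. f (x + y)) ` {f. smooth f}"])
  fix g assume "g \<in> (\<lambda>f y. f (x + y)) ` {f. smooth f}"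
  then obtain f where g: "g = (\<lambda>y. f (x + y))" and f: "smooth f" by auto
  show "continuous_on UNIV g" unfolding g
    by (intro continuous_on_compose2[OF smooth_continuous[OF f]] continuous_intros) auto
  show "axis_diff g" using smooth_imp_axis_diff[OF f] by (auto simp: axis_diff_def g add.assoc[symmetric])
  show "\<And>i. partial i g \<in> (\<lambda>f y. f (x + y)) ` {f. smooth f}"
    using f by (auto simp: g partial_translate smooth_partial)
qed auto

lemma partial_scale:
  assumes "smooth f" shows "partial i (\<lambda>y. f (c *\<^sub>R y)) = (\<lambda>y. of_real c * partial i f (c *\<^sub>R y))"
proof (rule partial_eqI)
  fix x
  have "((\<lambda>t. f (c *\<^sub>R x + t *\<^sub>R axis i 1)) has_vector_derivative partial i f (c *\<^sub>R x)) (at (c * 0))"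
    using has_vector_derivative_partial_0[OF assms] by simp
  then have "((\<lambda>t. f (c *\<^sub>R x + t *\<^sub>R axis i 1)) \<circ> (\<lambda>t. c * t) has_vector_derivative c *\<^sub>R partial i f (c *\<^sub>R x)) (at 0)"
    by (intro vector_diff_chain_at) (auto intro!: derivative_eq_intros)
  then show "((\<lambda>t. f (c *\<^sub>R (x + t *\<^sub>R axis i 1))) has_vector_derivative of_real c * partial i f (c *\<^sub>R x)) (at 0)"
    by (simp add: o_def algebra_simps scaleR_conv_of_real)
qed

lemma smooth_scale:
  assumes "smooth f" shows "smooth (\<lambda>y. f (c *\<^sub>R y))"
proof (rule smooth_coinduct[of _ "(\<lambda>(a, f) y. a * f (c *\<^sub>R y)) ` (UNIV \<times> {f. smooth f})"])
  show "(\<lambda>y. f (c *\<^sub>R y)) \<in> (\<lambda>(a, f) y. a * f (c *\<^sub>R y)) ` (UNIV \<times> {f. smooth f})"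
    using assms by (auto simp: image_iff intro!: exI[of _ 1] exI[of _ f])
next
  fix g assume "g \<in> (\<lambda>(a, f) y. a * f (c *\<^sub>R y)) ` (UNIV \<times> {f. smooth f})"
  then obtain a f where g: "g = (\<lambda>y. a * f (c *\<^sub>R y))" and f: "smooth f" by auto
  show "continuous_on UNIV g" unfolding g
    by (intro continuous_on_compose2[OF smooth_continuous[OF f]] continuous_intros) auto
  have g': "g = (\<lambda>y. (\<lambda>z. a * f z) (c *\<^sub>R y))" by (simp add: g)
  have *: "((\<lambda>t. g (x + t *\<^sub>R axis i 1)) has_vector_derivative of_real c * (a * partial i f (c *\<^sub>R x))) (at 0)" for x i
  proof -
    have "((\<lambda>t. (a * f (c *\<^sub>R x + t *\<^sub>R axis i 1))) has_vector_derivative a * partial i f (c *\<^sub>R x)) (at (c * 0))"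
      using has_vector_derivative_mult_right[OF has_vector_derivative_partial_0[OF f]] by simp
    then have "((\<lambda>t. a * f (c *\<^sub>R x + t *\<^sub>R axis i 1)) \<circ> (\<lambda>t. c * t) has_vector_derivative c *\<^sub>R (a * partial i f (c *\<^sub>R x))) (at 0)"
      by (intro vector_diff_chain_at) (auto intro!: derivative_eq_intros)
    then show ?thesis
      by (simp add: o_def algebra_simps scaleR_conv_of_real g)
  qed
  show "axis_diff g" by (rule axis_diffI[OF *])
  show "partial i g \<in> (\<lambda>(a, f) y. a * f (c *\<^sub>R y)) ` (UNIV \<times> {f. smooth f})" for i
    unfolding partial_eqI[OF *] using smooth_partial[OF f]
    by (auto simp: image_iff intro!: exI[of _ "of_real c * a"] exI[of _ "partial i f"])
qed

lemma Dw_scale: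
  assumes "smooth f" shows "Dw w (\<lambda>y. f (c *\<^sub>R y)) = (\<lambda>y. of_real c ^ length w * Dw w f (c *\<^sub>R y))"
  by (induction w)
    (auto simp: partial_cmult[OF smooth_scale[OF smooth_Dw[OF assms]]] partial_scale[OF smooth_Dw[OF assms]] algebra_simps)

text \<open>All ways to distribute the letters of a word over two factors, with repetitions: the
  terms of the Leibniz rule. Their number is the source of the factors \<open>2 ^ length w\<close>
  below.\<close>

fun splits :: "'a list \<Rightarrow> ('a list \<times> 'a list) list" where
  "splits [] = [([], [])]"
| "splits (i # w) = map (\<lambda>(u, v). (u, i # v)) (splits w) @ map (\<lambda>(u, v). (i # u, v)) (splits w)"

lemma length_splits: "length (splits w) = 2 ^ length w"
  by (induction w) auto

lemma splits_length: "(u, v) \<in> set (splits w) \<Longrightarrow> length u + length v = length w"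
  by (induction w arbitrary: u v) auto

lemma Dw_mult:
  assumes "smooth f" "smooth g"
  shows "Dw w (\<lambda>x. f x * g x) = (\<lambda>x. \<Sum>(u, v)\<leftarrow>splits w. Dw u f x * Dw v g x)"
proof (induction w)
  case (Cons i w)
  have *: "partial i (\<lambda>x. \<Sum>(u, v)\<leftarrow>l. Dw u f x * Dw v g x) =
     (\<lambda>x. (\<Sum>(u, v)\<leftarrow>l. Dw u f x * Dw (i # v) g x) + (\<Sum>(u, v)\<leftarrow>l. Dw (i # u) f x * Dw v g x))"
    and "smooth (\<lambda>x. \<Sum>(u, v)\<leftarrow>l. Dw u f x * Dw v g x)" for l
    by (induction l) (auto simp: partial_const smooth_const partial_add partial_mult smooth_mult smooth_add
        smooth_Dw assms algebra_simps fun_eq_iff)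
  show ?case
    by (simp only: foldr.simps o_def Cons.IH * ) (simp add: o_def case_prod_unfold)
qed simp

subsection \<open>Order of differentiation\<close>

text \<open>Two mean value estimates: along j for \<open>partial i f\<close>, then along i for the
  difference of f at points shifted by h along j.\<close>

lemma second_difference_bound:
  fixes f :: "real^'n::finite \<Rightarrow> complex"
  assumes f: "smooth f" and "h \<ge> 0"
    and B: "\<And>s t. \<bar>s\<bar> \<le> h \<Longrightarrow> \<bar>t\<bar> \<le> h \<Longrightarrow>
       cmod (partial j (partial i f) (x + s *\<^sub>R axis i 1 + t *\<^sub>R axis j 1) - c) \<le> B"
  shows "cmod (f (x + h *\<^sub>R axis i 1 + h *\<^sub>R axis j 1) - f (x + h *\<^sub>R axis i 1) - f (x + h *\<^sub>R axis j 1) + f x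
     - of_real (h * h) * c) \<le> B * h * h"
proof -
  let ?i = "axis i (1::real)" and ?j = "axis j (1::real)"
  have 1: "cmod (partial i f (x + s *\<^sub>R ?i + h *\<^sub>R ?j) - partial i f (x + s *\<^sub>R ?i) - of_real h * c) \<le> B * h"
    if s: "\<bar>s\<bar> \<le> h" for s
  proof -
    have "cmod ((partial i f (x + s *\<^sub>R ?i + h *\<^sub>R ?j) - h *\<^sub>R c) - (partial i f (x + s *\<^sub>R ?i + 0 *\<^sub>R ?j) - 0 *\<^sub>R c)) \<le> B * \<bar>h\<bar>"
    proof (rule real_mean_value_bound)
      fix t assume t: "\<bar>t\<bar> \<le> \<bar>h\<bar>"
      show "((\<lambda>t. partial i f (x + s *\<^sub>R ?i + t *\<^sub>R ?j) - t *\<^sub>R c) has_vector_derivative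
         partial j (partial i f) (x + s *\<^sub>R ?i + t *\<^sub>R ?j) - c) (at t)"
        by (auto intro!: derivative_eq_intros has_vector_derivative_partial smooth_partial f)
      show "cmod (partial j (partial i f) (x + s *\<^sub>R ?i + t *\<^sub>R ?j) - c) \<le> B"
        using s t \<open>h \<ge> 0\<close> by (intro B) auto
    qed
    then show ?thesis using \<open>h \<ge> 0\<close> by (simp add: scaleR_conv_of_real algebra_simps)
  qed
  have "cmod ((f (x + h *\<^sub>R ?j + h *\<^sub>R ?i) - f (x + h *\<^sub>R ?i) - h *\<^sub>R (of_real h * c)) -
      (f (x + h *\<^sub>R ?j + 0 *\<^sub>R ?i) - f (x + 0 *\<^sub>R ?i) - 0 *\<^sub>R (of_real h * c))) \<le> (B * h) * \<bar>h\<bar>"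
  proof (rule real_mean_value_bound)
    fix s assume s: "\<bar>s\<bar> \<le> \<bar>h\<bar>"
    show "((\<lambda>s. f (x + h *\<^sub>R ?j + s *\<^sub>R ?i) - f (x + s *\<^sub>R ?i) - s *\<^sub>R (of_real h * c)) has_vector_derivative
       partial i f (x + h *\<^sub>R ?j + s *\<^sub>R ?i) - partial i f (x + s *\<^sub>R ?i) - of_real h * c) (at s)"
      by (auto intro!: derivative_eq_intros has_vector_derivative_partial smooth_partial f)
    show "cmod (partial i f (x + h *\<^sub>R ?j + s *\<^sub>R ?i) - partial i f (x + s *\<^sub>R ?i) - of_real h * c) \<le> B * h"
      using 1[of s] s \<open>h \<ge> 0\<close> by (simp add: algebra_simps)
  qed
  then show ?thesis using \<open>h \<ge> 0\<close> by (simp add: scaleR_conv_of_real algebra_simps)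
qed

text \<open>Schwarz's theorem. The second difference is symmetric in i and j and lies within e h^2
  of h^2 times either mixed derivative at x, so these differ by at most 2 e.\<close>

lemma partial_commute:
  fixes f :: "real^'n::finite \<Rightarrow> complex"
  assumes f: "smooth f"
  shows "partial i (partial j f) = partial j (partial i f)"
proof
  fix x
  let ?a = "partial j (partial i f)" and ?b = "partial i (partial j f)"
  have "cmod (?a x - ?b x) \<le> 2 * e" if "e > 0" for e
  proof -
    have "continuous_on UNIV ?a" "continuous_on UNIV ?b"
      by (auto intro!: smooth_continuous smooth_partial f)
    then have "isCont ?a x" "isCont ?b x"
      by (auto simp: continuous_on_eq_continuous_at)
    then obtain d1 d2 where d: "d1 > 0" "d2 > 0"
      "\<And>y. dist y x < d1 \<Longrightarrow> dist (?a y) (?a x) < e" "\<And>y. dist y x < d2 \<Longrightarrow> dist (?b y) (?b x) < e"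
      using \<open>e > 0\<close> unfolding continuous_at_eps_delta by metis
    \<comment> \<open>A third of the radius, because the points involved have distance up to 2 h
      from x.\<close>
    define h where "h = min d1 d2 / 3"
    have h: "h > 0" using d by (auto simp: h_def)
    have n: "dist (x + s *\<^sub>R axis k 1 + t *\<^sub>R axis l 1) x < min d1 d2"
      if "\<bar>s\<bar> \<le> h" "\<bar>t\<bar> \<le> h" for s t and k l :: 'n
    proof -
      have "dist (x + s *\<^sub>R axis k 1 + t *\<^sub>R axis l 1) x \<le> \<bar>s\<bar> + \<bar>t\<bar>"
        using norm_triangle_ineq[of "s *\<^sub>R axis k (1::real)" "t *\<^sub>R axis l 1"]
        by (simp add: dist_norm algebra_simps)
      then show ?thesis using that h by (auto simp: h_def)
    qed
    let ?D = "f (x + h *\<^sub>R axis i 1 + h *\<^sub>R axis j 1) - f (x + h *\<^sub>R axis i 1) - f (x + h *\<^sub>R axis j 1) + f x"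
    have A: "cmod (?D - of_real (h * h) * ?a x) \<le> e * h * h"
      by (rule second_difference_bound[OF f]) (use h d n in \<open>auto simp: dist_norm intro!: less_imp_le\<close>)
    have "cmod (f (x + h *\<^sub>R axis j 1 + h *\<^sub>R axis i 1) - f (x + h *\<^sub>R axis j 1) - f (x + h *\<^sub>R axis i 1) + f x
       - of_real (h * h) * ?b x) \<le> e * h * h"
      by (rule second_difference_bound[OF f]) (use h d n in \<open>auto simp: dist_norm intro!: less_imp_le\<close>)
    then have Bb: "cmod (?D - of_real (h * h) * ?b x) \<le> e * h * h"
      by (simp add: algebra_simps)
    have "cmod (of_real (h * h) * (?a x - ?b x)) \<le> 2 * (e * h * h)"
      using norm_triangle_ineq4[of "?D - of_real (h * h) * ?b x" "?D - of_real (h * h) * ?a x"] A Bb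
      by (simp add: algebra_simps)
    then have "(h * h) * cmod (?a x - ?b x) \<le> (h * h) * (2 * e)"
      unfolding norm_mult norm_of_real using h by (simp add: mult_ac)
    then show ?thesis using h by simp
  qed
  then have "cmod (?a x - ?b x) \<le> 0 + e" if "e > 0" for e
    using that by (metis add_0 field_sum_of_halves half_gt_zero mult_2)
  then have "cmod (?a x - ?b x) \<le> 0" by (rule field_le_epsilon)
  then show "?b x = ?a x" by simp
qed

lemma Dw_partial_commute: "smooth f \<Longrightarrow> Dw w (partial i f) = partial i (Dw w f)"
proof (induction w)
  case (Cons j w)
  then show ?case using partial_commute[OF smooth_Dw[OF Cons.prems], of j i w] by simp
qed simp

lemma Dw_mset_cong:
  assumes "smooth f" "mset u = mset v"
  shows "Dw u f = Dw v f"
  using assms(2)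
proof (induction u arbitrary: v)
  case (Cons i u)
  then have "i \<in> set v" by (metis list.set_intros(1) mset_eq_setD)
  then obtain a b where v: "v = a @ i # b" by (meson split_list)
  have "mset u = mset (a @ b)" using Cons.prems by (simp add: v)
  then have "Dw u f = Dw (a @ b) f" by (rule Cons.IH)
  then show ?case by (simp add: v Dw_partial_commute[symmetric] smooth_Dw assms)
qed simp

section \<open>Multi-indices and words\<close>

definition multiword :: "('n::finite \<Rightarrow> nat) \<Rightarrow> 'n list" where
  "multiword \<alpha> = concat (map (\<lambda>i. replicate (\<alpha> i) i) coords)"

lemma coords: "distinct (coords :: 'n::finite list)" "set (coords :: 'n list) = UNIV"
proof -
  have "\<exists>is :: 'n list. distinct is \<and> set is = UNIV"
    using finite_distinct_list[OF finite_class.finite_UNIV] by blast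
  then have "distinct (coords :: 'n list) \<and> set (coords :: 'n list) = UNIV"
    unfolding coords_def by (rule someI_ex)
  then show "distinct (coords :: 'n::finite list)" "set (coords :: 'n list) = UNIV" by auto
qed

lemma mderiv_eq_Dw:
  fixes f :: "real^'n::finite \<Rightarrow> complex"
  shows "mderiv \<alpha> f = Dw (multiword \<alpha>) f"
proof -
  have "foldr partial (replicate n i) g = (partial i ^^ n) g" for n i and g :: "real^'n \<Rightarrow> complex"
    by (induction n) auto
  then have "foldr (\<lambda>i. partial i ^^ \<alpha> i) l g = foldr partial (concat (map (\<lambda>i. replicate (\<alpha> i) i) l)) g"
    for l and g :: "real^'n \<Rightarrow> complex"
    by (induction l) auto
  then show ?thesis by (simp add: mderiv_def multiword_def)
qed

lemma length_multiword: "length (multiword \<alpha>) = mlength \<alpha>"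
  by (simp add: multiword_def mlength_def length_concat o_def coords sum_list_distinct_conv_sum_set)

lemma count_multiword: "count (mset (multiword \<alpha>)) = \<alpha>"
proof
  fix i
  have "count (mset (concat (map (\<lambda>i. replicate (\<alpha> i) i) l))) i = (if i \<in> set l then \<alpha> i else 0)" if "distinct l" for l
    using that by (induction l) auto
  then show "count (mset (multiword \<alpha>)) i = \<alpha> i" by (simp add: multiword_def coords)
qed

lemma Dw_eq_mderiv:
  assumes "smooth f"
  shows "Dw w f = mderiv (count (mset w)) f"
  unfolding mderiv_eq_Dw by (rule Dw_mset_cong[OF assms]) (simp add: count_multiword multiset_eq_iff)

lemma mlength_count: "mlength (count (mset w)) = length w"
proof -
  have "mset (multiword (count (mset w))) = mset w"
    by (rule multiset_eqI) (simp add: count_multiword)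
  then show ?thesis using length_multiword[of "count (mset w)"] size_mset by metis
qed

section \<open>Weight functions\<close>

locale weight =
  fixes \<omega> :: "real \<Rightarrow> real"
  assumes weight: "nonquasianalytic_weight \<omega>"
    and ln_smallo: "(\<lambda>t. ln (1 + t)) \<in> o[at_top](\<omega>)"
begin

lemma \<omega>_mono: "0 \<le> s \<Longrightarrow> s \<le> t \<Longrightarrow> \<omega> s \<le> \<omega> t"
  using weight unfolding nonquasianalytic_weight_def by (auto simp: mono_on_def)

lemma \<omega>_nonneg: "0 \<le> t \<Longrightarrow> 0 \<le> \<omega> t"
  using weight unfolding nonquasianalytic_weight_def by auto

lemma \<omega>_zero: "0 \<le> t \<Longrightarrow> t \<le> 1 \<Longrightarrow> \<omega> t = 0"
  using weight unfolding nonquasianalytic_weight_def by auto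

lemma \<omega>_continuous: "continuous_on {0..} \<omega>"
  using weight unfolding nonquasianalytic_weight_def by auto

lemma \<omega>_convex: "convex_on UNIV (\<lambda>t. \<omega> (exp t))"
  using weight unfolding nonquasianalytic_weight_def by auto

abbreviation wt :: "'a::real_normed_vector \<Rightarrow> real" where
  "wt x \<equiv> \<omega> (norm x)"

abbreviation growth :: "nat \<Rightarrow> 'a::real_normed_vector \<Rightarrow> real" where
  "growth n x \<equiv> exp (real n * wt x)"

abbreviation decay :: "nat \<Rightarrow> 'a::real_normed_vector \<Rightarrow> real" where
  "decay n x \<equiv> exp (- (real n * wt x))"

lemma wt_nonneg: "0 \<le> wt x"
  by (simp add: \<omega>_nonneg)

lemma wt_continuous: "continuous_on UNIV (\<lambda>x::'a::real_normed_vector. wt x)"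
  by (rule continuous_on_compose2[OF \<omega>_continuous]) (auto intro: continuous_intros)

text \<open>The constant of the doubling condition, rounded up to a natural number so that
  \<open>n * K\<close> is again the index of a step.\<close>

definition K :: nat where
  "K = (SOME K. 1 \<le> K \<and> (\<forall>t\<ge>0. \<omega> (2 * t) \<le> real K * (1 + \<omega> t)))"

lemma K: "1 \<le> K" "0 \<le> t \<Longrightarrow> \<omega> (2 * t) \<le> real K * (1 + \<omega> t)"
proof -
  obtain k where k: "\<forall>t\<ge>0. \<omega> (2 * t) \<le> k * (1 + \<omega> t)"
    using weight unfolding nonquasianalytic_weight_def by auto
  have "\<omega> (2 * t) \<le> real (max 1 (nat \<lceil>k\<rceil>)) * (1 + \<omega> t)" if "t \<ge> 0" for t
  proof -
    have "k \<le> real (max 1 (nat \<lceil>k\<rceil>))" by linarith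
    then have "k * (1 + \<omega> t) \<le> real (max 1 (nat \<lceil>k\<rceil>)) * (1 + \<omega> t)"
      using \<omega>_nonneg[OF that] by (intro mult_right_mono) auto
    then show ?thesis using k that by fastforce
  qed
  then have "1 \<le> max 1 (nat \<lceil>k\<rceil>) \<and> (\<forall>t\<ge>0. \<omega> (2 * t) \<le> real (max 1 (nat \<lceil>k\<rceil>)) * (1 + \<omega> t))"
    by simp
  then have "1 \<le> K \<and> (\<forall>t\<ge>0. \<omega> (2 * t) \<le> real K * (1 + \<omega> t))"
    unfolding K_def by (rule someI)
  then show "1 \<le> K" "0 \<le> t \<Longrightarrow> \<omega> (2 * t) \<le> real K * (1 + \<omega> t)" by auto
qed

text \<open>The substitute for subadditivity: \<bar>x\<bar> + \<bar>y\<bar> is at most twice the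
  larger norm, and doubling applies.\<close>

lemma wt_le_add:
  assumes "norm z \<le> norm x + norm y"
  shows "wt z \<le> real K * (1 + wt x + wt y)"
proof -
  have "wt z \<le> \<omega> (2 * max (norm x) (norm y))"
    using assms by (intro \<omega>_mono) auto
  also have "\<dots> \<le> real K * (1 + \<omega> (max (norm x) (norm y)))"
    by (rule K) (simp add: le_max_iff_disj)
  also have "\<dots> \<le> real K * (1 + wt x + wt y)"
    using wt_nonneg[of x] wt_nonneg[of y] by (intro mult_left_mono) (auto simp: max_def)
  finally show ?thesis .
qed

lemma wt_add: "wt (x + y) \<le> real K * (1 + wt x + wt y)"
  by (intro wt_le_add norm_triangle_ineq)

lemma wt_add_unit: "norm y \<le> 1 \<Longrightarrow> wt (x + y) \<le> real K * (1 + wt x)"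
  using wt_add[of x y] by (simp add: \<omega>_zero)

lemma exp_wt_add: "growth n (x + y) \<le> exp (real (n * K)) * growth (n * K) x * growth (n * K) y"
  using mult_left_mono[OF wt_add[of x y], of "real n"] by (simp add: exp_add[symmetric] algebra_simps)

text \<open>Doubling is iterated until 2^n exceeds H. Each iteration turns L into 2 K L; the factor
  2 comes from 1 \<le> L (1 + \<omega> t).\<close>

lemma \<omega>_dilation:
  assumes "0 \<le> H"
  shows "\<exists>L::nat. 1 \<le> L \<and> (\<forall>t\<ge>0. \<omega> (H * t) \<le> real L * (1 + \<omega> t))"
proof -
  have *: "\<exists>L::nat. 1 \<le> L \<and> (\<forall>t\<ge>0. \<omega> (2 ^ n * t) \<le> real L * (1 + \<omega> t))" for n
  proof (induction n)
    case 0
    then show ?case by (intro exI[of _ 1]) auto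
  next
    case (Suc n)
    then obtain L where L: "1 \<le> L" "\<And>t. t \<ge> 0 \<Longrightarrow> \<omega> (2 ^ n * t) \<le> real L * (1 + \<omega> t)" by auto
    have "\<omega> (2 ^ Suc n * t) \<le> real (2 * K * L) * (1 + \<omega> t)" if "t \<ge> 0" for t
    proof -
      have 1: "1 * 1 \<le> real L * (1 + \<omega> t)"
        using L(1) \<omega>_nonneg[OF that] by (intro mult_mono) auto
      have "\<omega> (2 ^ Suc n * t) \<le> real K * (1 + \<omega> (2 ^ n * t))"
        using K(2)[of "2 ^ n * t"] that by (simp add: mult.assoc)
      also have "\<dots> \<le> real K * (2 * (real L * (1 + \<omega> t)))"
        using L(2)[OF that] 1 by (intro mult_left_mono) auto
      finally show ?thesis by (simp add: mult_ac)
    qed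
    then show ?case using L(1) K(1) by (intro exI[of _ "2 * K * L"]) auto
  qed
  obtain n where n: "H < 2 ^ n" using real_arch_pow[of 2 H] by auto
  obtain L where L: "1 \<le> L" "\<And>t. t \<ge> 0 \<Longrightarrow> \<omega> (2 ^ n * t) \<le> real L * (1 + \<omega> t)" using * by blast
  have "\<omega> (H * t) \<le> real L * (1 + \<omega> t)" if "t \<ge> 0" for t
  proof -
    have "\<omega> (H * t) \<le> \<omega> (2 ^ n * t)" using assms that n by (intro \<omega>_mono mult_right_mono) auto
    then show ?thesis using L(2)[OF that] by simp
  qed
  then show ?thesis using L(1) by blast
qed

lemma ln_le_\<omega>:
  assumes "c > 0"
  shows "\<exists>C. \<forall>t\<ge>0. ln (1 + t) \<le> C + c * \<omega> t"
proof -
  have "\<forall>\<^sub>F t in at_top. norm (ln (1 + t)) \<le> c * norm (\<omega> t)"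
    using ln_smallo assms by (auto dest: landau_o.smallD)
  then obtain T where T: "\<And>t. t \<ge> T \<Longrightarrow> \<bar>ln (1 + t)\<bar> \<le> c * \<bar>\<omega> t\<bar>"
    unfolding eventually_at_top_linorder by auto
  have "ln (1 + t) \<le> ln (1 + \<bar>T\<bar>) + c * \<omega> t" if "t \<ge> 0" for t
  proof (cases "t \<ge> T")
    case True
    have "0 \<le> ln (1 + \<bar>T\<bar>)" by simp
    then show ?thesis using T[OF True] \<omega>_nonneg[OF that] by (smt (verit))
  next
    case False
    then have "ln (1 + t) \<le> ln (1 + \<bar>T\<bar>)" using that by (intro ln_mono) auto
    then show ?thesis using \<omega>_nonneg[OF that] assms by (simp add: add_increasing2)
  qed
  then show ?thesis by blast
qed

text \<open>The little-o condition with c = 1 / (p + 1), multiplied by p + 1 and exponentiated.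
  Using p + 1 in place of p avoids a division by zero.\<close>

lemma power_le_exp_\<omega>: "\<exists>C>0. \<forall>t\<ge>0. (1 + t) ^ p \<le> C * exp (\<omega> t)"
proof -
  obtain C where C: "\<And>t. t \<ge> 0 \<Longrightarrow> ln (1 + t) \<le> C + (1 / real (Suc p)) * \<omega> t"
    using ln_le_\<omega>[of "1 / real (Suc p)"] by auto
  have "(1 + t) ^ p \<le> exp (real (Suc p) * C) * exp (\<omega> t)" if "t \<ge> 0" for t
  proof -
    have "(1 + t) ^ p \<le> (1 + t) ^ Suc p" using that by (intro power_increasing) auto
    also have "\<dots> = exp (real (Suc p) * ln (1 + t))"
      using that by (subst exp_of_nat_mult) simp
    also have "\<dots> \<le> exp (real (Suc p) * (C + (1 / real (Suc p)) * \<omega> t))"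
      using C[OF that] by (simp only: exp_le_cancel_iff mult_left_mono of_nat_0_le_iff)
    also have "\<dots> = exp (real (Suc p) * C) * exp (\<omega> t)"
      by (simp only: distrib_left exp_add) simp
    finally show ?thesis .
  qed
  then show ?thesis by (intro exI[of _ "exp (real (Suc p) * C)"]) auto
qed

text \<open>Non-quasianalyticity makes the tails of the integral small, and
  \<open>\<omega> n / (5 n)\<close> is a lower bound for the integral over \<open>[n, 2n]\<close>.\<close>
lemma \<omega>_sublinear:
  assumes "\<delta> > 0"
  shows "\<exists>C\<ge>0. \<forall>t\<ge>0. \<omega> t \<le> C + \<delta> * t"
proof -
  define h where "h t = indicator {1..} t *\<^sub>R (\<omega> t / (1 + t\<^sup>2))" for t :: real
  have h: "integrable lborel h"
    using weight unfolding nonquasianalytic_weight_def set_integrable_def h_def by auto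
  have h0: "h t \<ge> 0" for t
    unfolding h_def by (auto intro!: mult_nonneg_nonneg divide_nonneg_nonneg \<omega>_nonneg simp: indicator_def)
  have "(\<lambda>n. LINT t|lborel. indicator {real n..} t *\<^sub>R h t) \<longlonglongrightarrow> integral\<^sup>L lborel (\<lambda>t::real. 0::real)"
  proof (rule integral_dominated_convergence[of "\<lambda>t. 0" lborel "\<lambda>n t. indicator {real n..} t *\<^sub>R h t" h])
    show "integrable lborel h" by (rule h)
    show "AE t in lborel. (\<lambda>n. indicator {real n..} t *\<^sub>R h t) \<longlonglongrightarrow> 0"
    proof (rule AE_I2)
      fix t :: real
      obtain N :: nat where "t < real N" using reals_Archimedean2 by blast
      then have "\<forall>\<^sub>F n in sequentially. indicator {real n..} t *\<^sub>R h t = 0"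
        unfolding eventually_sequentially by (intro exI[of _ N]) (auto simp: indicator_def)
      then show "(\<lambda>n. indicator {real n..} t *\<^sub>R h t) \<longlonglongrightarrow> 0" by (rule tendsto_eventually)
    qed
    show "AE t in lborel. norm (indicator {real n..} t *\<^sub>R h t) \<le> h t" for n
      using h0 by (intro AE_I2) (auto simp: indicator_def)
  qed (use h in \<open>auto intro: borel_measurable_integrable\<close>)
  then have "(\<lambda>n. LINT t|lborel. indicator {real n..} t *\<^sub>R h t) \<longlonglongrightarrow> 0" by simp
  then have "\<forall>\<^sub>F n in sequentially. (LINT t|lborel. indicator {real n..} t *\<^sub>R h t) < \<delta> / 5"
    by (rule order_tendstoD) (use assms in auto)
  then obtain N where N: "\<And>n. n \<ge> N \<Longrightarrow> (LINT t|lborel. indicator {real n..} t *\<^sub>R h t) < \<delta> / 5"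
    unfolding eventually_sequentially by auto
  have 1: "\<omega> (real n) \<le> \<delta> * real n" if n: "n \<ge> N" "n \<ge> 1" for n
  proof -
    let ?c = "\<omega> (real n) / (1 + (2 * real n)\<^sup>2)"
    have "(LINT t|lborel. indicator {real n..2 * real n} t *\<^sub>R ?c) \<le> (LINT t|lborel. indicator {real n..} t *\<^sub>R h t)"
    proof (rule integral_mono)
      show "integrable lborel (\<lambda>t. indicator {real n..} t *\<^sub>R h t)"
        using integrable_mult_indicator[OF _ h, of "{real n..}"] by simp
      show "indicator {real n..2 * real n} t *\<^sub>R ?c \<le> indicator {real n..} t *\<^sub>R h t" for t
      proof (cases "t \<in> {real n..2 * real n}")
        case True
        then have "?c \<le> \<omega> t / (1 + t\<^sup>2)"
          by (intro frac_le \<omega>_mono \<omega>_nonneg add_left_mono power_mono) (auto intro: add_pos_nonneg)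
        then show ?thesis using True n by (auto simp: h_def)
      next
        case False
        then show ?thesis using h0[of t] by auto
      qed
    qed (simp add: integrable_mult_left)
    then have "real n * ?c \<le> (LINT t|lborel. indicator {real n..} t *\<^sub>R h t)" by simp
    then have "real n * ?c < \<delta> / 5" using N[OF n(1)] by linarith
    moreover have "1 + (2 * real n)\<^sup>2 \<le> 5 * (real n)\<^sup>2" using n by (simp add: power_mult_distrib)
    ultimately have "real n * \<omega> (real n) < (\<delta> / 5) * (1 + (2 * real n)\<^sup>2)"
      by (simp add: pos_divide_less_eq add_pos_nonneg)
    also have "\<dots> \<le> (\<delta> / 5) * (5 * (real n)\<^sup>2)"
      using \<open>1 + _ \<le> _\<close> assms by (intro mult_left_mono) auto
    finally show ?thesis using n by (simp add: power2_eq_square mult.left_commute)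
  qed
  \<comment> \<open>Up to N + 1 monotonicity suffices; beyond, rounding t up to an integer costs one
    additional \<delta>.\<close>
  have "\<omega> t \<le> (\<omega> (real (Suc N)) + \<delta>) + \<delta> * t" if t: "t \<ge> 0" for t
  proof (cases "t \<le> real (Suc N)")
    case True
    then show ?thesis using \<omega>_mono[OF t True] assms t by (auto intro: add_increasing2)
  next
    case False
    let ?n = "nat \<lceil>t\<rceil>"
    have n: "t \<le> real ?n" "real ?n \<le> t + 1" "?n \<ge> N" "?n \<ge> 1" using False t by linarith+
    have "\<omega> t \<le> \<omega> (real ?n)" using n t by (intro \<omega>_mono) auto
    also have "\<dots> \<le> \<delta> * real ?n" using 1 n by blast
    also have "\<dots> \<le> \<delta> * (t + 1)" using n assms by (intro mult_left_mono) auto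
    finally show ?thesis using \<omega>_nonneg[of "real (Suc N)"] by (simp add: algebra_simps)
  qed
  then show ?thesis using assms \<omega>_nonneg[of "real (Suc N)"]
    by (intro exI[of _ "\<omega> (real (Suc N)) + \<delta>"]) auto
qed

subsection \<open>The weight sequences\<close>

text \<open>In the notation of the paper, \<open>W m k\<close> is \<open>exp (m \<phi>\<^sup>*(k / m))\<close>; substituting
  \<open>R = e\<^sup>t\<close> in the Young conjugate avoids all reference to \<open>\<phi>\<^sup>*\<close>.\<close>
definition W :: "nat \<Rightarrow> nat \<Rightarrow> real" where
  "W m k = (SUP R\<in>{1..}. R ^ k * exp (- (real m * \<omega> R)))"

lemma W_bdd: "1 \<le> m \<Longrightarrow> bdd_above ((\<lambda>R. R ^ k * exp (- (real m * \<omega> R))) ` {1..})"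
proof -
  assume m: "1 \<le> m"
  obtain C where C: "C > 0" "\<And>t. t \<ge> 0 \<Longrightarrow> (1 + t) ^ k \<le> C * exp (\<omega> t)"
    using power_le_exp_\<omega> by blast
  have "R ^ k * exp (- (real m * \<omega> R)) \<le> C" if "R \<ge> 1" for R
  proof -
    have "R ^ k \<le> (1 + R) ^ k" using that by (intro power_mono) auto
    also have "\<dots> \<le> C * exp (\<omega> R)" using C that by auto
    also have "\<dots> \<le> C * exp (real m * \<omega> R)"
      using m C mult_right_mono[of 1 "real m" "\<omega> R"] \<omega>_nonneg[of R] that by auto
    finally have "R ^ k * exp (- (real m * \<omega> R)) \<le> C * exp (real m * \<omega> R) * exp (- (real m * \<omega> R))"
      by (rule mult_right_mono) auto
    also have "\<dots> = C" by (simp add: exp_minus)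
    finally show ?thesis .
  qed
  then show ?thesis by (auto intro!: bdd_aboveI2)
qed

lemma W_upper: "1 \<le> m \<Longrightarrow> 1 \<le> R \<Longrightarrow> R ^ k * exp (- (real m * \<omega> R)) \<le> W m k"
  unfolding W_def by (rule cSUP_upper[OF _ W_bdd]) auto

lemma W_least: "(\<And>R. 1 \<le> R \<Longrightarrow> R ^ k * exp (- (real m * \<omega> R)) \<le> B) \<Longrightarrow> W m k \<le> B"
  unfolding W_def by (rule cSUP_least) auto

text \<open>The point R = 1, where \<open>\<omega>\<close> vanishes by the normalization.\<close>

lemma W_ge_1: "1 \<le> m \<Longrightarrow> 1 \<le> W m k"
  using W_upper[of m 1 k] by (simp add: \<omega>_zero)

lemma W_pos: "1 \<le> m \<Longrightarrow> 0 < W m k"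
  using W_ge_1[of m k] by simp

lemma W_antimono:
  assumes "1 \<le> m" "m \<le> m'"
  shows "W m' k \<le> W m k"
proof (rule W_least)
  fix R :: real assume R: "1 \<le> R"
  have "R ^ k * exp (- (real m' * \<omega> R)) \<le> R ^ k * exp (- (real m * \<omega> R))"
    using assms R \<omega>_nonneg[of R] by (intro mult_left_mono) (auto intro: mult_right_mono)
  then show "R ^ k * exp (- (real m' * \<omega> R)) \<le> W m k" using W_upper[OF assms(1) R, of k] by simp
qed

text \<open>Both factors are compared at max R S: the powers only grow there, and
  \<open>\<omega>\<close> takes just one of its two values. No loss in m occurs, so Leibniz terms of
  the same total order share one bound.\<close>

lemma W_mult_le:
  assumes "1 \<le> m"
  shows "W m j * W m k \<le> W m (j + k)"
proof -
  have *: "(R ^ j * exp (- (real m * \<omega> R))) * (S ^ k * exp (- (real m * \<omega> S))) \<le> W m (j + k)"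
    if R: "1 \<le> R" and S: "1 \<le> S" for R S
  proof -
    let ?M = "max R S"
    have "\<omega> ?M \<le> \<omega> R + \<omega> S" using \<omega>_nonneg[of R] \<omega>_nonneg[of S] R S by (auto simp: max_def)
    then have "real m * \<omega> ?M \<le> real m * \<omega> R + real m * \<omega> S"
      by (simp add: distrib_left[symmetric] mult_left_mono)
    moreover have "R ^ j * S ^ k \<le> ?M ^ j * ?M ^ k"
      using R S by (intro mult_mono power_mono) auto
    ultimately have "(R ^ j * S ^ k) * exp (- (real m * \<omega> R) - real m * \<omega> S) \<le> ?M ^ (j + k) * exp (- (real m * \<omega> ?M))"
      using R by (intro mult_mono) (auto simp: power_add)
    also have "\<dots> \<le> W m (j + k)" using R by (intro W_upper assms) auto
    finally show ?thesis by (simp add: exp_diff exp_minus field_simps)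
  qed
  have 1: "(R ^ j * exp (- (real m * \<omega> R))) * W m k \<le> W m (j + k)" if "1 \<le> R" for R
  proof -
    have "W m k \<le> W m (j + k) / (R ^ j * exp (- (real m * \<omega> R)))"
      using *[OF that] that by (intro W_least) (auto simp: pos_le_divide_eq mult_ac)
    then show ?thesis using that by (simp add: pos_le_divide_eq mult_ac)
  qed
  have "W m j \<le> W m (j + k) / W m k"
    using 1 W_pos[OF assms, of k] by (intro W_least) (auto simp: pos_le_divide_eq)
  then show ?thesis using W_pos[OF assms, of k] by (simp add: pos_le_divide_eq)
qed

text \<open>The reverse inequality costs a factor 2 in m, since the exponential of -2 m \<omega> has
  to be shared by the two powers. It separates the orders when a derivative is differentiated
  further.\<close>

lemma W_add_le:
  assumes "1 \<le> m"
  shows "W (2 * m) (j + k) \<le> W m j * W m k"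
proof (rule W_least)
  fix R :: real assume R: "1 \<le> R"
  have "R ^ (j + k) * exp (- (real (2 * m) * \<omega> R)) = (R ^ j * exp (- (real m * \<omega> R))) * (R ^ k * exp (- (real m * \<omega> R)))"
    by (simp add: power_add exp_add[symmetric] mult_ac)
  also have "\<dots> \<le> W m j * W m k"
    using R W_upper[OF assms R] W_pos[OF assms, of j] by (intro mult_mono) auto
  finally show "R ^ (j + k) * exp (- (real (2 * m) * \<omega> R)) \<le> W m j * W m k" .
qed

text \<open>A factor H^k is a dilation of R by H, and dilations change \<open>\<omega>\<close> by at
  most a factor L and a constant; so M = m L. Geometric factors are thus free as long as all m are
  at one's disposal.\<close>

lemma W_geometric:
  assumes "1 \<le> m" "1 \<le> H"
  shows "\<exists>M\<ge>m. \<exists>C>0. \<forall>k. H ^ k * W M k \<le> C * W m k"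
proof -
  obtain L :: nat where L: "1 \<le> L" "\<And>t. t \<ge> 0 \<Longrightarrow> \<omega> (H * t) \<le> real L * (1 + \<omega> t)"
    using \<omega>_dilation[of H] assms by auto
  have "H ^ k * W (m * L) k \<le> exp (real (m * L)) * W m k" for k
  proof -
    have "W (m * L) k \<le> exp (real (m * L)) * W m k / H ^ k"
    proof (rule W_least)
      fix R :: real assume R: "1 \<le> R"
      have HR: "1 \<le> H * R" using mult_mono[of 1 H 1 R] assms R by auto
      have "real m * \<omega> (H * R) \<le> real (m * L) + real (m * L) * \<omega> R"
        using mult_left_mono[OF L(2)[of R], of "real m"] R by (simp add: algebra_simps)
      then have "exp (- (real (m * L) * \<omega> R)) \<le> exp (real (m * L)) * exp (- (real m * \<omega> (H * R)))"
        by (simp add: exp_add[symmetric])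
      then have "(H * R) ^ k * exp (- (real (m * L) * \<omega> R)) \<le> (H * R) ^ k * (exp (real (m * L)) * exp (- (real m * \<omega> (H * R))))"
        using HR by (intro mult_left_mono) auto
      also have "\<dots> \<le> exp (real (m * L)) * W m k"
        using W_upper[OF assms(1) HR, of k] by (simp add: mult_ac)
      finally show "R ^ k * exp (- (real (m * L) * \<omega> R)) \<le> exp (real (m * L)) * W m k / H ^ k"
        using assms by (simp add: pos_le_divide_eq power_mult_distrib mult_ac)
    qed
    then show ?thesis using assms by (simp add: pos_le_divide_eq mult_ac)
  qed
  then show ?thesis using L(1) assms
    by (intro exI[of _ "m * L"] conjI exI[of _ "exp (real (m * L))"]) auto
qed

text \<open>The supremum is tested at R = k e^3. Sublinearity with slope e^-3 / m makes m
  \<omega>(R) at most m C + k, which leaves k^k e^(3k - k), and this dominates k! e^k. Gaussians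
  satisfy the derivative bounds for this reason.\<close>

lemma fact_le_W:
  assumes "1 \<le> m"
  shows "\<exists>C>0. \<forall>k. fact k * exp (real k) \<le> C * W m k"
proof -
  obtain C where C: "C \<ge> 0" "\<And>t. t \<ge> 0 \<Longrightarrow> \<omega> t \<le> C + (exp (-3) / real m) * t"
    using \<omega>_sublinear[of "exp (-3) / real m"] assms by auto
  have "fact k * exp (real k) \<le> exp (real m * C) * W m k" for k
  proof (cases "k = 0")
    case True
    have "1 * 1 \<le> exp (real m * C) * W m 0"
      using W_ge_1[OF assms] C(1) by (intro mult_mono) auto
    then show ?thesis using True by simp
  next
    case False
    define R where "R = real k * exp 3"
    have R: "1 \<le> R" unfolding R_def using False mult_mono[of 1 "real k" 1 "exp 3"] by auto
    have "real m * \<omega> R \<le> real m * (C + (exp (-3) / real m) * R)"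
      using C(2)[of R] R by (intro mult_left_mono) auto
    also have "\<dots> = real m * C + real k" using assms by (simp add: R_def distrib_left exp_minus)
    finally have *: "exp (- (real m * C) - real k) \<le> exp (- (real m * \<omega> R))" by simp
    have "fact k \<le> real k ^ k" using fact_le_power[of k, where 'a=real] by simp
    then have "fact k * exp (real k) \<le> real k ^ k * exp (2 * real k)"
      by (intro mult_mono) auto
    also have "\<dots> = exp (real m * C) * (R ^ k * exp (- (real m * C) - real k))"
      by (simp add: R_def power_mult_distrib exp_of_nat_mult[symmetric] exp_add[symmetric] mult.left_commute[of "exp _"] mult.assoc)
    also have "\<dots> \<le> exp (real m * C) * (R ^ k * exp (- (real m * \<omega> R)))"
      using * R by (intro mult_left_mono) auto
    also have "\<dots> \<le> exp (real m * C) * W m k"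
      using W_upper[OF assms R, of k] by simp
    finally show ?thesis .
  qed
  then show ?thesis by (intro exI[of _ "exp (real m * C)"]) auto
qed

text \<open>\<open>s\<close> is a subgradient of \<open>\<phi>\<close> at \<open>ln R\<close>; rounding \<open>m s\<close> to an integer costs one factor \<open>R\<close>.\<close>
lemma W_inf:
  assumes "1 \<le> m" "1 \<le> R"
  shows "\<exists>k. W m k \<le> R ^ k * R * exp (- (real m * \<omega> R))"
proof -
  define t where "t = ln R"
  have t: "t \<ge> 0" "exp t = R" using assms by (auto simp: t_def)
  obtain s where s: "\<And>y. \<omega> (exp y) \<ge> \<omega> (exp t) + s * (y - t)"
    using convex_le_Inf_differential[OF \<omega>_convex, of t] by auto
  \<comment> \<open>Monotonicity of \<open>\<omega>\<close> makes the subgradient nonnegative, so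
    that its rounding is a derivative order.\<close>
  have s0: "s \<ge> 0" using s[of "t - 1"] \<omega>_mono[of "exp (t - 1)" "exp t"] by simp
  define k where "k = nat \<lfloor>real m * s\<rfloor>"
  have "0 \<le> real m * s" using s0 by simp
  then have k: "real k \<le> real m * s" "real m * s \<le> real k + 1" unfolding k_def by linarith+
  have "W m k \<le> R ^ k * R * exp (- (real m * \<omega> R))"
  proof (rule W_least)
    fix S :: real assume S: "1 \<le> S"
    define u where "u = ln S"
    have u: "u \<ge> 0" "exp u = S" using S by (auto simp: u_def)
    have "real k * u \<le> real m * s * u" using k u by (intro mult_right_mono) auto
    moreover have "real m * (\<omega> R + s * (u - t)) \<le> real m * \<omega> S"
      using s[of u] u t by (intro mult_left_mono) auto
    moreover have "real m * s * t \<le> (real k + 1) * t" using k t by (intro mult_right_mono) auto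
    ultimately have "real k * u - real m * \<omega> S \<le> real k * t + t - real m * \<omega> R"
      by (simp add: algebra_simps)
    then have "exp (real k * u - real m * \<omega> S) \<le> exp (real k * t + t - real m * \<omega> R)" by simp
    then show "S ^ k * exp (- (real m * \<omega> S)) \<le> R ^ k * R * exp (- (real m * \<omega> R))"
      unfolding u(2)[symmetric] t(2)[symmetric] exp_of_nat_mult[symmetric] exp_add[symmetric]
      by (simp add: algebra_simps)
  qed
  then show ?thesis by blast
qed

text \<open>Both sides have the same real upper bounds, by the substitution R = e^t. In particular
  the conjugate is finite at these arguments, so \<open>real_of_ereal\<close> in
  \<open>exp_ereal\<close> loses nothing.\<close>

lemma young_conj_eq:
  assumes "1 \<le> m"
  shows "young_conj \<omega> (real k / real m) = ereal (ln (W m k) / real m)"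
proof -
  let ?Y = "young_conj \<omega> (real k / real m)"
  have *: "(\<forall>t\<ge>0. real k / real m * t - \<omega> (exp t) \<le> y) \<longleftrightarrow> W m k \<le> exp (real m * y)" for y
  proof -
    have e: "exp t ^ k * exp (- (real m * \<omega> (exp t))) \<le> exp (real m * y) \<longleftrightarrow>
        real k / real m * t - \<omega> (exp t) \<le> y" for t
    proof -
      have "exp t ^ k * exp (- (real m * \<omega> (exp t))) = exp (real m * (real k / real m * t - \<omega> (exp t)))"
        using assms by (simp add: exp_of_nat_mult[symmetric] exp_add[symmetric] algebra_simps)
      then show ?thesis using assms by simp
    qed
    show ?thesis
    proof
      assume L: "\<forall>t\<ge>0. real k / real m * t - \<omega> (exp t) \<le> y"
      show "W m k \<le> exp (real m * y)"
      proof (rule W_least)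
        fix R :: real assume "1 \<le> R"
        then have "0 \<le> ln R" "exp (ln R) = R" by auto
        then show "R ^ k * exp (- (real m * \<omega> R)) \<le> exp (real m * y)"
          using e[of "ln R"] L by metis
      qed
    next
      assume "W m k \<le> exp (real m * y)"
      then show "\<forall>t\<ge>0. real k / real m * t - \<omega> (exp t) \<le> y"
        using W_upper[OF assms] e by (meson one_le_exp_iff order_trans)
    qed
  qed
  have Y: "?Y \<le> ereal y \<longleftrightarrow> W m k \<le> exp (real m * y)" for y
    unfolding *[symmetric] young_conj_def by (auto simp: SUP_le_iff)
  have "?Y \<le> ereal (ln (W m k) / real m)"
    unfolding Y using assms W_pos[OF assms, of k] by simp
  moreover have "ereal (ln (W m k) / real m) \<le> ?Y"
  proof (rule ereal_le_real)
    fix z assume "?Y \<le> ereal z"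
    then have "ln (W m k) \<le> real m * z"
      unfolding Y using W_pos[OF assms, of k] by (metis ln_exp ln_le_cancel_iff exp_gt_zero)
    then show "ereal (ln (W m k) / real m) \<le> ereal z" using assms by (simp add: pos_divide_le_eq mult.commute)
  qed
  ultimately show ?thesis by (rule antisym)
qed

lemma exp_ereal_young_conj:
  assumes "1 \<le> m"
  shows "exp_ereal (- ereal a - ereal (real m) * young_conj \<omega> (real k / real m)) = exp (- a) / W m k"
    and "exp_ereal (- (ereal (real m) * young_conj \<omega> (real k / real m))) = 1 / W m k"
  using assms W_pos[OF assms, of k]
  by (simp_all add: young_conj_eq exp_ereal_def exp_diff exp_minus field_simps)

subsection \<open>Integrability\<close>

text \<open>In dimension N, exp(-\<omega>) is at most C (1 + \<bar>x\<bar>)^-(N + 2). The points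
  with k \<le> \<bar>x\<bar> \<le> k + 1 lie in a cube of volume (2 (k + 1))^N, which leaves the
  convergent series of (k + 1)^-2.\<close>

lemma exp_wt_integrable: "integrable lborel (\<lambda>x::'a::euclidean_space. exp (- wt x))"
proof -
  let ?N = "DIM('a)"
  obtain C where C: "C > 0" "\<And>t. t \<ge> 0 \<Longrightarrow> (1 + t) ^ (?N + 2) \<le> C * exp (\<omega> t)"
    using power_le_exp_\<omega> by blast
  have m: "(\<lambda>x::'a. exp (- wt x)) \<in> borel_measurable lborel"
    using wt_continuous by (auto intro!: borel_measurable_continuous_onI continuous_intros)
  define a where "a k = C * (1 / real (Suc k)) ^ (?N + 2)" for k
  have a0: "a k \<ge> 0" for k using C by (simp add: a_def)
  have le: "ennreal (exp (- wt x)) \<le> (\<Sum>k. ennreal (a k) * indicator (cball 0 (real (Suc k))) x)" for x :: 'a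
  proof -
    define k where "k = nat \<lfloor>norm x\<rfloor>"
    have k: "real k \<le> norm x" "norm x \<le> real (Suc k)"
      unfolding k_def using norm_ge_zero[of x] by linarith+
    have "real (Suc k) ^ (?N + 2) \<le> C * exp (wt x)"
      by (rule order_trans[OF power_mono C(2)]) (use k in auto)
    then have "exp (- wt x) \<le> a k"
      using C(1) by (simp add: a_def exp_minus power_one_over divide_simps del: of_nat_Suc power_Suc power_Suc2 power_add_numeral)
    then have "ennreal (exp (- wt x)) \<le> ennreal (a k) * indicator (cball 0 (real (Suc k))) x"
      using k by (simp add: ennreal_leI indicator_def dist_norm)
    also have "\<dots> \<le> (\<Sum>k. ennreal (a k) * indicator (cball 0 (real (Suc k))) x)"
    proof -
      have "f k \<le> suminf f" for f :: "nat \<Rightarrow> ennreal"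
        using sum_le_suminf[of f "{k}"] by simp
      from this[of "\<lambda>k. ennreal (a k) * indicator (cball 0 (real (Suc k))) x"] show ?thesis .
    qed
    finally show ?thesis .
  qed
  have "(\<integral>\<^sup>+x. ennreal (norm (exp (- wt (x::'a)))) \<partial>lborel) \<le>
      (\<integral>\<^sup>+x. (\<Sum>k. ennreal (a k) * indicator (cball 0 (real (Suc k))) x) \<partial>(lborel::'a measure))"
    using le by (intro nn_integral_mono) simp
  also have "\<dots> = (\<Sum>k. ennreal (a k) * emeasure lborel (cball (0::'a) (real (Suc k))))"
  proof (subst nn_integral_suminf)
    show "(\<lambda>x::'a. ennreal (a i) * indicator (cball 0 (real (Suc i))) x) \<in> borel_measurable lborel" for i
      by (intro borel_measurable_times_ennreal borel_measurable_const borel_measurable_indicator) auto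
  qed (simp add: nn_integral_cmult_indicator)
  also have "\<dots> \<le> (\<Sum>k. ennreal (C * 2 ^ ?N * inverse (real (Suc k) ^ 2)))"
  proof (rule suminf_le)
    fix k
    let ?r = "real (Suc k)"
    have "emeasure lborel (cball (0::'a) ?r) \<le> emeasure lborel (cbox (- ?r *\<^sub>R One) (?r *\<^sub>R One :: 'a))"
    proof (rule emeasure_mono)
      show "cball (0::'a) ?r \<subseteq> cbox (- ?r *\<^sub>R One) (?r *\<^sub>R One)"
        using Basis_le_norm[where 'a='a] by (auto simp: mem_box inner_simps dist_norm) (smt (verit))+
    qed auto
    also have "\<dots> = ennreal ((2 * ?r) ^ ?N)"
      by (subst emeasure_lborel_cbox) (auto simp: inner_simps)
    finally have "ennreal (a k) * emeasure lborel (cball (0::'a) ?r) \<le> ennreal (a k) * ennreal ((2 * ?r) ^ ?N)"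
      by (rule mult_left_mono) simp
    also have "\<dots> = ennreal (a k * (2 * ?r) ^ ?N)" using a0 by (simp add: ennreal_mult)
    also have "a k * (2 * ?r) ^ ?N = C * 2 ^ ?N * inverse (?r ^ 2)"
      unfolding a_def by (simp add: power_add power_one_over power_mult_distrib power2_eq_square field_simps del: of_nat_Suc)
    finally show "ennreal (a k) * emeasure lborel (cball (0::'a) ?r) \<le> ennreal (C * 2 ^ ?N * inverse (?r ^ 2))" .
  qed auto
  also have "\<dots> < \<infinity>"
  proof -
    have "summable (\<lambda>k. C * 2 ^ ?N * inverse (real (Suc k) ^ 2))"
      by (intro summable_mult, subst summable_Suc_iff) (rule inverse_power_summable, simp)
    then show ?thesis using C by (subst suminf_ennreal2) auto
  qed
  finally show ?thesis using m by (intro integrableI_bounded) auto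
qed

lemma integrable_exp_wt_bound:
  fixes f :: "'a::euclidean_space \<Rightarrow> 'b::{banach,second_countable_topology}"
  assumes "f \<in> borel_measurable lborel" "\<And>x. norm (f x) \<le> C * exp (- wt x)"
  shows "integrable lborel f" "norm (integral\<^sup>L lborel f) \<le> C * (LINT x|lborel. exp (- wt (x::'a)))"
proof -
  have i: "integrable lborel (\<lambda>x::'a. C * exp (- wt x))"
    by (intro integrable_mult_right exp_wt_integrable)
  show "integrable lborel f"
    using assms(2) by (intro Bochner_Integration.integrable_bound[OF i assms(1)] AE_I2)
      (metis abs_ge_self order_trans real_norm_def)
  then show "norm (integral\<^sup>L lborel f) \<le> C * (LINT x|lborel. exp (- wt (x::'a)))"
    using order_trans[OF integral_norm_bound[of lborel f] integral_mono[OF _ i, of "\<lambda>x. norm (f x)"]] assms(2)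
    by simp
qed

end

section \<open>The function spaces in terms of uniform bounds\<close>

context weight
begin

text \<open>A common real-valued form of the two families of norms: \<open>r_norm\<close> bounded by
  C is the case v = C \<open>growth n\<close>, and \<open>q_norm\<close> bounded by C the case v = C
  \<open>decay n\<close>. Estimates can then avoid extended reals.\<close>

definition UB :: "nat \<Rightarrow> (real^'n::finite \<Rightarrow> real) \<Rightarrow> (real^'n \<Rightarrow> complex) \<Rightarrow> bool" where
  "UB m v f \<longleftrightarrow> (\<forall>w x. cmod (Dw w f x) \<le> v x * W m (length w))"

lemma UB_D: "UB m v f \<Longrightarrow> cmod (Dw w f x) \<le> v x * W m (length w)"
  by (simp add: UB_def)

lemma UB_I: "(\<And>w x. cmod (Dw w f x) \<le> v x * W m (length w)) \<Longrightarrow> UB m v f"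
  by (simp add: UB_def)

lemma UB_nonneg:
  assumes "1 \<le> m" "UB m v f" shows "0 \<le> v x"
proof -
  have "0 \<le> v x * W m 0" using UB_D[OF assms(2), of "[]" x] by (metis list.size(3) norm_ge_zero order_trans)
  then show ?thesis using W_pos[OF assms(1), of 0] by (simp add: zero_le_mult_iff)
qed

lemma UB_mono:
  fixes f :: "real^'n::finite \<Rightarrow> complex"
  assumes "1 \<le> m'" "m' \<le> m" "UB m v f" "\<And>x. v x \<le> v' x"
  shows "UB m' v' f"
proof (rule UB_I)
  fix w :: "'n list" and x
  have m: "1 \<le> m" using assms by simp
  have "v x * W m (length w) \<le> v' x * W m' (length w)"
    using assms(4)[of x] UB_nonneg[OF m assms(3), of x] W_antimono[OF assms(1,2), of "length w"] W_pos[OF m, of "length w"]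
    by (intro mult_mono) auto
  then show "cmod (Dw w f x) \<le> v' x * W m' (length w)" using UB_D[OF assms(3), of w x] by linarith
qed

lemma UB_add: "smooth f \<Longrightarrow> smooth g \<Longrightarrow> UB m u f \<Longrightarrow> UB m v g \<Longrightarrow> UB m (\<lambda>x. u x + v x) (\<lambda>x. f x + g x)"
  unfolding UB_def by (simp add: Dw_add distrib_right) (meson add_mono norm_triangle_ineq order_trans)

lemma UB_cmult: "smooth f \<Longrightarrow> UB m v f \<Longrightarrow> UB m (\<lambda>x. cmod c * v x) (\<lambda>x. c * f x)"
  unfolding UB_def by (simp add: Dw_cmult norm_mult mult.assoc mult_left_mono)

lemma UB_Dw:
  fixes f :: "real^'n::finite \<Rightarrow> complex"
  assumes "1 \<le> m" "UB (2 * m) v f"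
  shows "UB m (\<lambda>x. W m (length u) * v x) (Dw u f)"
proof (rule UB_I)
  fix w :: "'n list" and x
  have "cmod (Dw w (Dw u f) x) \<le> v x * W (2 * m) (length w + length u)"
    using UB_D[OF assms(2), of "w @ u" x] by simp
  also have "\<dots> \<le> v x * (W m (length w) * W m (length u))"
    using UB_nonneg[OF _ assms(2)] assms(1) by (intro mult_left_mono W_add_le) auto
  finally show "cmod (Dw w (Dw u f) x) \<le> W m (length u) * v x * W m (length w)"
    by (simp add: mult_ac)
qed

lemma UB_translate: "UB m v f \<Longrightarrow> UB m (\<lambda>y. v (x + y)) (\<lambda>y. f (x + y))"
  unfolding UB_def by (simp add: Dw_translate)

text \<open>Every Leibniz term has the same bound by \<open>W_mult_le\<close>, and there are
  \<open>2 ^ length w\<close> terms. The statement concerns one point x, because the reconstruction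
  from the Fourier side controls its factors only at 0.\<close>

lemma Dw_mult_bound:
  assumes "1 \<le> m" "smooth f" "smooth g"
    and "\<And>w. cmod (Dw w f x) \<le> u * W m (length w)" "\<And>w. cmod (Dw w g x) \<le> v * W m (length w)"
  shows "cmod (Dw w (\<lambda>x. f x * g x) x) \<le> u * v * (2 ^ length w * W m (length w))"
proof -
  have u: "0 \<le> u" using assms(4)[of "[]"] W_pos[OF assms(1), of 0]
    by (metis list.size(3) norm_ge_zero order_trans zero_le_mult_iff not_le)
  have v: "0 \<le> v" using assms(5)[of "[]"] W_pos[OF assms(1), of 0]
    by (metis list.size(3) norm_ge_zero order_trans zero_le_mult_iff not_le)
  have "cmod (\<Sum>(a, b)\<leftarrow>l. Dw a f x * Dw b g x) \<le> length l * (u * v * W m (length w))"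
    if "\<forall>(a, b)\<in>set l. length a + length b = length w" for l
    using that
  proof (induction l)
    case (Cons p l)
    obtain a b where p: "p = (a, b)" by (cases p)
    have "cmod (Dw a f x * Dw b g x) \<le> (u * W m (length a)) * (v * W m (length b))"
      unfolding norm_mult using u W_pos[OF assms(1)]
      by (intro mult_mono assms(4,5) mult_nonneg_nonneg) (auto intro: less_imp_le)
    also have "\<dots> = u * v * (W m (length a) * W m (length b))" by simp
    also have "\<dots> \<le> u * v * W m (length w)"
      using W_mult_le[OF assms(1), of "length a" "length b"] u v Cons.prems p by (intro mult_left_mono) auto
    finally have "cmod (Dw a f x * Dw b g x + (\<Sum>(a, b)\<leftarrow>l. Dw a f x * Dw b g x))
        \<le> u * v * W m (length w) + length l * (u * v * W m (length w))"
      using Cons by (intro norm_triangle_le add_mono) auto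
    then show ?case by (simp add: p algebra_simps)
  qed simp
  from this[of "splits w"] show ?thesis
    using assms(2,3) splits_length[where w=w] by (auto simp: Dw_mult length_splits algebra_simps)
qed

text \<open>Passing from m to a larger M absorbs the number of Leibniz terms, a geometric
  factor.\<close>

lemma UB_mult:
  assumes "1 \<le> m"
  shows "\<exists>M\<ge>m. \<exists>C>0. \<forall>f g u v. smooth f \<longrightarrow> smooth g \<longrightarrow> UB M u f \<longrightarrow> UB M v g \<longrightarrow>
     UB m (\<lambda>x::real^'n::finite. C * (u x * v x)) (\<lambda>x. f x * g x)"
proof -
  obtain M C where MC: "M \<ge> m" "C > 0" "\<And>k. 2 ^ k * W M k \<le> C * W m k"
    using W_geometric[OF assms, of 2] by auto
  have "UB m (\<lambda>x. C * (u x * v x)) (\<lambda>x. f x * g x)"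
    if *: "smooth f" "smooth g" "UB M u f" "UB M v g" for f g :: "real^'n \<Rightarrow> complex" and u v
  proof (rule UB_I)
    fix w :: "'n list" and x
    have M: "1 \<le> M" using MC assms by simp
    have "cmod (Dw w (\<lambda>x. f x * g x) x) \<le> u x * v x * (2 ^ length w * W M (length w))"
      using * by (intro Dw_mult_bound M) (auto simp: UB_D)
    also have "\<dots> \<le> u x * v x * (C * W m (length w))"
      using UB_nonneg[OF M *(3)] UB_nonneg[OF M *(4)] by (intro mult_left_mono MC) auto
    finally show "cmod (Dw w (\<lambda>x. f x * g x) x) \<le> C * (u x * v x) * W m (length w)" by (simp add: mult_ac)
  qed
  then show ?thesis using MC by blast
qed

subsection \<open>The spaces \<open>ON n\<close> and \<open>Q_set\<close>\<close>

definition ON :: "nat \<Rightarrow> (real^'n::finite \<Rightarrow> complex) set" where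
  "ON n = {f. smooth f \<and> (\<forall>m\<ge>1. \<exists>C. UB m (\<lambda>x. C * growth n x) f)}"

text \<open>The functions for which all \<open>q_norm\<close> are finite. A priori this is more than
  \<open>S_set \<omega>\<close> asks for, since there each derivative has its own constant.\<close>

definition Q_set :: "(real^'n::finite \<Rightarrow> complex) set" where
  "Q_set = {f. smooth f \<and> (\<forall>m\<ge>1. \<forall>n. \<exists>C. UB m (\<lambda>x. C * decay n x) f)}"

definition OC :: "(real^'n::finite \<Rightarrow> complex) set" where
  "OC = (\<Union>n\<in>{1..}. ON n)"

lemma ON_smooth: "f \<in> ON n \<Longrightarrow> smooth f"
  by (simp add: ON_def)

lemma Q_set_smooth: "f \<in> Q_set \<Longrightarrow> smooth f"
  by (simp add: Q_set_def)

lemma OC_smooth: "f \<in> OC \<Longrightarrow> smooth f"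
  by (auto simp: OC_def ON_def)

lemma ON_D: "f \<in> ON n \<Longrightarrow> 1 \<le> m \<Longrightarrow> \<exists>C. UB m (\<lambda>x. C * growth n x) f"
  by (simp add: ON_def)

lemma Q_set_D: "f \<in> Q_set \<Longrightarrow> 1 \<le> m \<Longrightarrow> \<exists>C. UB m (\<lambda>x. C * decay n x) f"
  by (simp add: Q_set_def)

lemma UB_const_nonneg: "1 \<le> m \<Longrightarrow> UB m (\<lambda>x. C * exp (g x)) f \<Longrightarrow> 0 \<le> C"
  using UB_nonneg[of m _ f undefined] by (fastforce simp: zero_le_mult_iff)

lemma ON_mono: assumes "n \<le> n'" shows "(ON n :: (real^'n::finite \<Rightarrow> complex) set) \<subseteq> ON n'"
proof
  fix f :: "real^'n \<Rightarrow> complex" assume f: "f \<in> ON n"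
  have "\<exists>C. UB m (\<lambda>x. C * exp (real n' * wt x)) f" if m: "1 \<le> m" for m
  proof -
    obtain C where C: "UB m (\<lambda>x. C * growth n x) f" using ON_D[OF f m] by blast
    have "UB m (\<lambda>x. C * exp (real n' * wt x)) f"
      using UB_const_nonneg[OF m C] assms
      by (intro UB_mono[OF m _ C] mult_left_mono) (auto intro: mult_right_mono wt_nonneg)
    then show ?thesis by blast
  qed
  then show "f \<in> ON n'" using f by (simp add: ON_def)
qed

lemma Q_set_subset_ON: "(Q_set :: (real^'n::finite \<Rightarrow> complex) set) \<subseteq> ON n"
proof
  fix f :: "real^'n \<Rightarrow> complex" assume f: "f \<in> Q_set"
  have "\<exists>C. UB m (\<lambda>x. C * growth n x) f" if m: "1 \<le> m" for m
  proof -
    obtain C where C: "UB m (\<lambda>x. C * decay 0 x) f" using Q_set_D[OF f m] by blast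
    have "UB m (\<lambda>x. C * growth n x) f"
      using UB_const_nonneg[OF m C]
      by (intro UB_mono[OF m _ C] mult_left_mono) (auto intro: mult_nonneg_nonneg wt_nonneg)
    then show ?thesis by blast
  qed
  then show "f \<in> ON n" using f by (simp add: ON_def Q_set_smooth)
qed

lemma Q_set_subset_OC: "Q_set \<subseteq> OC"
  using Q_set_subset_ON[of 1] by (auto simp: OC_def)

lemma ON_add: assumes "f \<in> ON n" "g \<in> ON n" shows "(\<lambda>x. f x + g x) \<in> ON n"
proof -
  have "\<exists>C. UB m (\<lambda>x. C * growth n x) (\<lambda>x. f x + g x)" if m: "1 \<le> m" for m
  proof -
    obtain C D where "UB m (\<lambda>x. C * growth n x) f" "UB m (\<lambda>x. D * growth n x) g"
      using ON_D assms m by metis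
    then have "UB m (\<lambda>x. C * growth n x + D * growth n x) (\<lambda>x. f x + g x)"
      by (intro UB_add ON_smooth[OF assms(1)] ON_smooth[OF assms(2)])
    then show ?thesis unfolding distrib_right[symmetric] by blast
  qed
  then show ?thesis using assms by (simp add: ON_def smooth_add)
qed

lemma ON_cmult: assumes "f \<in> ON n" shows "(\<lambda>x. c * f x) \<in> ON n"
proof -
  have "\<exists>C. UB m (\<lambda>x. C * growth n x) (\<lambda>x. c * f x)" if m: "1 \<le> m" for m
  proof -
    obtain C where "UB m (\<lambda>x. C * growth n x) f" using ON_D assms m by metis
    then have "UB m (\<lambda>x. cmod c * (C * growth n x)) (\<lambda>x. c * f x)"
      by (intro UB_cmult ON_smooth[OF assms(1)])
    then show ?thesis unfolding mult.assoc[symmetric] by blast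
  qed
  then show ?thesis using assms by (simp add: ON_def smooth_cmult)
qed

lemma OC_obtain2:
  assumes "f \<in> OC" "g \<in> OC" obtains n where "1 \<le> n" "f \<in> ON n" "g \<in> ON n"
proof -
  obtain a b where ab: "1 \<le> a" "f \<in> ON a" "1 \<le> b" "g \<in> ON b" using assms by (auto simp: OC_def)
  show thesis by (rule that[of "max a b"]) (use ab ON_mono[of a "max a b"] ON_mono[of b "max a b"] in auto)
qed

lemma OC_add: assumes "f \<in> OC" "g \<in> OC" shows "(\<lambda>x. f x + g x) \<in> OC"
proof -
  obtain n where "1 \<le> n" "f \<in> ON n" "g \<in> ON n" using OC_obtain2[OF assms] .
  then show ?thesis using ON_add[of f n g] by (auto simp: OC_def)
qed

lemma OC_cmult: "f \<in> OC \<Longrightarrow> (\<lambda>x. c * f x) \<in> OC"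
  using ON_cmult by (fastforce simp: OC_def)

lemma OC_diff: "f \<in> OC \<Longrightarrow> g \<in> OC \<Longrightarrow> (\<lambda>x. f x - g x) \<in> OC"
  using OC_add[of f "\<lambda>x. -1 * g x"] OC_cmult[of g "-1"] by simp

lemma Q_set_add: assumes "f \<in> Q_set" "g \<in> Q_set" shows "(\<lambda>x. f x + g x) \<in> Q_set"
proof -
  have "\<exists>C. UB m (\<lambda>x. C * decay n x) (\<lambda>x. f x + g x)" if m: "1 \<le> m" for m n
  proof -
    obtain C D where "UB m (\<lambda>x. C * decay n x) f" "UB m (\<lambda>x. D * decay n x) g"
      using Q_set_D assms m by metis
    then have "UB m (\<lambda>x. C * decay n x + D * decay n x) (\<lambda>x. f x + g x)"
      by (intro UB_add Q_set_smooth[OF assms(1)] Q_set_smooth[OF assms(2)])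
    then show ?thesis unfolding distrib_right[symmetric] by blast
  qed
  then show ?thesis using assms by (simp add: Q_set_def smooth_add)
qed

lemma Q_set_cmult: assumes "f \<in> Q_set" shows "(\<lambda>x. c * f x) \<in> Q_set"
proof -
  have "\<exists>C. UB m (\<lambda>x. C * decay n x) (\<lambda>x. c * f x)" if m: "1 \<le> m" for m n
  proof -
    obtain C where "UB m (\<lambda>x. C * decay n x) f" using Q_set_D assms m by metis
    then have "UB m (\<lambda>x. cmod c * (C * decay n x)) (\<lambda>x. c * f x)"
      by (intro UB_cmult Q_set_smooth[OF assms(1)])
    then show ?thesis unfolding mult.assoc[symmetric] by blast
  qed
  then show ?thesis using assms by (simp add: Q_set_def smooth_cmult)
qed

lemma ON_Dw: assumes "f \<in> ON n" shows "Dw u f \<in> ON n"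
proof -
  have "\<exists>C. UB m (\<lambda>x. C * growth n x) (Dw u f)" if m: "1 \<le> m" for m
  proof -
    obtain C where "UB (2 * m) (\<lambda>x. C * growth n x) f" using ON_D[OF assms, of "2 * m"] m by auto
    from UB_Dw[OF m this] show ?thesis unfolding mult.assoc[symmetric] by blast
  qed
  then show ?thesis using assms by (simp add: ON_def smooth_Dw)
qed

lemma OC_Dw: "f \<in> OC \<Longrightarrow> Dw u f \<in> OC"
  using ON_Dw by (fastforce simp: OC_def)

lemma Q_set_Dw: assumes "f \<in> Q_set" shows "Dw u f \<in> Q_set"
proof -
  have "\<exists>C. UB m (\<lambda>x. C * decay n x) (Dw u f)" if m: "1 \<le> m" for m n
  proof -
    obtain C where "UB (2 * m) (\<lambda>x. C * decay n x) f" using Q_set_D[OF assms, of "2 * m"] m by fastforce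
    from UB_Dw[OF m this] show ?thesis unfolding mult.assoc[symmetric] by blast
  qed
  then show ?thesis using assms by (simp add: Q_set_def smooth_Dw)
qed

text \<open>Every decay rate p survives, because f decays at rate p + n. With a Gaussian as f this
  is how functions of \<open>OC\<close> are localized.\<close>

lemma Q_set_mult_ON:
  assumes f: "f \<in> Q_set" and g: "g \<in> ON n"
  shows "(\<lambda>x. f x * g x) \<in> Q_set"
proof -
  have "\<exists>C. UB m (\<lambda>x. C * decay p x) (\<lambda>x. f x * g x)" if m: "1 \<le> m" for m p
  proof -
    obtain M C where MC: "M \<ge> m" "\<And>u v. UB M u f \<Longrightarrow> UB M v g \<Longrightarrow> UB m (\<lambda>x. C * (u x * v x)) (\<lambda>x. f x * g x)"
      using UB_mult[OF m] Q_set_smooth[OF f] ON_smooth[OF g] by metis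
    have M: "1 \<le> M" using MC m by simp
    obtain A B where "UB M (\<lambda>x. A * decay (p + n) x) f" "UB M (\<lambda>x. B * growth n x) g"
      using Q_set_D[OF f M] ON_D[OF g M] by metis
    from MC(2)[OF this] have "UB m (\<lambda>x. C * A * B * decay p x) (\<lambda>x. f x * g x)"
      by (rule UB_mono[OF m order.refl]) (simp add: mult.commute mult.left_commute exp_add[symmetric] algebra_simps)
    then show ?thesis by blast
  qed
  then show ?thesis using Q_set_smooth[OF f] ON_smooth[OF g] by (simp add: Q_set_def smooth_mult)
qed

subsection \<open>Translations\<close>

lemma UB_translate_exp:
  assumes m: "1 \<le> m" and f: "UB m (\<lambda>x. A * growth n x) f"
  shows "UB m (\<lambda>y. A * exp (real (n * K)) * growth (n * K) x * growth (n * K) y) (\<lambda>y. f (x + y))"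
proof (rule UB_mono[OF m order.refl UB_translate[OF f]])
  show "A * growth n (x + y) \<le> A * exp (real (n * K)) * growth (n * K) x * growth (n * K) y" for y
    using mult_left_mono[OF exp_wt_add[of n x y] UB_const_nonneg[OF m f]] by (simp add: mult_ac)
qed

lemma ON_translate: assumes "f \<in> ON n" shows "(\<lambda>y. f (x + y)) \<in> ON (n * K)"
  unfolding ON_def using ON_D[OF assms] UB_translate_exp smooth_translate[OF ON_smooth[OF assms]] by blast

lemma OC_translate: assumes "f \<in> OC" shows "(\<lambda>y. f (x + y)) \<in> OC"
proof -
  obtain n where "1 \<le> n" "f \<in> ON n" using assms by (auto simp: OC_def)
  then show ?thesis using ON_translate[of f n x] K(1) by (auto simp: OC_def intro!: bexI[of _ "n * K"])
qed

subsection \<open>Comparison with the norms\<close>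

lemma r_norm_le_iff:
  assumes "1 \<le> m" "smooth f"
  shows "r_norm \<omega> m n f \<le> ereal C \<longleftrightarrow> UB m (\<lambda>x. C * growth n x) f"
proof -
  have "r_norm \<omega> m n f \<le> ereal C \<longleftrightarrow>
    (\<forall>\<alpha> x. cmod (mderiv \<alpha> f x) * (decay n x / W m (mlength \<alpha>)) \<le> C)"
    unfolding r_norm_def exp_ereal_young_conj(1)[OF assms(1)] by (simp add: SUP_le_iff)
  also have "\<dots> \<longleftrightarrow> (\<forall>\<alpha> x. cmod (mderiv \<alpha> f x) \<le> C * growth n x * W m (mlength \<alpha>))"
    using W_pos[OF assms(1)] by (simp add: exp_minus field_simps)
  also have "\<dots> \<longleftrightarrow> UB m (\<lambda>x. C * growth n x) f"
    unfolding UB_def mderiv_eq_Dw length_multiword[symmetric]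
    by (metis Dw_eq_mderiv[OF assms(2)] mderiv_eq_Dw length_multiword mlength_count)
  finally show ?thesis .
qed

lemma q_norm_le_iff:
  assumes "1 \<le> m" "smooth f"
  shows "q_norm \<omega> m n f \<le> ereal C \<longleftrightarrow> UB m (\<lambda>x. C * decay n x) f"
proof -
  have *: "a * ereal (1 / c) \<le> ereal b \<longleftrightarrow> a \<le> ereal (b * c)" if "c > 0" for a b c
    using that by (cases a) (auto simp: field_simps)
  have "q_norm \<omega> m n f \<le> ereal C \<longleftrightarrow>
    (\<forall>\<alpha> x. growth n x * cmod (mderiv \<alpha> f x) \<le> C * W m (mlength \<alpha>))"
    unfolding q_norm_def exp_ereal_young_conj(2)[OF assms(1)]
    by (simp add: SUP_le_iff * W_pos[OF assms(1)] del: times_ereal.simps)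
  also have "\<dots> \<longleftrightarrow> (\<forall>\<alpha> x. cmod (mderiv \<alpha> f x) \<le> C * decay n x * W m (mlength \<alpha>))"
    by (simp add: exp_minus field_simps)
  also have "\<dots> \<longleftrightarrow> UB m (\<lambda>x. C * decay n x) f"
    unfolding UB_def mderiv_eq_Dw length_multiword[symmetric]
    by (metis Dw_eq_mderiv[OF assms(2)] mderiv_eq_Dw length_multiword mlength_count)
  finally show ?thesis .
qed

lemma r_norm_nonneg: assumes "1 \<le> m" "smooth f" shows "0 \<le> r_norm \<omega> m n f"
proof (rule ereal_le_real)
  fix C assume "r_norm \<omega> m n f \<le> ereal C"
  then show "0 \<le> ereal C" using UB_const_nonneg assms by (auto simp: r_norm_le_iff)
qed

lemma ON_eq: "((\<Inter>m\<in>{1..}. O_mn_set \<omega> m n) :: (real^'n::finite \<Rightarrow> complex) set) = ON n"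
proof -
  have "r_norm \<omega> m n f < \<infinity> \<longleftrightarrow> (\<exists>C. UB m (\<lambda>x. C * growth n x) f)" if "1 \<le> m" "smooth f" for m and f :: "real^'n \<Rightarrow> complex"
    using r_norm_nonneg[OF that, of n] unfolding r_norm_le_iff[OF that, symmetric]
    by (cases "r_norm \<omega> m n f") auto
  then show ?thesis by (fastforce simp: O_mn_set_def ON_def set_eq_iff)
qed

subsection \<open>Gaussians\<close>

text \<open>The parameter covers the window (s = -1) and its reciprocal (s = 1), with which the
  window is divided out again after inversion.\<close>

definition gauss :: "real \<Rightarrow> real^'n::finite \<Rightarrow> complex" where
  "gauss s x = of_real (exp (s * (x \<bullet> x) / 2))"

end

lemma power_le_fact_exp: "x \<ge> 0 \<Longrightarrow> x ^ k \<le> fact k * exp (x::real)"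
proof -
  assume x: "x \<ge> 0"
  have "(\<Sum>n\<in>{k}. x ^ n /\<^sub>R fact n) \<le> exp x"
    unfolding exp_def using x by (intro sum_le_suminf summable_exp_generic) auto
  then show ?thesis by (simp add: field_simps)
qed

lemma has_vector_derivative_coordinate:
  "((\<lambda>t. complex_of_real ((x + t *\<^sub>R axis j 1) $ i)) has_vector_derivative of_bool (i = j)) (at t)"
proof -
  have "((\<lambda>t. (x + t *\<^sub>R axis j 1) $ i) has_vector_derivative of_bool (i = j)) (at t)"
    by (auto simp: axis_def intro!: derivative_eq_intros)
  from has_vector_derivative_of_real[OF this[folded has_real_derivative_iff_has_vector_derivative]]
  show ?thesis by (cases "i = j") (simp_all add: axis_def)
qed

lemma partial_coordinate: "partial j (\<lambda>x. complex_of_real (x $ i)) = (\<lambda>x. of_bool (i = j))"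
  by (intro partial_eqI has_vector_derivative_coordinate)

lemma smooth_coordinate: "smooth (\<lambda>x::real^'n::finite. complex_of_real (x $ i))"
proof (rule smooth_coinduct[of _ "insert (\<lambda>x::real^'n. complex_of_real (x $ i)) {f. smooth f}"], safe)
  show "continuous_on UNIV (\<lambda>x::real^'n. complex_of_real (x $ i))" by (intro continuous_intros)
  show "axis_diff (\<lambda>x::real^'n. complex_of_real (x $ i))"
    by (rule axis_diffI[OF has_vector_derivative_coordinate])
qed (auto simp: partial_coordinate smooth_const smooth_continuous smooth_imp_axis_diff smooth_partial)

text \<open>The commutator of a derivative with multiplication by a coordinate: one term for each
  letter of w equal to i, namely w with that letter removed.\<close>

lemma Dw_coordinate_mult:
  assumes "smooth f"
  shows "\<exists>L. length L \<le> length w \<and> (\<forall>u\<in>set L. Suc (length u) = length w) \<and>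
    Dw w (\<lambda>x. of_real (x $ i) * f x) = (\<lambda>x. of_real (x $ i) * Dw w f x + (\<Sum>u\<leftarrow>L. Dw u f x))"
proof (induction w)
  case (Cons j w)
  then obtain L where L: "length L \<le> length w" "\<forall>u\<in>set L. Suc (length u) = length w"
    "Dw w (\<lambda>x. of_real (x $ i) * f x) = (\<lambda>x. of_real (x $ i) * Dw w f x + (\<Sum>u\<leftarrow>L. Dw u f x))" by auto
  have *: "partial j (\<lambda>x. \<Sum>u\<leftarrow>L. Dw u f x) = (\<lambda>x. \<Sum>u\<leftarrow>map ((#) j) L. Dw u f x)" and s: "smooth (\<lambda>x. \<Sum>u\<leftarrow>L. Dw u f x)" for L
    by (induction L) (auto simp: partial_const smooth_const partial_add smooth_add smooth_Dw assms fun_eq_iff)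
  have "Dw (j # w) (\<lambda>x. of_real (x $ i) * f x) =
      (\<lambda>x. of_real (x $ i) * Dw (j # w) f x + (\<Sum>u\<leftarrow>(if i = j then [w] else []) @ map ((#) j) L. Dw u f x))"
    by (simp only: foldr.simps o_def L(3), simp only: * map_append sum_list_append partial_add partial_mult
        smooth_mult smooth_coordinate smooth_Dw assms s partial_coordinate)
      (simp add: fun_eq_iff o_def)
  then show ?case using L(1,2)
    by (intro exI[of _ "(if i = j then [w] else []) @ map ((#) j) L"]) auto
qed simp

context weight
begin

lemma gauss_has_vector_derivative:
  "((\<lambda>t. gauss s (x + t *\<^sub>R axis i 1)) has_vector_derivative of_real s * of_real (x $ i) * gauss s x) (at 0)"
proof -
  have "((\<lambda>t. exp (s * ((x + t *\<^sub>R axis i 1) \<bullet> (x + t *\<^sub>R axis i 1)) / 2)) has_real_derivative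
      exp (s * (x \<bullet> x) / 2) * (s * (x $ i))) (at 0)"
    by (auto intro!: derivative_eq_intros simp: inner_simps inner_axis inner_axis' field_simps)
  from has_vector_derivative_of_real[OF this]
  show ?thesis unfolding gauss_def by (simp add: mult_ac)
qed

lemma partial_gauss: "partial i (gauss s) = (\<lambda>x. of_real s * (of_real (x $ i) * gauss s x))"
  by (intro partial_eqI) (use gauss_has_vector_derivative in \<open>simp add: mult.assoc\<close>)

lemma gauss_continuous: "continuous_on UNIV (gauss s)"
  unfolding gauss_def by (intro continuous_intros) auto

lemma smooth_gauss: "smooth (gauss s :: real^'n::finite \<Rightarrow> complex)"
proof (rule smooth_coinduct[of _ "{\<lambda>x. h x * gauss s x | h. smooth h}"])
  show "gauss s \<in> {\<lambda>x. h x * gauss s x | h. smooth h}" using smooth_const[of 1] by force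
next
  fix f assume "f \<in> {\<lambda>x::real^'n. h x * gauss s x | h. smooth h}"
  then obtain h where f: "f = (\<lambda>x. h x * gauss s x)" and h: "smooth h" by auto
  show "continuous_on UNIV f" unfolding f by (intro continuous_on_mult smooth_continuous h gauss_continuous)
  have *: "((\<lambda>t. f (x + t *\<^sub>R axis i 1)) has_vector_derivative
      (partial i h x + of_real s * of_real (x $ i) * h x) * gauss s x) (at 0)" for i x
    unfolding f using has_vector_derivative_mult[OF has_vector_derivative_partial_0[OF h] gauss_has_vector_derivative]
    by (rule has_vector_derivative_eq_rhs) (simp add: algebra_simps)
  show "axis_diff f" by (rule axis_diffI[OF *])
  show "partial i f \<in> {\<lambda>x. h x * gauss s x | h. smooth h}" for i
    unfolding partial_eqI[OF *]
    by (auto intro!: exI[of _ "\<lambda>x. partial i h x + of_real s * of_real (x $ i) * h x"] smooth_add smooth_mult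
      smooth_partial h smooth_const smooth_coordinate)
qed

text \<open>The innermost derivative produces the factor s x_i; commuting it outwards gives a
  recursion of Hermite type, a(k+1) \<le> r a(k) + k a(k-1) with r = \<bar>x\<bar>. The numbers (r +
  k)^k satisfy it, since r (r + k)^k + (r + k)^k \<le> (r + k + 1)^(k + 1).\<close>

lemma Dw_gauss_bound:
  assumes "\<bar>s\<bar> \<le> 1"
  shows "cmod (Dw w (gauss s) x) \<le> cmod (gauss s x) * (norm x + length w) ^ length w"
proof (induction "length w" arbitrary: w rule: less_induct)
  case less
  show ?case
  proof (cases w rule: rev_cases)
    case (snoc v i)
    let ?k = "length v" and ?r = "norm x" and ?g = "cmod (gauss s x)"
    obtain L where L: "length L \<le> ?k" "\<forall>u\<in>set L. Suc (length u) = ?k"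
      "Dw v (\<lambda>x. of_real (x $ i) * gauss s x) = (\<lambda>x. of_real (x $ i) * Dw v (gauss s) x + (\<Sum>u\<leftarrow>L. Dw u (gauss s) x))"
      using Dw_coordinate_mult[OF smooth_gauss] by blast
    have "Dw w (gauss s) x = of_real s * (of_real (x $ i) * Dw v (gauss s) x + (\<Sum>u\<leftarrow>L. Dw u (gauss s) x))"
      unfolding snoc by (simp add: partial_gauss Dw_cmult smooth_mult smooth_gauss smooth_coordinate L(3))
    then have "cmod (Dw w (gauss s) x) \<le> 1 * cmod (of_real (x $ i) * Dw v (gauss s) x + (\<Sum>u\<leftarrow>L. Dw u (gauss s) x))"
      using assms by (simp only: norm_mult norm_of_real) (intro mult_right_mono, auto)
    also have "\<dots> \<le> ?r * (?g * (?r + ?k) ^ ?k) + ?g * (?r + ?k) ^ ?k"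
    proof -
      have 1: "cmod (of_real (x $ i) * Dw v (gauss s) x) \<le> ?r * (?g * (?r + ?k) ^ ?k)"
        unfolding norm_mult norm_of_real
        using component_le_norm_cart[of x i] less[of v] by (intro mult_mono) (auto simp: snoc)
      have 2: "cmod (\<Sum>u\<leftarrow>l. Dw u (gauss s) x) \<le> length l * (?g * (?r + ?k) ^ (?k - 1))"
        if "\<forall>u\<in>set l. Suc (length u) = ?k" for l
        using that
      proof (induction l)
        case (Cons u l)
        then have lu: "length u = ?k - 1" "Suc (length u) = ?k" by auto
        have "cmod (Dw u (gauss s) x) \<le> ?g * (?r + length u) ^ length u"
          using less[of u] lu by (simp add: snoc)
        also have "\<dots> \<le> ?g * (?r + ?k) ^ (?k - 1)"
          unfolding lu(1) by (intro mult_left_mono power_mono) auto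
        finally have "cmod (Dw u (gauss s) x + (\<Sum>u\<leftarrow>l. Dw u (gauss s) x)) \<le>
            ?g * (?r + ?k) ^ (?k - 1) + length l * (?g * (?r + ?k) ^ (?k - 1))"
          using Cons by (intro norm_triangle_le add_mono) auto
        then show ?case by (simp add: algebra_simps)
      qed simp
      have "cmod (\<Sum>u\<leftarrow>L. Dw u (gauss s) x) \<le> real ?k * (?g * (?r + ?k) ^ (?k - 1))"
        by (rule order_trans[OF 2[OF L(2)] mult_right_mono]) (use L(1) in auto)
      also have "\<dots> \<le> ?g * (?r + ?k) ^ ?k"
      proof (cases ?k)
        case (Suc j)
        have "real ?k * (?g * (?r + ?k) ^ (?k - 1)) \<le> (?r + ?k) * (?g * (?r + ?k) ^ (?k - 1))"
          by (intro mult_right_mono) auto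
        then show ?thesis by (simp add: Suc mult_ac)
      qed simp
      finally show ?thesis using 1 by (simp only: mult_1) (rule norm_triangle_le, simp)
    qed
    also have "\<dots> = ?g * ((?r + 1) * (?r + ?k) ^ ?k)" by (simp add: algebra_simps)
    also have "\<dots> \<le> ?g * ((?r + Suc ?k) * (?r + Suc ?k) ^ ?k)"
      by (intro mult_left_mono mult_mono power_mono) auto
    finally show ?thesis by (simp add: snoc)
  qed simp
qed

lemma Dw_gauss_bound_exp:
  assumes "\<bar>s\<bar> \<le> 1"
  shows "cmod (Dw w (gauss s) x) \<le> cmod (gauss s x) * exp (norm x) * (fact (length w) * exp (real (length w)))"
proof -
  have "cmod (Dw w (gauss s) x) \<le> cmod (gauss s x) * (norm x + length w) ^ length w"
    by (rule Dw_gauss_bound[OF assms])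
  also have "\<dots> \<le> cmod (gauss s x) * (fact (length w) * exp (norm x + length w))"
    by (intro mult_left_mono power_le_fact_exp) auto
  finally show ?thesis by (simp add: exp_add mult_ac)
qed

lemma UB_gauss_scale:
  assumes "1 \<le> m" "0 < \<epsilon>" "\<epsilon> \<le> 1"
  shows "\<exists>C. UB m (\<lambda>x. C * decay n x) (\<lambda>x::real^'n::finite. gauss (-1) (\<epsilon> *\<^sub>R x))"
proof -
  obtain A where A: "A > 0" "\<And>k. fact k * exp (real k) \<le> A * W m k" using fact_le_W[OF assms(1)] by blast
  obtain B where B: "B \<ge> 0" "\<And>t. t \<ge> 0 \<Longrightarrow> \<omega> t \<le> B + \<epsilon> * t" using \<omega>_sublinear[OF assms(2)] by blast
  \<comment> \<open>The constant comes from completing the square: with s = \<epsilon>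
    \<bar>x\<bar>, sublinearity gives n \<omega>(x) \<le> n B + n s, and (n + 1) s - s^2 / 2 is at
    most (n + 1)^2 / 2.\<close>
  have "UB m (\<lambda>x. (A * exp (real n * B + (real n + 1)\<^sup>2 / 2)) * decay n x) (\<lambda>x::real^'n::finite. gauss (-1) (\<epsilon> *\<^sub>R x))"
  proof (rule UB_I)
    fix w :: "'n list" and x :: "real^'n"
    let ?k = "length w" and ?s = "\<epsilon> * norm x"
    have "cmod (Dw w (\<lambda>x. gauss (-1) (\<epsilon> *\<^sub>R x)) x) = \<epsilon> ^ ?k * cmod (Dw w (gauss (-1)) (\<epsilon> *\<^sub>R x))"
      using assms by (simp add: Dw_scale smooth_gauss norm_mult norm_power)
    also have "\<dots> \<le> 1 * cmod (Dw w (gauss (-1)) (\<epsilon> *\<^sub>R x))"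
      using assms by (intro mult_right_mono power_le_one) auto
    also have "\<dots> \<le> cmod (gauss (-1) (\<epsilon> *\<^sub>R x)) * exp (norm (\<epsilon> *\<^sub>R x)) * (fact ?k * exp (real ?k))"
      using Dw_gauss_bound_exp[of "-1" w "\<epsilon> *\<^sub>R x"] by simp
    also have "\<dots> \<le> cmod (gauss (-1) (\<epsilon> *\<^sub>R x)) * exp (norm (\<epsilon> *\<^sub>R x)) * (A * W m ?k)"
      by (intro mult_left_mono A) auto
    also have "cmod (gauss (-1) (\<epsilon> *\<^sub>R x)) * exp (norm (\<epsilon> *\<^sub>R x)) = exp (?s - ?s\<^sup>2 / 2)"
      using assms by (simp add: gauss_def exp_add[symmetric] power2_norm_eq_inner[symmetric] power_mult_distrib power2_eq_square)
    also have "exp (?s - ?s\<^sup>2 / 2) * (A * W m ?k) \<le>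
        exp (real n * B + (real n + 1)\<^sup>2 / 2 - real n * wt x) * (A * W m ?k)"
    proof (intro mult_right_mono)
      have "real n * wt x \<le> real n * (B + ?s)" by (intro mult_left_mono B) auto
      moreover have "0 \<le> (?s - (real n + 1))\<^sup>2" by simp
      moreover have "(?s - (real n + 1))\<^sup>2 = ?s\<^sup>2 - 2 * ?s - 2 * (real n * ?s) + (real n + 1)\<^sup>2"
        by (simp add: power2_eq_square algebra_simps)
      ultimately show "exp (?s - ?s\<^sup>2 / 2) \<le> exp (real n * B + (real n + 1)\<^sup>2 / 2 - real n * wt x)"
        unfolding exp_le_cancel_iff distrib_left by linarith
    qed (use A W_pos[OF assms(1), of ?k] in auto)
    finally show "cmod (Dw w (\<lambda>x. gauss (-1) (\<epsilon> *\<^sub>R x)) x) \<le>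
       (A * exp (real n * B + (real n + 1)\<^sup>2 / 2)) * decay n x * W m ?k"
      by (simp only: exp_diff exp_minus divide_inverse mult_ac)
  qed
  then show ?thesis by blast
qed

lemma gauss_scale_Q_set:
  assumes "0 < \<epsilon>" "\<epsilon> \<le> 1" shows "(\<lambda>x. gauss (-1) (\<epsilon> *\<^sub>R x)) \<in> Q_set"
  using UB_gauss_scale[OF _ assms] smooth_scale[OF smooth_gauss] by (auto simp: Q_set_def)

lemma gauss_Q_set: "gauss (-1) \<in> Q_set"
  using gauss_scale_Q_set[of 1] by simp

text \<open>For the value itself, 1 - exp(-s^2 / 2) \<le> s with s = \<epsilon> \<bar>x\<bar>; each
  derivative of order k \<ge> 1 carries the factor \<epsilon>^k \<le> \<epsilon>. The rate is thus
  uniform in the order of differentiation.\<close>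

lemma UB_one_minus_gauss:
  assumes "1 \<le> m"
  shows "\<exists>C>0. \<forall>\<epsilon>>0. \<epsilon> \<le> 1 \<longrightarrow> UB m (\<lambda>x. C * \<epsilon> * (1 + norm x)) (\<lambda>x::real^'n::finite. 1 - gauss (-1) (\<epsilon> *\<^sub>R x))"
proof -
  obtain A where A: "A > 0" "\<And>k. fact k * exp (real k) \<le> A * W m k" using fact_le_W[OF assms(1)] by blast
  have "UB m (\<lambda>x. (1 + A * exp 1) * \<epsilon> * (1 + norm x)) (\<lambda>x::real^'n. 1 - gauss (-1) (\<epsilon> *\<^sub>R x))" if e: "0 < \<epsilon>" "\<epsilon> \<le> 1" for \<epsilon>
  proof (rule UB_I)
    fix w :: "'n list" and x :: "real^'n"
    let ?k = "length w" and ?s = "\<epsilon> * norm x"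
    have D: "Dw w (\<lambda>x. 1 - gauss (-1) (\<epsilon> *\<^sub>R x)) x = Dw w (\<lambda>x. 1) x - of_real \<epsilon> ^ ?k * Dw w (gauss (-1)) (\<epsilon> *\<^sub>R x)"
      by (simp add: Dw_diff smooth_const smooth_scale smooth_gauss Dw_scale)
    have g: "cmod (gauss (-1) (\<epsilon> *\<^sub>R x)) = exp (- (?s\<^sup>2 / 2))"
      using e by (simp add: gauss_def power2_norm_eq_inner[symmetric] power_mult_distrib power2_eq_square mult_ac)
    show "cmod (Dw w (\<lambda>x. 1 - gauss (-1) (\<epsilon> *\<^sub>R x)) x) \<le> (1 + A * exp 1) * \<epsilon> * (1 + norm x) * W m ?k"
    proof (cases w)
      case Nil
      have "1 - gauss (-1) (\<epsilon> *\<^sub>R x) = of_real (1 - exp (- (?s\<^sup>2 / 2)))"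
        using e by (simp add: gauss_def power2_norm_eq_inner[symmetric] power_mult_distrib power2_eq_square mult_ac)
      then have "cmod (1 - gauss (-1) (\<epsilon> *\<^sub>R x)) = 1 - exp (- (?s\<^sup>2 / 2))"
        by (simp only: norm_of_real) simp
      also have "\<dots> \<le> ?s"
      proof (cases "?s \<le> 1")
        case True
        have "1 - exp (- (?s\<^sup>2 / 2)) \<le> ?s\<^sup>2 / 2" using exp_ge_add_one_self[of "- (?s\<^sup>2 / 2)"] by linarith
        also have "\<dots> \<le> ?s"
        proof -
          have s: "0 \<le> ?s" using e by simp
          then show ?thesis using mult_left_mono[OF True s] unfolding power2_eq_square by linarith
        qed
        finally show ?thesis .
      next
        case False
        then show ?thesis using exp_gt_zero[of "- (?s\<^sup>2 / 2)"] by linarith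
      qed
      also have "\<dots> \<le> 1 * \<epsilon> * (1 + norm x) * 1" using e by (simp add: algebra_simps)
      also have "\<dots> \<le> (1 + A * exp 1) * \<epsilon> * (1 + norm x) * W m ?k"
        using A(1) e W_ge_1[OF assms, of ?k] by (intro mult_mono) auto
      finally show ?thesis by (simp add: Nil)
    next
      case (Cons i v)
      have 0: "Dw w (\<lambda>x::real^'n. 1) x = 0"
      proof -
        have "Dw v (\<lambda>x::real^'n. 1) \<in> range (\<lambda>c x. c)" by (induction v) (auto simp: partial_const)
        then obtain c where "Dw v (\<lambda>x::real^'n. 1) = (\<lambda>x. c)" by auto
        then show ?thesis by (simp add: Cons partial_const)
      qed
      have "cmod (Dw w (\<lambda>x. 1 - gauss (-1) (\<epsilon> *\<^sub>R x)) x) = \<epsilon> ^ ?k * cmod (Dw w (gauss (-1)) (\<epsilon> *\<^sub>R x))"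
        using e by (simp add: D 0 norm_mult norm_power)
      also have "\<dots> \<le> \<epsilon> * (exp (- (?s\<^sup>2 / 2)) * exp ?s * (A * W m ?k))"
      proof (rule mult_mono)
        show "\<epsilon> ^ ?k \<le> \<epsilon>" using e power_decreasing[of 1 ?k \<epsilon>] by (simp add: Cons)
        have "cmod (Dw w (gauss (-1)) (\<epsilon> *\<^sub>R x)) \<le> exp (- (?s\<^sup>2 / 2)) * exp ?s * (fact ?k * exp (real ?k))"
          using Dw_gauss_bound_exp[of "-1" w "\<epsilon> *\<^sub>R x"] e by (simp add: g)
        also have "\<dots> \<le> exp (- (?s\<^sup>2 / 2)) * exp ?s * (A * W m ?k)"
          by (intro mult_left_mono A) auto
        finally show "cmod (Dw w (gauss (-1)) (\<epsilon> *\<^sub>R x)) \<le> exp (- (?s\<^sup>2 / 2)) * exp ?s * (A * W m ?k)" .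
      qed (use e in auto)
      also have "\<dots> \<le> \<epsilon> * (exp 1 * (A * W m ?k))"
      proof -
        have "0 \<le> (?s - 1)\<^sup>2" by simp
        then have "exp (- (?s\<^sup>2 / 2)) * exp ?s \<le> exp 1"
          by (simp add: exp_add[symmetric] power2_eq_square algebra_simps)
        then show ?thesis using e A W_pos[OF assms, of ?k] by (intro mult_left_mono mult_right_mono) auto
      qed
      also have "\<dots> = (A * exp 1) * \<epsilon> * 1 * W m ?k" by simp
      also have "\<dots> \<le> (1 + A * exp 1) * \<epsilon> * (1 + norm x) * W m ?k"
        using A(1) e W_pos[OF assms, of ?k] by (intro mult_mono) auto
      finally show ?thesis .
    qed
  qed
  then show ?thesis using A(1) by (intro exI[of _ "1 + A * exp 1"]) (auto intro: add_pos_pos)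
qed

end

section \<open>Fourier transforms\<close>

lemma has_vector_derivative_cis: "(cis has_vector_derivative \<i> * cis t) (at t)"
proof -
  have "((\<lambda>z. exp (\<i> * z)) has_field_derivative \<i> * exp (\<i> * of_real t)) (at (of_real t))"
    by (auto intro!: derivative_eq_intros)
  from has_vector_derivative_real_field[OF this, of UNIV] show ?thesis by (simp add: cis_conv_exp[abs_def])
qed

lemma cis_minus_one_bound: "cmod (cis t - 1) \<le> \<bar>t\<bar>"
proof -
  have "cmod (cis t - cis 0) \<le> 1 * \<bar>t\<bar>"
    by (rule real_mean_value_bound[where f' = "\<lambda>s. \<i> * cis s"])
      (auto simp: norm_mult intro: has_vector_derivative_cis)
  then show ?thesis by simp
qed

lemma cis_remainder_bound: "cmod (cis t - 1 - \<i> * of_real t) \<le> t\<^sup>2"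
proof -
  have "cmod ((cis t - 1 - \<i> * of_real t) - (cis 0 - 1 - \<i> * of_real 0)) \<le> \<bar>t\<bar> * \<bar>t\<bar>"
  proof (rule real_mean_value_bound[where f' = "\<lambda>s. \<i> * (cis s - 1)"])
    show "((\<lambda>s. cis s - 1 - \<i> * of_real s) has_vector_derivative \<i> * (cis s - 1)) (at s)" for s
      by (rule has_vector_derivative_eq_rhs[OF has_vector_derivative_diff[OF has_vector_derivative_diff
              [OF has_vector_derivative_cis has_vector_derivative_const]
              has_vector_derivative_mult_right[OF has_vector_derivative_of_real[OF DERIV_ident]]]])
        (simp add: algebra_simps)
    show "cmod (\<i> * (cis s - 1)) \<le> \<bar>t\<bar>" if "\<bar>s\<bar> \<le> \<bar>t\<bar>" for s
      using cis_minus_one_bound[of s] that by (simp add: norm_mult)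
  qed
  then show ?thesis by (simp add: power2_eq_square)
qed

text \<open>The criterion behind the differentiation of Fourier integrals and of functionals applied
  to translates: a bounded linear operation preserves a remainder of order t^2, so a bound on the
  remainder is all that has to be passed through.\<close>

lemma has_vector_derivative_quadratic:
  fixes f :: "real \<Rightarrow> complex"
  assumes "\<And>t. \<bar>t\<bar> \<le> 1 \<Longrightarrow> cmod (f t - f 0 - of_real t * c) \<le> B * t\<^sup>2"
  shows "(f has_vector_derivative c) (at 0)"
  unfolding has_vector_derivative_def has_derivative_at
proof (intro conjI)
  show "bounded_linear (\<lambda>h. h *\<^sub>R c)" by (rule bounded_linear_scaleR_left)
  show "(\<lambda>h. norm (f (0 + h) - f 0 - h *\<^sub>R c) / norm h) \<midarrow>0\<rightarrow> 0"
  proof (rule Lim_null_comparison)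
    show "\<forall>\<^sub>F h in at 0. norm (norm (f (0 + h) - f 0 - h *\<^sub>R c) / norm h) \<le> B * \<bar>h\<bar>"
      unfolding eventually_at
    proof (intro exI[of _ 1] conjI ballI impI)
      fix h :: real assume h: "h \<noteq> 0 \<and> dist h 0 < 1"
      then have "cmod (f h - f 0 - of_real h * c) \<le> (B * \<bar>h\<bar>) * \<bar>h\<bar>"
        using assms[of h] by (simp add: power2_eq_square mult.assoc)
      then show "norm (norm (f (0 + h) - f 0 - h *\<^sub>R c) / norm h) \<le> B * \<bar>h\<bar>"
        using h by (simp add: pos_divide_le_eq scaleR_conv_of_real)
    qed simp
    show "((\<lambda>h. B * \<bar>h\<bar>) \<longlongrightarrow> 0) (at 0)" by (auto intro!: tendsto_eq_intros)
  qed
qed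

lemma lborel_integral_translate:
  fixes f :: "'a::euclidean_space \<Rightarrow> 'b::{banach,second_countable_topology}"
  assumes "f \<in> borel_measurable borel"
  shows "(LINT x|lborel. f (c + x)) = (LINT x|lborel. f x)"
proof -
  have "(LINT x|lborel. f x) = (LINT x|distr lborel borel ((+) c). f x)" by (simp add: lborel_distr_plus)
  also have "\<dots> = (LINT x|lborel. f (c + x))" by (rule integral_distr) (use assms in auto)
  finally show ?thesis by simp
qed

lemma lborel_integral_scale:
  fixes f :: "'a::euclidean_space \<Rightarrow> 'b::{banach,second_countable_topology}"
  assumes [measurable]: "f \<in> borel_measurable borel" and "c \<noteq> 0"
  shows "(LINT x|lborel. f x) = \<bar>c\<bar> ^ DIM('a) *\<^sub>R (LINT x|lborel. f (c *\<^sub>R x))"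
proof -
  have "(LINT x|lborel. f x) = (LINT x|density (distr lborel borel (\<lambda>x. 0 + c *\<^sub>R x)) (\<lambda>_. \<bar>c\<bar> ^ DIM('a)). f x)"
    using lborel_affine[OF assms(2), of "0::'a"] by simp
  also have "\<dots> = (LINT x|distr lborel borel (\<lambda>x. 0 + c *\<^sub>R x). \<bar>c\<bar> ^ DIM('a) *\<^sub>R f x)"
    by (rule integral_density) auto
  also have "\<dots> = (LINT x|lborel. \<bar>c\<bar> ^ DIM('a) *\<^sub>R f (0 + c *\<^sub>R x))"
    by (rule integral_distr) auto
  finally show ?thesis by simp
qed

lemma continuous_cis: "continuous_on A f \<Longrightarrow> continuous_on A (\<lambda>x. cis (f x))"
  unfolding cis_conv_exp by (intro continuous_intros)

lemma borel_measurable_cis [measurable]: "cis \<in> borel_measurable borel"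
  by (intro borel_measurable_continuous_onI continuous_cis continuous_on_id)

lemma norm_fourier_le:
  fixes f :: "real^'n::finite \<Rightarrow> complex"
  shows "cmod (fourier f \<xi>) \<le> (LINT x|lborel. cmod (f x))"
  unfolding fourier_def by (rule order_trans[OF integral_norm_bound]) (simp add: norm_mult)

lemma integrable_cis_mult:
  fixes f :: "real^'n::finite \<Rightarrow> complex"
  assumes "integrable lborel f"
  shows "integrable lborel (\<lambda>x. cis (- (x \<bullet> \<xi>)) * f x)"
  by (rule Bochner_Integration.integrable_bound[OF assms])
    (use borel_measurable_integrable[OF assms] in \<open>auto simp: norm_mult\<close>)

lemma fourier_multiplication:
  fixes f g :: "real^'n::finite \<Rightarrow> complex"
  assumes f: "integrable lborel f" and g: "integrable lborel g"
  shows "(LINT x|lborel. fourier f x * g x) = (LINT x|lborel. f x * fourier g x)"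
proof -
  have [measurable]: "f \<in> borel_measurable borel" "g \<in> borel_measurable borel"
    using f g by (auto dest: borel_measurable_integrable)
  define F where "F = (\<lambda>x y. cis (- (x \<bullet> y)) * f x * g y)"
  have "integrable (lborel \<Otimes>\<^sub>M lborel) (case_prod F)"
  proof (rule lborel_pair.Fubini_integrable)
    show "case_prod F \<in> borel_measurable (lborel \<Otimes>\<^sub>M lborel)"
      unfolding F_def by measurable
    have "(\<lambda>x. LINT y|lborel. cmod (case_prod F (x, y))) = (\<lambda>x. cmod (f x) * (LINT y|lborel. cmod (g y)))"
      by (simp add: F_def norm_mult fun_eq_iff)
    then show "integrable lborel (\<lambda>x. LINT y|lborel. cmod (case_prod F (x, y)))"
      using f by (simp add: integrable_mult_left integrable_norm)
    have "(\<lambda>y. case_prod F (x, y)) = (\<lambda>y. f x * (cis (- (y \<bullet> x)) * g y))" for x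
      by (simp add: F_def fun_eq_iff inner_commute)
    then show "AE x in lborel. integrable lborel (\<lambda>y. case_prod F (x, y))"
      by (auto intro!: AE_I2 integrable_mult_right integrable_cis_mult g)
  qed
  from lborel_pair.Fubini_integral[OF this]
  have "(LINT y|lborel. LINT x|lborel. F x y) = (LINT x|lborel. LINT y|lborel. F x y)" .
  moreover have "(LINT x|lborel. F x y) = fourier f y * g y" for y
    by (simp add: F_def fourier_def)
  moreover have "(LINT y|lborel. F x y) = f x * fourier g x" for x
  proof -
    have "(LINT y|lborel. F x y) = (LINT y|lborel. f x * (cis (- (y \<bullet> x)) * g y))"
      by (simp add: F_def inner_commute mult_ac)
    then show ?thesis by (simp add: fourier_def)
  qed
  ultimately show ?thesis by simp
qed

context weight
begin

text \<open>An intermediate class, with unrelated constants for different derivatives. It contains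
  both \<open>Q_set\<close> and \<open>S_set \<omega>\<close>, so Fourier analysis can be done
  before the two are known to agree; \<open>slow\<close> provides its multipliers.\<close>

definition rapid :: "(real^'n::finite \<Rightarrow> complex) set" where
  "rapid = {f. smooth f \<and> (\<forall>w n. \<exists>C. \<forall>x. cmod (Dw w f x) \<le> C * decay n x)}"

definition slow :: "(real^'n::finite \<Rightarrow> complex) set" where
  "slow = {f. smooth f \<and> (\<forall>w. \<exists>n C. \<forall>x. cmod (Dw w f x) \<le> C * growth n x)}"

lemma rapid_smooth: "f \<in> rapid \<Longrightarrow> smooth f" by (simp add: rapid_def)

lemma slow_smooth: "f \<in> slow \<Longrightarrow> smooth f" by (simp add: slow_def)

lemma bound_const_nonneg:
  fixes z :: complex
  assumes "cmod z \<le> C * exp a" shows "0 \<le> C"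
  using order_trans[OF norm_ge_zero assms] by (simp add: zero_le_mult_iff)

lemma rapid_D: "f \<in> rapid \<Longrightarrow> \<exists>C\<ge>0. \<forall>x. cmod (Dw w f x) \<le> C * decay n x"
  unfolding rapid_def using bound_const_nonneg by blast

lemma rapid_bound: assumes "f \<in> rapid" obtains C where "C \<ge> 0" "\<And>x. cmod (f x) \<le> C * decay n x"
  using rapid_D[OF assms, of "[]" n] by auto

lemma rapid_Dw: "f \<in> rapid \<Longrightarrow> Dw u f \<in> rapid"
  unfolding rapid_def using smooth_Dw by (auto simp: foldr_append[symmetric] simp del: foldr_append)

lemma rapid_partial: "f \<in> rapid \<Longrightarrow> partial i f \<in> rapid"
  using rapid_Dw[of f "[i]"] by simp

lemma Q_set_subset_rapid: "Q_set \<subseteq> rapid"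
proof
  fix f :: "real^'n::finite \<Rightarrow> complex" assume f: "f \<in> Q_set"
  have "\<exists>C. \<forall>x. cmod (Dw w f x) \<le> C * decay n x" for w n
  proof -
    obtain C where "UB 1 (\<lambda>x. C * decay n x) f" using Q_set_D[OF f] by blast
    from UB_D[OF this, of w] show ?thesis by (intro exI[of _ "C * W 1 (length w)"]) (simp add: mult_ac)
  qed
  then show "f \<in> rapid" using Q_set_smooth[OF f] by (simp add: rapid_def)
qed

lemma ON_subset_slow: "ON n \<subseteq> slow"
proof
  fix f :: "real^'n::finite \<Rightarrow> complex" assume f: "f \<in> ON n"
  have "\<exists>n C. \<forall>x. cmod (Dw w f x) \<le> C * growth n x" for w
  proof -
    obtain C where "UB 1 (\<lambda>x. C * growth n x) f" using ON_D[OF f] by blast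
    from UB_D[OF this, of w] show ?thesis by (intro exI[of _ "C * W 1 (length w)"] exI[of _ n]) (simp add: mult_ac)
  qed
  then show "f \<in> slow" using ON_smooth[OF f] by (simp add: slow_def)
qed

lemma rapid_subset_slow: "rapid \<subseteq> slow"
proof
  fix f :: "real^'n::finite \<Rightarrow> complex" assume f: "f \<in> rapid"
  have "\<exists>n C. \<forall>x. cmod (Dw w f x) \<le> C * growth n x" for w
  proof -
    obtain C where "\<And>x. cmod (Dw w f x) \<le> C * decay 0 x" using rapid_D[OF f] by blast
    then show ?thesis by (intro exI[of _ 0] exI[of _ C]) simp
  qed
  then show "f \<in> slow" using rapid_smooth[OF f] by (simp add: slow_def)
qed

lemma rapid_mult:
  assumes f: "f \<in> rapid" and g: "g \<in> slow" shows "(\<lambda>x. f x * g x) \<in> rapid"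
proof -
  have "\<exists>C. \<forall>x. cmod (Dw w (\<lambda>x. f x * g x) x) \<le> C * decay n x" for w n
  proof -
    have "\<exists>C. \<forall>x. cmod (\<Sum>(u, v)\<leftarrow>l. Dw u f x * Dw v g x) \<le> C * decay n x" for l
    proof (induction l)
      case Nil
      then show ?case by (intro exI[of _ 0]) auto
    next
      case (Cons p l)
      obtain u v where p: "p = (u, v)" by (cases p)
      obtain C where C: "\<And>x. cmod (\<Sum>(u, v)\<leftarrow>l. Dw u f x * Dw v g x) \<le> C * decay n x"
        using Cons.IH by blast
      obtain k B where B: "\<And>x. cmod (Dw v g x) \<le> B * growth k x" using g unfolding slow_def by blast
      have B0: "0 \<le> B" using bound_const_nonneg[OF B] .
      obtain A where A: "A \<ge> 0" "\<And>x. cmod (Dw u f x) \<le> A * decay (n + k) x" using rapid_D[OF f] by metis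
      have "cmod (Dw u f x * Dw v g x) \<le> (A * B) * decay n x" for x
      proof -
        have "cmod (Dw u f x * Dw v g x) \<le> (A * decay (n + k) x) * (B * growth k x)"
          unfolding norm_mult using A B by (intro mult_mono) auto
        also have "\<dots> = (A * B) * decay n x"
          by (simp add: algebra_simps exp_add[symmetric] exp_diff[symmetric])
        finally show ?thesis .
      qed
      then have "cmod (Dw u f x * Dw v g x + (\<Sum>(u, v)\<leftarrow>l. Dw u f x * Dw v g x)) \<le> (A * B + C) * decay n x" for x
        unfolding distrib_right by (intro norm_triangle_le add_mono C)
      then show ?case by (auto simp: p)
    qed
    then show ?thesis by (simp add: Dw_mult rapid_smooth[OF f] slow_smooth[OF g])
  qed
  then show ?thesis using rapid_smooth[OF f] slow_smooth[OF g] by (simp add: rapid_def smooth_mult)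
qed

lemma coordinate_ON: "(\<lambda>x::real^'n::finite. of_real (x $ i)) \<in> ON 1"
proof -
  obtain C where C: "C > 0" "\<And>t. t \<ge> 0 \<Longrightarrow> (1 + t) ^ 1 \<le> C * exp (\<omega> t)" using power_le_exp_\<omega> by blast
  have "UB m (\<lambda>x. C * growth 1 x) (\<lambda>x::real^'n. of_real (x $ i))" if m: "1 \<le> m" for m
  proof (rule UB_I)
    fix w :: "'n list" and x :: "real^'n"
    have "cmod (Dw w (\<lambda>x. of_real (x $ i)) x) \<le> 1 + norm x"
    proof (cases w rule: rev_cases)
      case Nil
      then show ?thesis using component_le_norm_cart[of x i] by simp
    next
      case (snoc v j)
      have "Dw v (\<lambda>x::real^'n. c) \<in> (\<lambda>c x. c) ` {0, c}" for c :: complex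
        by (induction v) (auto simp: partial_const)
      then obtain c where c: "c \<in> {0, of_bool (i = j) :: complex}" "Dw v (\<lambda>x::real^'n. of_bool (i = j)) = (\<lambda>x. c)"
        by blast
      then have "cmod (Dw w (\<lambda>x. of_real (x $ i)) x) \<le> 1"
        unfolding snoc by (auto simp: partial_coordinate)
      then show ?thesis using norm_ge_zero[of x] by linarith
    qed
    also have "\<dots> \<le> C * exp (wt x) * 1" using C(2)[of "norm x"] by simp
    also have "\<dots> \<le> C * exp (wt x) * W m (length w)"
      using C(1) W_ge_1[OF m] by (intro mult_left_mono) auto
    finally show "cmod (Dw w (\<lambda>x. of_real (x $ i)) x) \<le> C * growth 1 x * W m (length w)" by simp
  qed
  then show ?thesis using smooth_coordinate by (auto simp: ON_def)
qed

lemma rapid_coordinate_mult: "f \<in> rapid \<Longrightarrow> (\<lambda>x. f x * of_real (x $ i)) \<in> rapid"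
  using rapid_mult[OF _ subsetD[OF ON_subset_slow coordinate_ON]] .

lemma rapid_cmult: "f \<in> rapid \<Longrightarrow> (\<lambda>x. c * f x) \<in> rapid"
proof -
  assume f: "f \<in> rapid"
  have "\<exists>C. \<forall>x. cmod (c * Dw w f x) \<le> C * decay n x" for w n
  proof -
    obtain C where C: "\<And>x. cmod (Dw w f x) \<le> C * decay n x" using rapid_D[OF f] by blast
    then have "cmod (c * Dw w f x) \<le> cmod c * C * decay n x" for x
      unfolding norm_mult mult.assoc by (intro mult_left_mono) auto
    then show ?thesis by blast
  qed
  then show ?thesis using rapid_smooth[OF f] by (auto simp: rapid_def smooth_cmult Dw_cmult)
qed

text \<open>A Peetre type inequality: y is written as (x + y) + (-x). Decay at the rate n K becomes
  decay at the rate n after a translation.\<close>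

lemma exp_wt_translate:
  "decay (n * K) (x + y) \<le> exp (real (n * K)) * growth (n * K) x * decay n y"
proof -
  have "growth n y \<le> exp (real (n * K)) * growth (n * K) (x + y) * growth (n * K) x"
    using exp_wt_add[of n "x + y" "- x"] by simp
  then show ?thesis by (simp add: exp_minus field_simps)
qed

lemma rapid_translate: "f \<in> rapid \<Longrightarrow> (\<lambda>y. f (x + y)) \<in> rapid"
proof -
  assume f: "f \<in> rapid"
  have "\<exists>C. \<forall>y. cmod (Dw w f (x + y)) \<le> C * decay n y" for w n
  proof -
    obtain C where C: "C \<ge> 0" "\<And>x. cmod (Dw w f x) \<le> C * decay (n * K) x" using rapid_D[OF f] by blast
    have "cmod (Dw w f (x + y)) \<le> C * (exp (real (n * K)) * growth (n * K) x) * decay n y" for y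
      using order_trans[OF C(2)[of "x + y"] mult_left_mono[OF exp_wt_translate C(1)]] by (simp add: mult.assoc)
    then show ?thesis by blast
  qed
  then show ?thesis using rapid_smooth[OF f] by (simp add: rapid_def smooth_translate Dw_translate)
qed

lemma rapid_measurable: "f \<in> rapid \<Longrightarrow> f \<in> borel_measurable borel"
  by (intro borel_measurable_continuous_onI smooth_continuous rapid_smooth)

definition I_wt :: "'n::finite itself \<Rightarrow> real" where
  "I_wt _ = (LINT x|lborel. exp (- wt (x :: real^'n)))"

lemma I_wt_nonneg: "0 \<le> I_wt TYPE('n::finite)"
  by (simp add: I_wt_def)

lemma integrable_bound_wt:
  fixes f :: "real^'n::finite \<Rightarrow> complex"
  assumes "f \<in> borel_measurable borel" "\<And>x. cmod (f x) \<le> C * exp (- wt x)"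
  shows "integrable lborel f" "cmod (integral\<^sup>L lborel f) \<le> C * I_wt TYPE('n)"
    "(LINT x|lborel. cmod (f x)) \<le> C * I_wt TYPE('n)"
  using integrable_exp_wt_bound[of f C] integrable_exp_wt_bound(2)[of "\<lambda>x. cmod (f x)" C] assms
  by (auto simp: I_wt_def)

lemma rapid_integrable: "f \<in> rapid \<Longrightarrow> integrable lborel f"
  using rapid_bound[of f 1] integrable_bound_wt(1)[OF rapid_measurable] by (metis mult_1 of_nat_1)

lemma fourier_bound_wt:
  fixes f :: "real^'n::finite \<Rightarrow> complex"
  assumes "f \<in> borel_measurable borel" "\<And>x. cmod (f x) \<le> C * exp (- wt x)"
  shows "cmod (fourier f \<xi>) \<le> C * I_wt TYPE('n)"
  by (rule order_trans[OF norm_fourier_le integrable_bound_wt(3)[OF assms]])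

subsection \<open>Differentiation\<close>

lemma fourier_has_vector_derivative:
  fixes h :: "real^'n::finite \<Rightarrow> complex"
  assumes h: "h \<in> rapid"
  shows "((\<lambda>t. fourier h (\<xi> + t *\<^sub>R axis j 1)) has_vector_derivative
    fourier (\<lambda>x. -\<i> * (h x * of_real (x $ j))) \<xi>) (at 0)"
proof -
  let ?h1 = "\<lambda>x. h x * of_real (x $ j)"
  have h1: "?h1 \<in> rapid" by (rule rapid_coordinate_mult[OF h])
  have h1': "(\<lambda>x. -\<i> * ?h1 x) \<in> rapid" by (rule rapid_cmult[OF h1])
  obtain C where C: "C \<ge> 0" "\<And>x. cmod (?h1 x * of_real (x $ j)) \<le> C * decay 1 x"
    using rapid_bound[OF rapid_coordinate_mult[OF h1]] by blast
  show ?thesis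
  proof (rule has_vector_derivative_quadratic)
    fix t :: real
    let ?R = "\<lambda>x. cis (- (x \<bullet> (\<xi> + t *\<^sub>R axis j 1))) * h x - cis (- (x \<bullet> \<xi>)) * h x - of_real t * (cis (- (x \<bullet> \<xi>)) * (-\<i> * ?h1 x))"
    have R: "?R x = cis (- (x \<bullet> \<xi>)) * h x * (cis (- (t * x $ j)) - 1 - \<i> * of_real (- (t * x $ j)))" for x
      by (simp add: inner_simps inner_axis algebra_simps)
        (simp add: cis_mult algebra_simps)
    have "cmod (?R x) \<le> (C * t\<^sup>2) * exp (- wt x)" for x
    proof -
      have "cmod (?R x) \<le> cmod (h x) * (- (t * x $ j))\<^sup>2"
        unfolding R norm_mult norm_cis using cis_remainder_bound[of "- (t * x $ j)"]
        by (simp add: mult_left_mono)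
      also have "\<dots> = t\<^sup>2 * cmod (?h1 x * of_real (x $ j))"
        by (simp add: norm_mult power_mult_distrib power2_eq_square)
      also have "\<dots> \<le> t\<^sup>2 * (C * decay 1 x)" by (intro mult_left_mono C) auto
      finally show ?thesis by (simp add: mult_ac)
    qed
    then have "cmod (integral\<^sup>L lborel ?R) \<le> (C * t\<^sup>2) * I_wt TYPE('n)"
      using rapid_measurable[OF h] by (intro integrable_bound_wt(2)) (auto intro!: borel_measurable_diff borel_measurable_times)
    also have "integral\<^sup>L lborel ?R = fourier h (\<xi> + t *\<^sub>R axis j 1) - fourier h \<xi> - of_real t * fourier (\<lambda>x. -\<i> * ?h1 x) \<xi>"
      unfolding fourier_def
      by (subst Bochner_Integration.integral_diff Bochner_Integration.integral_mult_right |
          intro Bochner_Integration.integrable_diff integrable_mult_right integrable_cis_mult rapid_integrable h h1' |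
          simp only:)+
    finally show "cmod (fourier h (\<xi> + t *\<^sub>R axis j 1) - fourier h (\<xi> + 0 *\<^sub>R axis j 1) - of_real t * fourier (\<lambda>x. -\<i> * ?h1 x) \<xi>)
        \<le> (C * I_wt TYPE('n)) * t\<^sup>2"
      by (simp add: mult_ac)
  qed
qed

lemma partial_fourier:
  "h \<in> rapid \<Longrightarrow> partial j (fourier h) = fourier (\<lambda>x. -\<i> * (h x * of_real (x $ j)))"
  by (rule partial_eqI[OF fourier_has_vector_derivative])

lemma smooth_fourier:
  fixes h :: "real^'n::finite \<Rightarrow> complex"
  assumes "h \<in> rapid" shows "smooth (fourier h)"
proof (rule smooth_coinduct_bounded[of _ "fourier ` (rapid :: (real^'n \<Rightarrow> complex) set)"])
  show "fourier h \<in> fourier ` rapid" using assms by simp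
next
  fix f :: "real^'n \<Rightarrow> complex" assume "f \<in> fourier ` rapid"
  then obtain h where h: "h \<in> rapid" "f = fourier h" by auto
  show "axis_diff f" unfolding h(2) by (rule axis_diffI[OF fourier_has_vector_derivative[OF h(1)]])
  show "partial i f \<in> fourier ` rapid" for i
    unfolding h(2) partial_fourier[OF h(1)] by (intro imageI rapid_cmult rapid_coordinate_mult h)
  show "\<exists>B. \<forall>y. dist x y < 1 \<longrightarrow> cmod (f y) \<le> B" for x
    unfolding h(2) using norm_fourier_le by blast
qed

text \<open>The class \<open>H\<close> is a parameter so that, for f in \<open>Q_set\<close>,
  derivatives of the transform come from functions in \<open>Q_set\<close> again; plain rapid decay
  would not give them decay of exponential type in \<omega>.\<close>

lemma Dw_fourier:
  assumes "h \<in> H" "H \<subseteq> rapid" "\<And>h j. h \<in> H \<Longrightarrow> (\<lambda>x. -\<i> * (h x * of_real (x $ j))) \<in> H"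
  shows "Dw w (fourier h) \<in> fourier ` H"
proof (induction w)
  case (Cons j w)
  then obtain g where "g \<in> H" "Dw w (fourier h) = fourier g" by auto
  then show ?case using assms(2,3) partial_fourier[of g j] by auto
qed (use assms in auto)

text \<open>In place of integration by parts, the identity that the transform of a translate by t
  along an axis is a character in t times the transform is differentiated at t = 0 on both
  sides.\<close>

lemma fourier_partial:
  fixes h :: "real^'n::finite \<Rightarrow> complex"
  assumes h: "h \<in> rapid"
  shows "fourier (partial j h) \<xi> = \<i> * of_real (\<xi> $ j) * fourier h \<xi>"
proof -
  let ?e = "axis j (1::real)"
  obtain C where C: "C \<ge> 0" "\<And>x. cmod (partial j (partial j h) x) \<le> C * decay (1 * K) x"
    using rapid_bound[OF rapid_partial[OF rapid_partial[OF h]]] by blast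
  have sm[measurable]: "h \<in> borel_measurable borel" "partial j h \<in> borel_measurable borel"
    using rapid_measurable h rapid_partial by auto
  have tr: "fourier (\<lambda>x. h (t *\<^sub>R ?e + x)) \<xi> = cis (t * \<xi> $ j) * fourier h \<xi>" for t
  proof -
    let ?f = "\<lambda>y. cis (- ((y - t *\<^sub>R ?e) \<bullet> \<xi>)) * h y"
    have "fourier (\<lambda>x. h (t *\<^sub>R ?e + x)) \<xi> = (LINT x|lborel. ?f (t *\<^sub>R ?e + x))"
      by (simp add: fourier_def)
    also have "\<dots> = (LINT x|lborel. ?f x)"
      using sm by (intro lborel_integral_translate) measurable
    also have "\<dots> = (LINT x|lborel. cis (t * \<xi> $ j) * (cis (- (x \<bullet> \<xi>)) * h x))"
      by (simp add: inner_simps inner_axis' cis_mult mult.assoc[symmetric])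
    finally show ?thesis by (simp add: fourier_def)
  qed
  have "((\<lambda>t. cis (t * \<xi> $ j) * fourier h \<xi>) has_vector_derivative fourier (partial j h) \<xi>) (at 0)"
  proof (rule has_vector_derivative_quadratic)
    fix t :: real assume t: "\<bar>t\<bar> \<le> 1"
    let ?R = "\<lambda>x. cis (- (x \<bullet> \<xi>)) * h (t *\<^sub>R ?e + x) - cis (- (x \<bullet> \<xi>)) * h x - of_real t * (cis (- (x \<bullet> \<xi>)) * partial j h x)"
    have "cmod (?R x) \<le> (C * exp (real (1 * K)) * t\<^sup>2) * exp (- wt x)" for x
    proof -
      have "?R x = cis (- (x \<bullet> \<xi>)) * (h (x + t *\<^sub>R ?e) - h x - of_real t * partial j h x)"
        by (simp add: algebra_simps)
      then have "cmod (?R x) = cmod (h (x + t *\<^sub>R ?e) - h x - of_real t * partial j h x)"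
        by (simp add: norm_mult)
      also have "\<dots> \<le> (C * exp (real (1 * K)) * exp (- wt x)) * t\<^sup>2"
      proof (rule partial_remainder_bound[OF rapid_smooth[OF h]])
        fix s assume s: "\<bar>s\<bar> \<le> \<bar>t\<bar>"
        \<comment> \<open>Shifts of length at most 1 have weight 0 by the normalization, so they
          cost only the constant e^K.\<close>
        then have "wt (s *\<^sub>R ?e) = 0" using t by (intro \<omega>_zero) auto
        then have "decay (1 * K) (s *\<^sub>R ?e + x) \<le> exp (real (1 * K)) * exp (- wt x)"
          using exp_wt_translate[of 1 "s *\<^sub>R ?e" x] by simp
        from order_trans[OF C(2) mult_left_mono[OF this C(1)]]
        show "cmod (partial j (partial j h) (x + s *\<^sub>R ?e)) \<le> C * exp (real (1 * K)) * exp (- wt x)"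
          by (simp add: add.commute mult.assoc)
      qed
      finally show ?thesis by (simp add: mult_ac)
    qed
    then have "cmod (integral\<^sup>L lborel ?R) \<le> (C * exp (real (1 * K)) * t\<^sup>2) * I_wt TYPE('n)"
      by (intro integrable_bound_wt(2)) measurable
    also have "integral\<^sup>L lborel ?R = fourier (\<lambda>x. h (t *\<^sub>R ?e + x)) \<xi> - fourier h \<xi> - of_real t * fourier (partial j h) \<xi>"
      unfolding fourier_def
      by (subst Bochner_Integration.integral_diff Bochner_Integration.integral_mult_right |
        intro Bochner_Integration.integrable_diff integrable_mult_right integrable_cis_mult rapid_integrable h rapid_partial rapid_translate |
        simp only:)+
    finally show "cmod (cis (t * \<xi> $ j) * fourier h \<xi> - cis (0 * \<xi> $ j) * fourier h \<xi> - of_real t * fourier (partial j h) \<xi>)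
        \<le> (C * exp (real (1 * K)) * I_wt TYPE('n)) * t\<^sup>2"
      by (simp add: tr mult_ac)
  qed
  moreover have "((\<lambda>t. cis (t * \<xi> $ j) * fourier h \<xi>) has_vector_derivative \<i> * of_real (\<xi> $ j) * fourier h \<xi>) (at 0)"
  proof -
    have "(cis \<circ> (\<lambda>t. t * \<xi> $ j) has_vector_derivative (\<xi> $ j) *\<^sub>R (\<i> * cis (0 * \<xi> $ j))) (at 0)"
      by (intro vector_diff_chain_at has_vector_derivative_cis) (auto intro!: derivative_eq_intros)
    from has_vector_derivative_mult_left[OF this, of "fourier h \<xi>"] show ?thesis
      by (simp add: o_def scaleR_conv_of_real mult_ac)
  qed
  ultimately show ?thesis by (rule vector_derivative_unique_at)
qed

lemma fourier_Dw:
  assumes "h \<in> rapid"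
  shows "fourier (Dw w h) \<xi> = (\<Prod>i\<leftarrow>w. \<i> * of_real (\<xi> $ i)) * fourier h \<xi>"
  by (induction w) (auto simp: fourier_partial rapid_Dw assms)

lemma fourier_Dw_norm:
  assumes "h \<in> rapid"
  shows "cmod (fourier (Dw w h) \<xi>) \<le> norm \<xi> ^ length w * cmod (fourier h \<xi>)"
proof -
  have "cmod (\<Prod>i\<leftarrow>w. \<i> * of_real (\<xi> $ i)) \<le> norm \<xi> ^ length w"
    by (induction w) (auto simp: norm_mult component_le_norm_cart intro!: mult_mono)
  then show ?thesis unfolding fourier_Dw[OF assms] norm_mult by (rule mult_right_mono) simp
qed

subsection \<open>Gaussians and Fourier inversion\<close>

text \<open>The Gaussian integral (2 pi)^(N/2), carried along as a symbol; it is nonzero because its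
  integrand is positive.\<close>

definition gauss_const :: "'n::finite itself \<Rightarrow> complex" where
  "gauss_const _ = fourier (gauss (-1) :: real^'n \<Rightarrow> complex) 0"

lemma gauss_const_nonzero: "gauss_const TYPE('n::finite) \<noteq> 0"
proof
  let ?f = "\<lambda>x::real^'n. exp (- (x \<bullet> x) / 2)"
  have i: "integrable lborel (\<lambda>x. complex_of_real (?f x))"
    using rapid_integrable[OF subsetD[OF Q_set_subset_rapid gauss_Q_set], where 'a='n] by (simp add: gauss_def[abs_def])
  assume "gauss_const TYPE('n) = 0"
  then have "complex_of_real (LINT x|lborel. ?f x) = 0"
    unfolding gauss_const_def fourier_def gauss_def by (simp add: integral_complex_of_real[symmetric] del: integral_complex_of_real)
  moreover have "integrable lborel ?f" using i by (simp add: complex_of_real_integrable_eq)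
  ultimately have "AE x in lborel. ?f x = 0"
    by (subst integral_nonneg_eq_0_iff_AE[symmetric]) auto
  then have "AE x::real^'n in lborel. False" by simp
  then show False by (subst (asm) AE_iff_measurable[of UNIV]) auto
qed

text \<open>The product of the transform of the Gaussian with the inverse Gaussian has vanishing partial derivatives.\<close>
lemma fourier_gauss: "fourier (gauss (-1)) \<xi> = gauss_const TYPE('n::finite) * gauss (-1) (\<xi> :: real^'n)"
proof -
  let ?g = "gauss (-1) :: real^'n \<Rightarrow> complex" and ?G = "fourier (gauss (-1)) :: real^'n \<Rightarrow> complex"
  have g: "?g \<in> rapid" using gauss_Q_set Q_set_subset_rapid by blast
  have G: "smooth ?G" by (rule smooth_fourier[OF g])
  have "partial j ?G = (\<lambda>\<xi>. - (of_real (\<xi> $ j) * ?G \<xi>))" for j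
  proof -
    have "(\<lambda>x. -\<i> * (?g x * of_real (x $ j))) = (\<lambda>x. \<i> * partial j ?g x)"
      by (simp add: partial_gauss fun_eq_iff mult_ac)
    then have "partial j ?G = fourier (\<lambda>x. \<i> * partial j ?g x)" by (simp add: partial_fourier[OF g])
    moreover have "fourier (\<lambda>x. \<i> * partial j ?g x) \<xi> = \<i> * fourier (partial j ?g) \<xi>" for \<xi>
      by (simp add: fourier_def mult.left_commute[of _ \<i>])
    ultimately show ?thesis by (simp add: fourier_partial[OF g] fun_eq_iff mult.assoc[symmetric])
  qed
  then have p: "partial j (\<lambda>\<xi>. ?G \<xi> * gauss 1 \<xi>) = (\<lambda>\<xi>. 0)" for j
    by (simp add: partial_mult G smooth_gauss partial_gauss fun_eq_iff mult_ac)
  have "cmod (?G (0 + \<xi>) * gauss 1 (0 + \<xi>) - ?G 0 * gauss 1 (0 :: real^'n)) \<le> 0 * (\<Sum>i\<in>UNIV. \<bar>\<xi> $ i\<bar>)"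
    by (rule axis_diff_lipschitz[of "\<lambda>\<xi>. ?G \<xi> * gauss 1 \<xi>" 0 \<xi> 0, OF smooth_imp_axis_diff[OF smooth_mult[OF G smooth_gauss]]]) (simp add: p)
  then have "?G \<xi> * gauss 1 \<xi> = gauss_const TYPE('n)" by (simp add: gauss_def gauss_const_def)
  moreover have "gauss 1 \<xi> * ?g \<xi> = 1" by (simp add: gauss_def exp_of_real[symmetric] exp_add[symmetric])
  ultimately show ?thesis by (metis mult.assoc mult.right_neutral)
qed

lemma fourier_gauss_scale:
  fixes y :: "real^'n::finite"
  assumes e: "\<epsilon> > 0"
  shows "fourier (\<lambda>\<eta>. gauss (-1) (\<epsilon> *\<^sub>R \<eta>)) y = gauss_const TYPE('n) * ((1 / \<epsilon>) ^ CARD('n) *\<^sub>R gauss (-1) ((1 / \<epsilon>) *\<^sub>R y))"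
proof -
  have [measurable]: "gauss (-1) \<in> borel_measurable (borel :: (real^'n) measure)"
    by (intro borel_measurable_continuous_onI gauss_continuous)
  have "fourier (\<lambda>\<eta>. gauss (-1) (\<epsilon> *\<^sub>R \<eta>)) y = \<bar>1 / \<epsilon>\<bar> ^ DIM(real^'n) *\<^sub>R
      (LINT \<eta>|lborel. cis (- (((1 / \<epsilon>) *\<^sub>R \<eta>) \<bullet> y)) * gauss (-1) (\<epsilon> *\<^sub>R ((1 / \<epsilon>) *\<^sub>R \<eta>)))"
    unfolding fourier_def by (rule lborel_integral_scale) (use e in auto)
  also have "\<dots> = (1 / \<epsilon>) ^ CARD('n) *\<^sub>R fourier (gauss (-1)) ((1 / \<epsilon>) *\<^sub>R y)"
    using e by (simp add: fourier_def)
  finally show ?thesis by (simp add: fourier_gauss scaleR_conv_of_real mult_ac)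
qed

lemma cmod_gauss_le_1: "cmod (gauss (-1) x) \<le> 1"
  by (simp add: gauss_def)

lemma gauss_tendsto_1: "(\<lambda>k. gauss s (inverse (real (Suc k)) *\<^sub>R x)) \<longlonglongrightarrow> 1"
proof -
  have "(\<lambda>k. inverse (real (Suc k)) *\<^sub>R x) \<longlonglongrightarrow> 0 *\<^sub>R x"
    by (intro tendsto_scaleR LIMSEQ_inverse_real_of_nat tendsto_const)
  then have "(\<lambda>k. gauss s (inverse (real (Suc k)) *\<^sub>R x)) \<longlonglongrightarrow> gauss s (0 *\<^sub>R x)"
    using gauss_continuous[of s] by (intro isCont_tendsto_compose[of _ "gauss s"]) (auto simp: continuous_on_eq_continuous_at)
  then show ?thesis by (simp add: gauss_def)
qed

text \<open>Gaussian regularization: the multiplication formula moves the transform onto a scaled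
  Gaussian, and the scale tends to 0. Dominated convergence applies on both sides, with
  \<bar>fourier f\<bar> on one and B times the Gaussian on the other. Evaluation at the origin is
  enough because translations are built into \<open>stft\<close>.\<close>

lemma fourier_inversion_0:
  fixes f :: "real^'n::finite \<Rightarrow> complex"
  assumes f: "continuous_on UNIV f" "\<And>x. cmod (f x) \<le> B" "integrable lborel f" and F: "integrable lborel (fourier f)"
  shows "(LINT \<xi>|lborel. fourier f \<xi>) = (gauss_const TYPE('n))\<^sup>2 * f 0"
proof -
  let ?g = "gauss (-1) :: real^'n \<Rightarrow> complex" and ?c = "gauss_const TYPE('n)"
  let ?e = "\<lambda>k. inverse (real (Suc k))"
  have g: "?g \<in> rapid" "(\<lambda>x. ?g (?e k *\<^sub>R x)) \<in> rapid" for k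
    using gauss_Q_set gauss_scale_Q_set[of "?e k"] Q_set_subset_rapid by (auto simp: divide_simps)
  have [measurable]: "f \<in> borel_measurable borel" "?g \<in> borel_measurable borel" "fourier f \<in> borel_measurable borel"
    using f(1) rapid_measurable[OF g(1)] borel_measurable_integrable[OF F] by (auto intro: borel_measurable_continuous_onI)
  have eq: "(LINT \<xi>|lborel. fourier f \<xi> * ?g (?e k *\<^sub>R \<xi>)) = ?c * (LINT z|lborel. f (?e k *\<^sub>R z) * ?g z)" for k
  proof -
    define e where "e = ?e k"
    have e: "e > 0" by (simp add: e_def)
    have "(LINT \<xi>|lborel. fourier f \<xi> * ?g (e *\<^sub>R \<xi>)) = (LINT y|lborel. f y * fourier (\<lambda>\<eta>. ?g (e *\<^sub>R \<eta>)) y)"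
      unfolding e_def by (rule fourier_multiplication[OF f(3) rapid_integrable[OF g(2)]])
    also have "\<dots> = \<bar>e\<bar> ^ DIM(real^'n) *\<^sub>R
       (LINT y|lborel. f (e *\<^sub>R y) * (?c * ((1 / e) ^ CARD('n) *\<^sub>R ?g ((1 / e) *\<^sub>R (e *\<^sub>R y)))))"
      unfolding fourier_gauss_scale[OF e] by (rule lborel_integral_scale) (use e in auto)
    also have "(\<lambda>y. f (e *\<^sub>R y) * (?c * ((1 / e) ^ CARD('n) *\<^sub>R ?g ((1 / e) *\<^sub>R (e *\<^sub>R y))))) =
       (\<lambda>y. (?c * of_real ((1 / e) ^ CARD('n))) * (f (e *\<^sub>R y) * ?g y))"
    proof
      fix y :: "real^'n"
      have "(1 / e) *\<^sub>R (e *\<^sub>R y) = y" using e by simp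
      then show "f (e *\<^sub>R y) * (?c * ((1 / e) ^ CARD('n) *\<^sub>R ?g ((1 / e) *\<^sub>R (e *\<^sub>R y)))) =
         (?c * of_real ((1 / e) ^ CARD('n))) * (f (e *\<^sub>R y) * ?g y)"
        by (simp only: scaleR_conv_of_real mult_ac)
    qed
    also have "(LINT y|lborel. (?c * of_real ((1 / e) ^ CARD('n))) * (f (e *\<^sub>R y) * ?g y)) =
        (?c * of_real ((1 / e) ^ CARD('n))) * (LINT y|lborel. (f (e *\<^sub>R y) * ?g y))"
      by (rule integral_mult_right_zero)
    also have "\<bar>e\<bar> ^ DIM(real^'n) *\<^sub>R \<dots> = (of_real (e ^ CARD('n) * (1 / e) ^ CARD('n)) * ?c) * (LINT y|lborel. (f (e *\<^sub>R y) * ?g y))"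
      using e by (simp add: scaleR_conv_of_real)
    also have "e ^ CARD('n) * (1 / e) ^ CARD('n) = 1"
      using e by (simp add: power_mult_distrib[symmetric])
    finally show ?thesis by (simp add: e_def)
  qed
  have "(\<lambda>k. LINT \<xi>|lborel. fourier f \<xi> * ?g (?e k *\<^sub>R \<xi>)) \<longlonglongrightarrow> (LINT \<xi>|lborel. fourier f \<xi> * 1)"
  proof (rule integral_dominated_convergence[where w = "\<lambda>x. cmod (fourier f x)"])
    show "AE \<xi> in lborel. (\<lambda>k. fourier f \<xi> * ?g (?e k *\<^sub>R \<xi>)) \<longlonglongrightarrow> fourier f \<xi> * 1"
      by (intro AE_I2 tendsto_mult tendsto_const gauss_tendsto_1)
    show "AE \<xi> in lborel. cmod (fourier f \<xi> * ?g (?e k *\<^sub>R \<xi>)) \<le> cmod (fourier f \<xi>)" for k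
      using cmod_gauss_le_1 by (intro AE_I2) (simp only: norm_mult, intro mult_left_le, auto)
  qed (use F in auto)
  moreover have "(\<lambda>k. LINT z|lborel. f (?e k *\<^sub>R z) * ?g z) \<longlonglongrightarrow> (LINT z|lborel. f 0 * ?g z)"
  proof (rule integral_dominated_convergence[where w = "\<lambda>x. B * cmod (?g x)"])
    have "(\<lambda>k. ?e k *\<^sub>R z) \<longlonglongrightarrow> 0 *\<^sub>R z" for z :: "real^'n"
      by (intro tendsto_scaleR LIMSEQ_inverse_real_of_nat tendsto_const)
    then have "(\<lambda>k. f (?e k *\<^sub>R z)) \<longlonglongrightarrow> f (0 *\<^sub>R z)" for z
      using f(1) by (intro isCont_tendsto_compose[of _ f]) (auto simp: continuous_on_eq_continuous_at)
    then show "AE z in lborel. (\<lambda>k. f (?e k *\<^sub>R z) * ?g z) \<longlonglongrightarrow> f 0 * ?g z"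
      by (intro AE_I2 tendsto_mult tendsto_const) simp
    show "AE z in lborel. cmod (f (?e k *\<^sub>R z) * ?g z) \<le> B * cmod (?g z)" for k
      using f(2) by (intro AE_I2) (simp add: norm_mult mult_right_mono)
    show "integrable lborel (\<lambda>x. B * cmod (?g x))"
      using rapid_integrable[OF g(1)] by (intro integrable_mult_right integrable_norm)
  qed auto
  then have "(\<lambda>k. ?c * (LINT z|lborel. f (?e k *\<^sub>R z) * ?g z)) \<longlonglongrightarrow> ?c * (LINT z|lborel. f 0 * ?g z)"
    by (intro tendsto_mult tendsto_const)
  ultimately have "(LINT \<xi>|lborel. fourier f \<xi> * 1) = ?c * (LINT z|lborel. f 0 * ?g z)"
    unfolding eq by (rule LIMSEQ_unique)
  moreover have "(LINT z|lborel. ?g z) = ?c" by (simp add: gauss_const_def fourier_def)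
  ultimately show ?thesis by (simp add: power2_eq_square)
qed

lemma exp_le_wt_integer: "l \<le> real n \<Longrightarrow> exp (l * wt x) \<le> growth n x"
  by (simp add: mult_right_mono wt_nonneg)

text \<open>Differentiating k times along the largest coordinate of \<xi> gives the factor
  \<bar>\<xi>\<bar>^k up to N^k, which a larger M absorbs. The order k is then chosen by
  \<open>W_inf\<close>, where convexity enters; its loss of one factor \<bar>\<xi>\<bar> is absorbed
  by exp \<omega>, hence m + 1 instead of m.\<close>

lemma fourier_decay:
  assumes "1 \<le> m"
  shows "\<exists>M\<ge>1. \<exists>C>0. \<forall>(h :: real^'n::finite \<Rightarrow> complex) A. h \<in> rapid \<longrightarrow> UB M (\<lambda>x. A * exp (- wt x)) h \<longrightarrow>
     (\<forall>\<xi>. cmod (fourier h \<xi>) \<le> C * A * decay m \<xi>)"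
proof -
  let ?N = "real CARD('n)" and ?I = "I_wt TYPE('n)"
  have N: "?N \<ge> 1" by (simp add: Suc_le_eq)
  obtain M C where MC: "M \<ge> m + 1" "C > 0" "\<And>k. ?N ^ k * W M k \<le> C * W (m + 1) k"
    using W_geometric[of "m + 1" ?N] N by auto
  have M: "1 \<le> M" using MC by simp
  obtain P where P: "P > 0" "\<And>t. t \<ge> 0 \<Longrightarrow> (1 + t) ^ 1 \<le> P * exp (\<omega> t)" using power_le_exp_\<omega> by blast
  \<comment> \<open>The first term serves \<bar>\<xi>\<bar> > 1, the second \<bar>\<xi>\<bar> \<le>
    1, where the weight vanishes and the bound of order 0 is enough.\<close>
  define Q where "Q = ?I * C * P + ?I * W M 0 + 1"
  have Q: "Q > 0" "?I * C * P \<le> Q" "?I * W M 0 \<le> Q"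
    using I_wt_nonneg[where 'n='n] MC(2) P(1) W_pos[OF M, of 0] by (auto simp: Q_def intro!: add_nonneg_pos)
  have "cmod (fourier h \<xi>) \<le> Q * A * decay m \<xi>"
    if h: "h \<in> rapid" and UB: "UB M (\<lambda>x. A * exp (- wt x)) h" for h :: "real^'n \<Rightarrow> complex" and A \<xi>
  proof -
    have A: "0 \<le> A" by (rule UB_const_nonneg[OF M UB])
    have F: "cmod (fourier (Dw w h) \<xi>) \<le> A * W M (length w) * ?I" for w
      using UB_D[OF UB, of w] rapid_measurable[OF rapid_Dw[OF h]] by (intro fourier_bound_wt) (auto simp: mult_ac)
    show ?thesis
    proof (cases "norm \<xi> \<le> 1")
      case True
      then have "wt \<xi> = 0" by (intro \<omega>_zero) auto
      moreover have "A * W M 0 * ?I \<le> Q * A"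
        using mult_left_mono[OF Q(3) A] by (simp add: mult_ac)
      ultimately show ?thesis using F[of "[]"] by simp
    next
      case False
      let ?R = "norm \<xi>"
      obtain k where k: "W (m + 1) k \<le> ?R ^ k * ?R * exp (- (real (m + 1) * \<omega> ?R))"
        using W_inf[of "m + 1" ?R] False by auto
      obtain j where j: "?R \<le> ?N * \<bar>\<xi> $ j\<bar>"
      proof -
        have "\<exists>j. ?R \<le> ?N * \<bar>\<xi> $ j\<bar>"
        proof (rule ccontr)
          assume "\<not> ?thesis"
          then have "(\<Sum>j\<in>(UNIV::'n set). ?N * \<bar>\<xi> $ j\<bar>) < (\<Sum>j\<in>(UNIV::'n set). ?R)"
            by (intro sum_strict_mono) (auto simp: not_le)
          then have "(\<Sum>j\<in>UNIV. \<bar>\<xi> $ j\<bar>) < ?R" by (simp add: sum_distrib_left[symmetric])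
          then show False using norm_le_l1_cart[of \<xi>] by simp
        qed
        then show thesis using that by blast
      qed
      have pe: "(\<Prod>i\<leftarrow>replicate k j. \<i> * complex_of_real (\<xi> $ i)) = (\<i> * of_real (\<xi> $ j)) ^ k"
        by (induction k) auto
      have eq: "cmod (fourier (Dw (replicate k j) h) \<xi>) = \<bar>\<xi> $ j\<bar> ^ k * cmod (fourier h \<xi>)"
        unfolding fourier_Dw[OF h] pe norm_mult norm_power by simp
      have "?R ^ k * cmod (fourier h \<xi>) \<le> (?N * \<bar>\<xi> $ j\<bar>) ^ k * cmod (fourier h \<xi>)"
        using j by (intro mult_right_mono power_mono) auto
      also have "\<dots> = ?N ^ k * cmod (fourier (Dw (replicate k j) h) \<xi>)"
        by (simp only: eq power_mult_distrib mult.assoc)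
      also have "\<dots> \<le> ?N ^ k * (A * W M k * ?I)"
        using F[of "replicate k j"] by (intro mult_left_mono) auto
      also have "\<dots> = A * ?I * (?N ^ k * W M k)" by simp
      also have "\<dots> \<le> A * ?I * (C * W (m + 1) k)"
        using A I_wt_nonneg[where 'n='n] by (intro mult_left_mono MC) auto
      also have "\<dots> \<le> A * ?I * (C * (?R ^ k * ?R * exp (- (real (m + 1) * \<omega> ?R))))"
        using A I_wt_nonneg[where 'n='n] MC(2) k by (intro mult_left_mono) auto
      also have "\<dots> \<le> A * ?I * (C * (?R ^ k * (P * exp (\<omega> ?R)) * exp (- (real (m + 1) * \<omega> ?R))))"
        using A I_wt_nonneg[where 'n='n] MC(2) P(2)[of ?R] by (intro mult_left_mono mult_right_mono) auto
      also have "\<dots> = ?R ^ k * (A * (?I * C * P) * (exp (\<omega> ?R) * exp (- (real (m + 1) * \<omega> ?R))))" by simp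
      also have "\<dots> \<le> ?R ^ k * (A * Q * (exp (\<omega> ?R) * exp (- (real (m + 1) * \<omega> ?R))))"
        using A Q by (intro mult_left_mono mult_right_mono) auto
      also have "exp (\<omega> ?R) * exp (- (real (m + 1) * \<omega> ?R)) = exp (- (real m * \<omega> ?R))"
        by (simp add: exp_add[symmetric] algebra_simps)
      finally have "?R ^ k * cmod (fourier h \<xi>) \<le> ?R ^ k * (A * Q * exp (- (real m * \<omega> ?R)))" .
      moreover have "?R ^ k > 0" using False by (intro zero_less_power) linarith
      ultimately show ?thesis by (simp add: mult_ac)
    qed
  qed
  then show ?thesis using Q(1) M by blast
qed

text \<open>The short-time Fourier transform with Gaussian window, up to a phase: translating f in
  place of the window removes exp(-i x \<xi>), so moduli agree.\<close>

definition stft :: "(real^'n::finite \<Rightarrow> complex) \<Rightarrow> real^'n \<Rightarrow> real^'n \<Rightarrow> complex" where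
  "stft f x = fourier (\<lambda>y. f (x + y) * gauss (-1) y)"

text \<open>The derivatives of y \<mapsto> f (x + y) \<open>gauss (-1) y\<close> at 0 are integrals
  of \<xi>^w times the transform, and \<bar>\<xi>\<bar>^k \<open>decay M \<xi>\<close> \<le>
  \<open>W M k\<close> by the very definition of W. One more factor exp(-\<omega>) secures
  integrability, hence the witness M + 1. Multiplication by \<open>gauss 1\<close> removes the
  window; its derivatives at 0 are at most k! e^k.\<close>

lemma reconstruct:
  assumes "1 \<le> m"
  shows "\<exists>M\<ge>1. \<exists>C>0. \<forall>(f :: real^'n::finite \<Rightarrow> complex) x A. smooth f \<longrightarrow> (\<lambda>y. f (x + y) * gauss (-1) y) \<in> rapid \<longrightarrow>
     (\<forall>\<xi>. cmod (stft f x \<xi>) \<le> A * decay M \<xi>) \<longrightarrow>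
     (\<forall>w. cmod (Dw w f x) \<le> C * A * W m (length w))"
proof -
  let ?I = "I_wt TYPE('n)" and ?c = "gauss_const TYPE('n)"
  obtain M B where MB: "M \<ge> m" "B > 0" "\<And>k. 2 ^ k * W M k \<le> B * W m k"
    using W_geometric[OF assms, of 2] by auto
  have M: "1 \<le> M" using MB assms by simp
  obtain D where D: "D > 0" "\<And>k. fact k * exp (real k) \<le> D * W M k" using fact_le_W[OF M] by blast
  define C where "C = (?I + 1) / (cmod ?c)\<^sup>2 * D * B"
  have C: "C > 0" unfolding C_def using I_wt_nonneg[where 'n='n] D(1) MB(2) gauss_const_nonzero[where 'n='n]
    by (intro mult_pos_pos divide_pos_pos) auto
  have "cmod (Dw w f x) \<le> C * A * W m (length w)"
    if f: "smooth f" and hD: "(\<lambda>y. f (x + y) * gauss (-1) y) \<in> rapid"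
      and F: "\<And>\<xi>. cmod (stft f x \<xi>) \<le> A * decay (M + 1) \<xi>"
    for f :: "real^'n \<Rightarrow> complex" and x A w
  proof -
    define h where "h y = f (x + y) * gauss (-1) y" for y
    have h: "h \<in> rapid" using hD unfolding h_def[abs_def] .
    have F: "cmod (fourier h \<xi>) \<le> A * decay (M + 1) \<xi>" for \<xi>
      using F[of \<xi>] by (simp add: stft_def h_def[abs_def])
    have A: "0 \<le> A" using bound_const_nonneg[OF F] .
    have 1: "cmod (Dw w h 0) \<le> A * (?I + 1) / (cmod ?c)\<^sup>2 * W M (length w)" for w
    proof -
      let ?k = "length w"
      have wD: "Dw w h \<in> rapid" by (rule rapid_Dw[OF h])
      have b: "cmod (fourier (Dw w h) \<xi>) \<le> (A * W M ?k) * exp (- wt \<xi>)" for \<xi>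
      proof -
        have "norm \<xi> ^ ?k * decay M \<xi> \<le> W M ?k"
        proof (cases "norm \<xi> \<le> 1")
          case True
          then have "norm \<xi> ^ ?k * decay M \<xi> \<le> 1 * 1"
            by (intro mult_mono power_le_one) (auto intro: mult_nonneg_nonneg wt_nonneg)
          then show ?thesis using W_ge_1[OF M, of ?k] by simp
        qed (simp add: W_upper[OF M])
        then have "A * exp (- wt \<xi>) * (norm \<xi> ^ ?k * decay M \<xi>) \<le> A * exp (- wt \<xi>) * W M ?k"
          using A by (intro mult_left_mono) auto
        moreover have "cmod (fourier (Dw w h) \<xi>) \<le> norm \<xi> ^ ?k * (A * decay (M + 1) \<xi>)"
          by (rule order_trans[OF fourier_Dw_norm[OF h] mult_left_mono[OF F]]) simp
        moreover have "decay (M + 1) \<xi> = exp (- wt \<xi>) * decay M \<xi>"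
          by (simp add: exp_add[symmetric] algebra_simps)
        ultimately show ?thesis by (simp add: mult_ac)
      qed
      have meas: "fourier (Dw w h) \<in> borel_measurable borel"
        by (intro borel_measurable_continuous_onI smooth_continuous smooth_fourier wD)
      obtain Z where Z: "\<And>x. cmod (Dw w h x) \<le> Z * decay 0 x" using rapid_bound[OF wD] by blast
      have "(LINT \<xi>|lborel. fourier (Dw w h) \<xi>) = ?c\<^sup>2 * Dw w h 0"
        by (rule fourier_inversion_0[OF smooth_continuous[OF rapid_smooth[OF wD]] _ rapid_integrable[OF wD] integrable_bound_wt(1)[OF meas b]])
          (use Z in auto)
      then have "(cmod ?c)\<^sup>2 * cmod (Dw w h 0) \<le> A * W M ?k * ?I"
        using integrable_bound_wt(2)[OF meas b] by (simp add: norm_mult norm_power)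
      also have "\<dots> \<le> A * W M ?k * (?I + 1)"
        using A W_pos[OF M, of ?k] by (intro mult_left_mono) auto
      finally show ?thesis using gauss_const_nonzero[where 'n='n] by (simp add: field_simps)
    qed
    have 2: "cmod (Dw w (gauss 1) (0 :: real^'n)) \<le> D * W M (length w)" for w
      using Dw_gauss_bound_exp[of 1 w 0] D(2)[of "length w"] by (simp add: gauss_def)
    have "f (x + y) = h y * gauss 1 y" for y
      by (simp add: h_def gauss_def exp_of_real[symmetric] exp_add[symmetric])
    then have "Dw w (\<lambda>y. f (x + y)) 0 = Dw w (\<lambda>y. h y * gauss 1 y) 0" by simp
    then have "cmod (Dw w f x) = cmod (Dw w (\<lambda>y. h y * gauss 1 y) 0)" by (simp add: Dw_translate)
    also have "\<dots> \<le> A * (?I + 1) / (cmod ?c)\<^sup>2 * D * (2 ^ length w * W M (length w))"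
      by (rule Dw_mult_bound[OF M rapid_smooth[OF h] smooth_gauss 1 2])
    also have "\<dots> \<le> A * (?I + 1) / (cmod ?c)\<^sup>2 * D * (B * W m (length w))"
      using A D(1) I_wt_nonneg[where 'n='n] by (intro mult_left_mono MB) auto
    finally show ?thesis by (simp add: C_def mult_ac)
  qed
  then show ?thesis using C M by (intro exI[of _ "M + 1"] conjI exI[of _ C]) auto
qed

section \<open>The space \<open>S_set \<omega>\<close>\<close>

text \<open>Derivatives of the transform are transforms of polynomial multiples of f, which remain
  in \<open>Q_set\<close>, and \<open>fourier_decay\<close> applies to these.\<close>

lemma Q_set_subset_S_set: "Q_set \<subseteq> (S_set \<omega> :: (real^'n::finite \<Rightarrow> complex) set)"
proof
  fix f :: "real^'n \<Rightarrow> complex" assume f: "f \<in> Q_set"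
  then have fD: "f \<in> rapid" using Q_set_subset_rapid by blast
  have 1: "bdd_above (range (\<lambda>x. exp (l * wt x) * cmod (mderiv \<alpha> f x)))" if "l > 0" for l \<alpha>
  proof -
    obtain C where C: "\<And>x. cmod (Dw (multiword \<alpha>) f x) \<le> C * decay (nat \<lceil>l\<rceil>) x"
      using rapid_D[OF fD] by blast
    show ?thesis
    proof (rule bdd_aboveI2)
      fix x
      have "exp (l * wt x) * cmod (mderiv \<alpha> f x) \<le> growth (nat \<lceil>l\<rceil>) x * (C * decay (nat \<lceil>l\<rceil>) x)"
        unfolding mderiv_eq_Dw by (intro mult_mono exp_le_wt_integer C) (auto, linarith)
      also have "\<dots> = C * (growth (nat \<lceil>l\<rceil>) x * decay (nat \<lceil>l\<rceil>) x)"
        by (simp only: mult_ac)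
      finally show "exp (l * wt x) * cmod (mderiv \<alpha> f x) \<le> C" by (simp only: exp_minus_inverse mult_1_right)
    qed
  qed
  have 2: "bdd_above (range (\<lambda>x. exp (l * wt x) * cmod (mderiv \<alpha> (fourier f) x)))" if l: "l > 0" for l \<alpha>
  proof -
    define m where "m = nat \<lceil>l\<rceil>"
    have m: "1 \<le> m" "l \<le> real m" using l by (auto simp: m_def) linarith+
    obtain M C where MC: "M \<ge> 1" "\<And>(h :: real^'n \<Rightarrow> complex) A \<xi>. h \<in> rapid \<Longrightarrow> UB M (\<lambda>x. A * exp (- wt x)) h \<Longrightarrow>
       cmod (fourier h \<xi>) \<le> C * A * decay m \<xi>"
      using fourier_decay[OF m(1), where 'n='n] by blast
    have "Dw (multiword \<alpha>) (fourier f) \<in> fourier ` Q_set"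
      by (rule Dw_fourier[OF f Q_set_subset_rapid]) (intro Q_set_cmult Q_set_mult_ON[OF _ coordinate_ON])
    then obtain h where h: "h \<in> Q_set" "mderiv \<alpha> (fourier f) = fourier h" by (auto simp: mderiv_eq_Dw)
    obtain A where A: "UB M (\<lambda>x. A * decay 1 x) h" using Q_set_D[OF h(1) MC(1)] by blast
    show ?thesis
    proof (rule bdd_aboveI2)
      fix x
      have "exp (l * wt x) * cmod (fourier h x) \<le> growth m x * (C * A * decay m x)"
        using MC(2)[of h A x] A h(1) Q_set_subset_rapid by (intro mult_mono exp_le_wt_integer m) auto
      also have "\<dots> = C * A * (growth m x * decay m x)"
        by (simp only: mult_ac)
      finally show "exp (l * wt x) * cmod (mderiv \<alpha> (fourier f) x) \<le> C * A"
        unfolding h(2) by (simp only: exp_minus_inverse mult_1_right)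
    qed
  qed
  show "f \<in> S_set \<omega>"
    unfolding S_set_def using 1 2 rapid_integrable[OF fD] Q_set_smooth[OF f] smooth_fourier[OF fD] by auto
qed

lemma S_set_subset_rapid: "S_set \<omega> \<subseteq> rapid"
proof
  fix f :: "real^'n::finite \<Rightarrow> complex" assume f: "f \<in> S_set \<omega>"
  then have s: "smooth f" by (simp add: S_set_def)
  have "\<exists>C. \<forall>x. cmod (Dw w f x) \<le> C * decay n x" for w n
  proof -
    \<comment> \<open>The rate Suc n is positive also for n = 0, as the condition in
      \<open>S_set\<close> demands.\<close>
    have "bdd_above (range (\<lambda>x. growth (Suc n) x * cmod (Dw w f x)))"
      using f unfolding S_set_def Dw_eq_mderiv[OF s] by (auto simp del: of_nat_Suc)
    then obtain C where C: "\<And>x. growth (Suc n) x * cmod (Dw w f x) \<le> C"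
      unfolding bdd_above_def by auto
    have "cmod (Dw w f x) \<le> C * decay n x" for x
    proof -
      have "growth n x * cmod (Dw w f x) \<le> C"
        by (rule order_trans[OF mult_right_mono C]) (auto intro!: mult_right_mono wt_nonneg)
      then show ?thesis by (simp add: exp_minus field_simps)
    qed
    then show ?thesis by blast
  qed
  then show "f \<in> rapid" using s by (simp add: rapid_def)
qed

text \<open>The multiplication formula with a modulated and translated Gaussian. It moves the
  short-time transform to the frequency side, where decay of \<open>fourier f\<close> becomes decay
  in \<xi> that is uniform in x.\<close>

lemma stft_eq:
  fixes f :: "real^'n::finite \<Rightarrow> complex"
  assumes f: "f \<in> rapid"
  shows "gauss_const TYPE('n) * stft f x \<xi> = (LINT \<eta>|lborel. fourier f \<eta> * (cis (x \<bullet> \<eta>) * gauss (-1) (\<eta> - \<xi>)))"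
proof -
  let ?g = "gauss (-1) :: real^'n \<Rightarrow> complex" and ?c = "gauss_const TYPE('n)"
  have g: "?g \<in> rapid" using gauss_Q_set Q_set_subset_rapid by blast
  have [measurable]: "f \<in> borel_measurable borel" "?g \<in> borel_measurable borel"
    using f g by (auto intro: rapid_measurable)
  let ?\<psi> = "\<lambda>\<eta>. cis (x \<bullet> \<eta>) * ?g (\<eta> - \<xi>)"
  have "(\<lambda>\<eta>. ?g (- \<xi> + \<eta>)) \<in> rapid" by (rule rapid_translate[OF g])
  then have i: "integrable lborel (\<lambda>\<eta>. ?g (\<eta> - \<xi>))" using rapid_integrable by fastforce
  have psi: "integrable lborel ?\<psi>"
    using integrable_cis_mult[OF i, of "- x"] by (simp add: inner_commute)
  have F: "fourier ?\<psi> y = ?c * (cis ((x - y) \<bullet> \<xi>) * ?g (y - x))" for y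
  proof -
    let ?u = "\<lambda>\<eta>. cis (- (\<eta> \<bullet> y)) * (cis (x \<bullet> \<eta>) * ?g (\<eta> - \<xi>))"
    have "fourier ?\<psi> y = (LINT \<zeta>|lborel. ?u (\<xi> + \<zeta>))"
      unfolding fourier_def by (rule lborel_integral_translate[symmetric]) measurable
    also have "(\<lambda>\<zeta>. ?u (\<xi> + \<zeta>)) = (\<lambda>\<zeta>. cis ((x - y) \<bullet> \<xi>) * (cis (- (\<zeta> \<bullet> (y - x))) * ?g \<zeta>))"
    proof
      fix \<zeta>
      have "cis (- ((\<xi> + \<zeta>) \<bullet> y)) * cis (x \<bullet> (\<xi> + \<zeta>)) = cis ((x - y) \<bullet> \<xi>) * cis (- (\<zeta> \<bullet> (y - x)))"
        unfolding cis_mult by (rule arg_cong[where f=cis]) (simp add: inner_simps inner_commute)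
      then show "?u (\<xi> + \<zeta>) = cis ((x - y) \<bullet> \<xi>) * (cis (- (\<zeta> \<bullet> (y - x))) * ?g \<zeta>)"
        by (simp add: mult.assoc[symmetric])
    qed
    also have "(LINT \<zeta>|lborel. cis ((x - y) \<bullet> \<xi>) * (cis (- (\<zeta> \<bullet> (y - x))) * ?g \<zeta>)) = cis ((x - y) \<bullet> \<xi>) * fourier ?g (y - x)"
      by (simp add: fourier_def)
    finally show ?thesis by (simp add: fourier_gauss mult_ac)
  qed
  have "(LINT \<eta>|lborel. fourier f \<eta> * ?\<psi> \<eta>) = (LINT y|lborel. f y * fourier ?\<psi> y)"
    by (rule fourier_multiplication[OF rapid_integrable[OF f] psi])
  also have "\<dots> = (LINT y|lborel. ?c * (cis ((x - y) \<bullet> \<xi>) * f y * ?g (y - x)))"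
    unfolding F by (simp add: mult_ac)
  also have "\<dots> = ?c * (LINT y|lborel. cis ((x - y) \<bullet> \<xi>) * f y * ?g (y - x))" by (rule integral_mult_right_zero)
  also have "(LINT y|lborel. cis ((x - y) \<bullet> \<xi>) * f y * ?g (y - x)) = (LINT y|lborel. cis ((x - (x + y)) \<bullet> \<xi>) * f (x + y) * ?g (x + y - x))"
    by (rule lborel_integral_translate[symmetric]) measurable
  also have "\<dots> = stft f x \<xi>" by (simp add: stft_def fourier_def mult.assoc)
  finally show ?thesis by simp
qed

lemma exp_wt_translate':
  "decay (n * K) (x + y) \<le> exp (real (n * K)) * growth (n * K) y * decay n x"
  using exp_wt_translate[of n y x] by (simp add: add.commute)

text \<open>Decay of f gives decay of \<open>stft f x \<xi>\<close> in x, decay of the transform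
  gives decay in \<xi>. Joint decay of every rate follows, and reconstruction at x turns it into
  bounds with one constant for all orders of differentiation.\<close>

lemma S_set_subset_Q_set: "(S_set \<omega> :: (real^'n::finite \<Rightarrow> complex) set) \<subseteq> Q_set"
proof
  fix f :: "real^'n \<Rightarrow> complex" assume f: "f \<in> S_set \<omega>"
  then have fD: "f \<in> rapid" using S_set_subset_rapid by blast
  let ?g = "gauss (-1) :: real^'n \<Rightarrow> complex" and ?I = "I_wt TYPE('n)" and ?c = "gauss_const TYPE('n)"
  have g: "?g \<in> rapid" using gauss_Q_set Q_set_subset_rapid by blast
  have [measurable]: "f \<in> borel_measurable borel" "?g \<in> borel_measurable borel" "fourier f \<in> borel_measurable borel"
    using fD g by (auto intro: rapid_measurable borel_measurable_continuous_onI[OF smooth_continuous[OF smooth_fourier]])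
  have hD: "(\<lambda>y. f (x + y) * ?g y) \<in> rapid" for x
    using rapid_mult[OF rapid_translate[OF fD] subsetD[OF rapid_subset_slow g]] .
  have a: "\<exists>C\<ge>0. \<forall>x \<xi>. cmod (stft f x \<xi>) \<le> C * decay n x" for n
  proof -
    obtain A where A: "A \<ge> 0" "\<And>x. cmod (f x) \<le> A * decay (n * K) x" using rapid_bound[OF fD] by blast
    obtain B where B: "B \<ge> 0" "\<And>x. cmod (?g x) \<le> B * decay (n * K + 1) x" using rapid_bound[OF g] by blast
    let ?C = "A * B * exp (real (n * K)) * ?I"
    have "cmod (stft f x \<xi>) \<le> ?C * decay n x" for x \<xi>
    proof -
      have "cmod (f (x + y) * ?g y) \<le> (A * B * exp (real (n * K)) * decay n x) * exp (- wt y)" for y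
      proof -
        have "cmod (f (x + y) * ?g y) \<le>
           (A * (exp (real (n * K)) * growth (n * K) y * decay n x)) * (B * decay (n * K + 1) y)"
          unfolding norm_mult using A(1) B
          by (intro mult_mono order_trans[OF A(2) mult_left_mono[OF exp_wt_translate']]) auto
        also have "\<dots> = A * B * exp (real (n * K)) * decay n x * (growth (n * K) y * decay (n * K + 1) y)"
          by (simp only: mult_ac)
        also have "growth (n * K) y * decay (n * K + 1) y = exp (- wt y)"
          by (simp add: exp_add[symmetric] algebra_simps)
        finally show ?thesis .
      qed
      then have "cmod (stft f x \<xi>) \<le> (A * B * exp (real (n * K)) * decay n x) * ?I"
        unfolding stft_def by (rule fourier_bound_wt[OF rapid_measurable[OF hD]])
      then show ?thesis by (simp only: mult_ac)
    qed
    moreover have "?C \<ge> 0" using A(1) B(1) I_wt_nonneg[where 'n='n] by simp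
    ultimately show ?thesis by blast
  qed
  have b: "\<exists>C\<ge>0. \<forall>x \<xi>. cmod (stft f x \<xi>) \<le> C * decay n \<xi>" for n
  proof -
    have "bdd_above (range (\<lambda>x. growth (n * K + 1) x * cmod (mderiv (\<lambda>_. 0) (fourier f) x)))"
      using f unfolding S_set_def by (auto simp del: of_nat_add of_nat_mult)
    moreover have "multiword (\<lambda>_::'n. 0) = []" by (simp add: multiword_def)
    ultimately have "bdd_above (range (\<lambda>x. growth (n * K + 1) x * cmod (fourier f x)))"
      by (simp add: mderiv_eq_Dw)
    then obtain A where A: "\<And>x. growth (n * K + 1) x * cmod (fourier f x) \<le> A"
      unfolding bdd_above_def by auto
    have A0: "0 \<le> A" using A[of 0] by (smt (verit) mult_nonneg_nonneg norm_ge_zero exp_ge_zero)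
    have A': "cmod (fourier f x) \<le> A * decay (n * K) x * exp (- wt x)" for x
      using A[of x] by (simp add: exp_minus field_simps exp_add)
    obtain B where B: "B \<ge> 0" "\<And>x. cmod (?g x) \<le> B * decay (n * K) x" using rapid_bound[OF g] by blast
    let ?C = "A * B * exp (real (n * K)) * ?I / cmod ?c"
    have "cmod (stft f x \<xi>) \<le> ?C * decay n \<xi>" for x \<xi>
    proof -
      have "cmod (fourier f \<eta> * (cis (x \<bullet> \<eta>) * ?g (\<eta> - \<xi>))) \<le> (A * B * exp (real (n * K)) * decay n \<xi>) * exp (- wt \<eta>)" for \<eta>
      proof -
        have "decay (n * K) \<eta> \<le> exp (real (n * K)) * growth (n * K) (\<eta> - \<xi>) * decay n \<xi>"
          using exp_wt_translate'[of n \<xi> "\<eta> - \<xi>"] by simp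
        from order_trans[OF A' mult_right_mono[OF mult_left_mono[OF this A0], of "exp (- wt \<eta>)"]]
        have "cmod (fourier f \<eta>) \<le> A * (exp (real (n * K)) * growth (n * K) (\<eta> - \<xi>) * decay n \<xi>) * exp (- wt \<eta>)"
          by simp
        then have "cmod (fourier f \<eta> * (cis (x \<bullet> \<eta>) * ?g (\<eta> - \<xi>))) \<le>
           (A * (exp (real (n * K)) * growth (n * K) (\<eta> - \<xi>) * decay n \<xi>) * exp (- wt \<eta>)) * (B * decay (n * K) (\<eta> - \<xi>))"
          unfolding norm_mult norm_cis mult_1 using A0 B by (intro mult_mono) auto
        also have "\<dots> = (A * B * exp (real (n * K)) * decay n \<xi>) * exp (- wt \<eta>) * (growth (n * K) (\<eta> - \<xi>) * decay (n * K) (\<eta> - \<xi>))"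
          by (simp only: mult_ac)
        finally show ?thesis by (simp only: exp_minus_inverse mult_1_right)
      qed
      then have "cmod (?c * stft f x \<xi>) \<le> (A * B * exp (real (n * K)) * decay n \<xi>) * ?I"
        unfolding stft_eq[OF fD] by (intro integrable_bound_wt(2)) measurable
      then show ?thesis using gauss_const_nonzero[where 'n='n] by (simp add: norm_mult field_simps)
    qed
    moreover have "?C \<ge> 0" using A0 B(1) I_wt_nonneg[where 'n='n] by simp
    ultimately show ?thesis by blast
  qed
  have "\<exists>C. UB m (\<lambda>x. C * decay n x) f" if m: "1 \<le> m" for m n
  proof -
    obtain M C where MC: "C > 0" "\<And>(f :: real^'n \<Rightarrow> complex) x A w. smooth f \<Longrightarrow> (\<lambda>y. f (x + y) * gauss (-1) y) \<in> rapid \<Longrightarrow>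
     (\<And>\<xi>. cmod (stft f x \<xi>) \<le> A * decay M \<xi>) \<Longrightarrow> cmod (Dw w f x) \<le> C * A * W m (length w)"
      using reconstruct[OF m, where 'n='n] by blast
    \<comment> \<open>Both rates are doubled because a + b \<le> max(2a, 2b): whichever of n
      \<omega>(x) and M \<omega>(\<xi>) is larger pays for both.\<close>
    obtain A where A: "A \<ge> 0" "\<And>x \<xi>. cmod (stft f x \<xi>) \<le> A * decay (2 * n) x" using a by blast
    obtain B where B: "B \<ge> 0" "\<And>x \<xi>. cmod (stft f x \<xi>) \<le> B * decay (2 * M) \<xi>" using b by blast
    have "cmod (stft f x \<xi>) \<le> ((A + B) * decay n x) * decay M \<xi>" for x \<xi>
    proof (cases "real M * wt \<xi> \<le> real n * wt x")
      case True
      have "cmod (stft f x \<xi>) \<le> A * decay (2 * n) x" by (rule A)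
      also have "\<dots> \<le> (A + B) * exp (- (real n * wt x) - real M * wt \<xi>)"
        using True A(1) B(1) by (intro mult_mono) auto
      finally show ?thesis by (simp add: mult.assoc exp_add[symmetric])
    next
      case False
      have "cmod (stft f x \<xi>) \<le> B * decay (2 * M) \<xi>" by (rule B)
      also have "\<dots> \<le> (A + B) * exp (- (real n * wt x) - real M * wt \<xi>)"
        using False A(1) B(1) by (intro mult_mono) auto
      finally show ?thesis by (simp add: mult.assoc exp_add[symmetric])
    qed
    then have "cmod (Dw w f x) \<le> C * ((A + B) * decay n x) * W m (length w)" for w x
      by (rule MC(2)[OF rapid_smooth[OF fD] hD])
    then have "UB m (\<lambda>x. (C * (A + B)) * decay n x) f"
      by (intro UB_I) (simp add: mult.assoc)
    then show ?thesis by blast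
  qed
  then show "f \<in> Q_set" using rapid_smooth[OF fD] by (simp add: Q_set_def)
qed

lemma S_set_eq_Q_set: "S_set \<omega> = Q_set"
  using Q_set_subset_S_set S_set_subset_Q_set by blast

end

section \<open>Topologies generated by seminorms\<close>

definition fun_space :: "('x \<Rightarrow> complex) set \<Rightarrow> bool" where
  "fun_space V \<longleftrightarrow> (\<lambda>x. 0) \<in> V \<and> (\<forall>f\<in>V. \<forall>g\<in>V. (\<lambda>x. f x + g x) \<in> V) \<and> (\<forall>c. \<forall>f\<in>V. (\<lambda>x. c * f x) \<in> V)"

text \<open>A supremum over the empty set is \<open>-\<infinity>\<close>, hence the inequality in the condition at \<open>0\<close>.\<close>
definition subadditive_family :: "('x \<Rightarrow> complex) set \<Rightarrow> (('x \<Rightarrow> complex) \<Rightarrow> ereal) set \<Rightarrow> bool" where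
  "subadditive_family V P \<longleftrightarrow> (\<forall>p\<in>P. (\<forall>f\<in>V. \<forall>g\<in>V. p (\<lambda>x. f x + g x) \<le> p f + p g) \<and>
     (\<forall>f\<in>V. p f < \<infinity>) \<and> p (\<lambda>x. 0) \<le> 0)"

lemma subadditive_familyD:
  "subadditive_family V P \<Longrightarrow> p \<in> P \<Longrightarrow> f \<in> V \<Longrightarrow> g \<in> V \<Longrightarrow> p (\<lambda>x. f x + g x) \<le> p f + p g"
  by (simp add: subadditive_family_def)

lemma fun_space_0: "fun_space V \<Longrightarrow> (\<lambda>x. 0) \<in> V"
  and fun_space_add: "fun_space V \<Longrightarrow> f \<in> V \<Longrightarrow> g \<in> V \<Longrightarrow> (\<lambda>x. f x + g x) \<in> V"
  and fun_space_cmult: "fun_space V \<Longrightarrow> f \<in> V \<Longrightarrow> (\<lambda>x. c * f x) \<in> V"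
  by (simp_all add: fun_space_def)

lemma fun_space_diff: "fun_space V \<Longrightarrow> f \<in> V \<Longrightarrow> g \<in> V \<Longrightarrow> (\<lambda>x. f x - g x) \<in> V"
proof -
  assume V: "fun_space V" and fg: "f \<in> V" "g \<in> V"
  have "(\<lambda>x. f x + (-1) * g x) \<in> V"
    by (rule fun_space_add[OF V fg(1) fun_space_cmult[OF V fg(2)]])
  then show "(\<lambda>x. f x - g x) \<in> V" by simp
qed

text \<open>The generating sets are balls of single seminorms about arbitrary centres. Subadditivity
  recentres such a ball at any of its points, so finite intersections of balls centred at f form a
  neighbourhood base at f.\<close>

lemma openin_seminorm_topology:
  assumes V: "fun_space V" and P: "subadditive_family V P"
  shows "openin (seminorm_topology V P) U \<longleftrightarrow> U \<subseteq> V \<and>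
    (\<forall>f\<in>U. \<exists>F e. finite F \<and> F \<subseteq> P \<and> 0 < e \<and> {g\<in>V. \<forall>p\<in>F. p (\<lambda>x. g x - f x) < ereal e} \<subseteq> U)"
    (is "?L \<longleftrightarrow> U \<subseteq> V \<and> (\<forall>f\<in>U. ?N f U)")
proof
  assume L: ?L
  then have "U \<subseteq> V" using openin_subset by fastforce
  moreover have "\<forall>f\<in>U. ?N f U"
    using L unfolding seminorm_topology_def openin_topology_generated_by_iff
  proof (induction rule: generate_topology_on.induct)
    case Empty
    then show ?case by simp
  next
    case (Int a b)
    show ?case
    proof
      fix f assume "f \<in> a \<inter> b"
      then have "f \<in> a" "f \<in> b" by auto
      from bspec[OF Int.IH(1) this(1)] bspec[OF Int.IH(2) this(2)]
      obtain F e F' e' where *: "finite F" "F \<subseteq> P" "0 < e" "{g\<in>V. \<forall>p\<in>F. p (\<lambda>x. g x - f x) < ereal e} \<subseteq> a"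
        "finite F'" "F' \<subseteq> P" "0 < e'" "{g\<in>V. \<forall>p\<in>F'. p (\<lambda>x. g x - f x) < ereal e'} \<subseteq> b"
        by (elim exE conjE)
      have "{g\<in>V. \<forall>p\<in>F \<union> F'. p (\<lambda>x. g x - f x) < ereal (min e e')} \<subseteq> a \<inter> b"
        using *(4,8) by (force simp: ereal_min)
      then show "?N f (a \<inter> b)" using * by (intro exI[of _ "F \<union> F'"] exI[of _ "min e e'"]) auto
    qed
  next
    case (UN K)
    then show ?case by (meson Union_iff Union_upper order_trans)
  next
    case (Basis s)
    then consider "s = V" | f p e where "s = {g \<in> V. p (\<lambda>x. g x - f x) < ereal e}" "f \<in> V" "p \<in> P" "0 < e" by auto
    then show ?case
    proof cases
      case 1
      then show ?thesis by (intro ballI exI[of _ "{}"] exI[of _ 1]) auto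
    next
      case (2 f p e)
      show ?thesis
      proof
        fix g assume "g \<in> s"
        then have g: "g \<in> V" "p (\<lambda>x. g x - f x) < ereal e" using 2 by auto
        have "\<exists>d>0. p (\<lambda>x. g x - f x) + ereal d \<le> ereal e"
        proof (cases "p (\<lambda>x. g x - f x)")
          case (real r)
          then show ?thesis using g(2) by (intro exI[of _ "e - r"]) auto
        next
          case MInf
          then show ?thesis by (intro exI[of _ 1]) auto
        qed (use g in auto)
        then obtain d where d: "d > 0" "p (\<lambda>x. g x - f x) + ereal d \<le> ereal e" by blast
        have "p (\<lambda>x. h x - f x) < ereal e" if h: "h \<in> V" "p (\<lambda>x. h x - g x) < ereal d" for h
        proof -
          have "p (\<lambda>x. (g x - f x) + (h x - g x)) \<le> p (\<lambda>x. g x - f x) + p (\<lambda>x. h x - g x)"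
            by (rule subadditive_familyD[OF P 2(3)]) (intro fun_space_diff[OF V] g h 2(2))+
          then have "p (\<lambda>x. h x - f x) \<le> p (\<lambda>x. g x - f x) + p (\<lambda>x. h x - g x)"
            by simp
          also have "\<dots> < ereal e"
          proof (cases "p (\<lambda>x. g x - f x)")
            case (real r)
            have "ereal r + p (\<lambda>x. h x - g x) < ereal r + ereal d"
              using h(2) by (cases "p (\<lambda>x. h x - g x)") auto
            then show ?thesis using d(2) real by (metis order_less_le_trans plus_ereal.simps(1))
          next
            case MInf
            then show ?thesis using h(2) by (cases "p (\<lambda>x. h x - g x)") auto
          qed (use g in auto)
          finally show ?thesis .
        qed
        then have "{h\<in>V. \<forall>p\<in>{p}. p (\<lambda>x. h x - g x) < ereal d} \<subseteq> s" using 2(1) by auto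
        then show "?N g s" using 2(3) d(1) by (intro exI[of _ "{p}"] exI[of _ d]) auto
      qed
    qed
  qed
  ultimately show "U \<subseteq> V \<and> (\<forall>f\<in>U. ?N f U)" by simp
next
  assume R: "U \<subseteq> V \<and> (\<forall>f\<in>U. ?N f U)"
  show ?L
  proof (subst openin_subopen, safe)
    fix f assume f: "f \<in> U"
    then obtain F e where *: "finite F" "F \<subseteq> P" "0 < e" "{g\<in>V. \<forall>p\<in>F. p (\<lambda>x. g x - f x) < ereal e} \<subseteq> U"
      using R by blast
    have fV: "f \<in> V" using R f by blast
    have 1: "openin (seminorm_topology V P) V"
      using openin_topspace[of "seminorm_topology V P"] by simp
    have 2: "openin (seminorm_topology V P) {g\<in>V. p (\<lambda>x. g x - f x) < ereal e}" if "p \<in> F" for p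
      unfolding seminorm_topology_def
      by (rule topology_generated_by_Basis) (use * fV that in blast)
    have "openin (seminorm_topology V P) {g\<in>V. \<forall>p\<in>F'. p (\<lambda>x. g x - f x) < ereal e}"
      if "F' \<subseteq> F" for F'
      using finite_subset[OF that *(1)] that
    proof (induction F')
      case (insert q G)
      have "{g\<in>V. \<forall>p\<in>insert q G. p (\<lambda>x. g x - f x) < ereal e} =
        {g\<in>V. q (\<lambda>x. g x - f x) < ereal e} \<inter> {g\<in>V. \<forall>p\<in>G. p (\<lambda>x. g x - f x) < ereal e}" by auto
      then show ?case using insert 2 by (simp add: openin_Int)
    qed (use 1 in simp)
    then have "openin (seminorm_topology V P) {g\<in>V. \<forall>p\<in>F. p (\<lambda>x. g x - f x) < ereal e}" by simp
    moreover have "p (\<lambda>x. f x - f x) < ereal e" if "p \<in> F" for p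
    proof -
      have "p (\<lambda>x. 0) \<le> 0" using that * P unfolding subadditive_family_def by blast
      then show ?thesis using *(3) by (simp add: order_le_less_trans)
    qed
    ultimately show "\<exists>T. openin (seminorm_topology V P) T \<and> f \<in> T \<and> T \<subseteq> U"
      using * fV by blast
  qed
qed

lemma continuous_map_seminorm_topology:
  fixes h :: "('x \<Rightarrow> complex) \<Rightarrow> 'b::metric_space"
  assumes V: "fun_space V" and P: "subadditive_family V P"
    and h: "\<And>f d. f \<in> V \<Longrightarrow> 0 < d \<Longrightarrow> \<exists>F e. finite F \<and> F \<subseteq> P \<and> 0 < e \<and>
      (\<forall>g\<in>V. (\<forall>p\<in>F. p (\<lambda>x. g x - f x) < ereal e) \<longrightarrow> dist (h g) (h f) < d)"
  shows "continuous_map (seminorm_topology V P) euclidean h"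
  unfolding continuous_map_def
proof (intro conjI allI impI)
  fix U :: "'b set" assume "openin euclidean U"
  then have U: "open U" by simp
  show "openin (seminorm_topology V P) {x \<in> topspace (seminorm_topology V P). h x \<in> U}"
    unfolding openin_seminorm_topology[OF V P] topspace_seminorm_topology
  proof (intro conjI ballI)
    fix f assume f: "f \<in> {x \<in> V. h x \<in> U}"
    then obtain d where d: "d > 0" "ball (h f) d \<subseteq> U" using U open_contains_ball by blast
    obtain F e where F: "finite F" "F \<subseteq> P" "0 < e" "\<And>g. g \<in> V \<Longrightarrow> \<forall>p\<in>F. p (\<lambda>x. g x - f x) < ereal e \<Longrightarrow> dist (h g) (h f) < d"
      using h[of f d] f d(1) by blast
    have "{g \<in> V. \<forall>p\<in>F. p (\<lambda>x. g x - f x) < ereal e} \<subseteq> {x \<in> V. h x \<in> U}"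
      using F(4) d(2) by (auto simp: dist_commute)
    then show "\<exists>F e. finite F \<and> F \<subseteq> P \<and> 0 < e \<and> {g \<in> V. \<forall>p\<in>F. p (\<lambda>x. g x - f x) < ereal e} \<subseteq> {x \<in> V. h x \<in> U}"
      using F by blast
  qed auto
qed auto

lemma continuous_map_seminorm_topology_0:
  fixes h :: "('x \<Rightarrow> complex) \<Rightarrow> 'b::real_normed_vector"
  assumes V: "fun_space V" and P: "subadditive_family V P"
    and h: "continuous_map (seminorm_topology V P) euclidean h" "h (\<lambda>x. 0) = 0"
  shows "\<exists>F e. finite F \<and> F \<subseteq> P \<and> 0 < e \<and> (\<forall>g\<in>V. (\<forall>p\<in>F. p g < ereal e) \<longrightarrow> norm (h g) < 1)"
proof -
  have "openin (seminorm_topology V P) {f \<in> V. h f \<in> ball 0 1}"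
    using openin_continuous_map_preimage[OF h(1), of "ball 0 1"] by simp
  moreover have "(\<lambda>x. 0) \<in> {f \<in> V. h f \<in> ball 0 1}" using V h(2) by (simp add: fun_space_def)
  ultimately obtain F e where F: "finite F" "F \<subseteq> P" "0 < e" "{g\<in>V. \<forall>p\<in>F. p (\<lambda>x. g x - 0) < ereal e} \<subseteq> {f \<in> V. h f \<in> ball 0 1}"
    unfolding openin_seminorm_topology[OF V P] by (elim conjE) (drule (1) bspec, elim exE conjE)
  have "\<forall>g\<in>V. (\<forall>p\<in>F. p g < ereal e) \<longrightarrow> norm (h g) < 1"
    using F(4) by (auto simp: subset_iff)
  then show ?thesis using F by blast
qed

lemma bounded_in_seminorm_topology:
  assumes V: "fun_space V" and P: "subadditive_family V P"
    and hom: "\<And>p c f. p \<in> P \<Longrightarrow> f \<in> V \<Longrightarrow> p (\<lambda>x. c * f x) = ereal (cmod c) * p f"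
  shows "bounded_in (seminorm_topology V P) B \<longleftrightarrow> B \<subseteq> V \<and> (\<forall>p\<in>P. \<exists>C. \<forall>f\<in>B. p f \<le> ereal C)"
proof
  assume L: "bounded_in (seminorm_topology V P) B"
  have "\<exists>C. \<forall>f\<in>B. p f \<le> ereal C" if p: "p \<in> P" for p
  proof -
    have 0: "(\<lambda>x. 0) \<in> V" using V by (simp add: fun_space_def)
    have "openin (seminorm_topology V P) {g\<in>V. p (\<lambda>x. g x - (\<lambda>x. 0) x) < ereal 1}"
      unfolding seminorm_topology_def
      by (rule topology_generated_by_Basis, rule insertI2, rule CollectI,
          rule exI[of _ "\<lambda>x. 0"], rule exI[of _ p], rule exI[of _ 1]) (use 0 p in simp)
    moreover have "(\<lambda>x. 0) \<in> {g\<in>V. p (\<lambda>x. g x - (\<lambda>x. 0) x) < ereal 1}"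
    proof -
      have "p (\<lambda>x. 0) \<le> 0" using P p by (simp add: subadditive_family_def)
      then have "p (\<lambda>x. 0) < ereal 1" by (rule order_le_less_trans) simp
      then show ?thesis using 0 by simp
    qed
    ultimately obtain r where r: "r > 0" "\<And>c. r \<le> cmod c \<Longrightarrow> B \<subseteq> (\<lambda>g x. c * g x) ` {g\<in>V. p (\<lambda>x. g x - (\<lambda>x. 0) x) < ereal 1}"
      using L unfolding bounded_in_def by meson
    have "p f \<le> ereal r" if "f \<in> B" for f
    proof -
      obtain g where g: "g \<in> V" "p g < ereal 1" "f = (\<lambda>x. of_real r * g x)"
        using r(2)[of "of_real r"] r(1) \<open>f \<in> B\<close> by auto
      then show ?thesis using hom[OF p g(1), of "of_real r"] r(1)
        by (cases "p g") (auto simp: mult_left_le)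
    qed
    then show ?thesis by blast
  qed
  then show "B \<subseteq> V \<and> (\<forall>p\<in>P. \<exists>C. \<forall>f\<in>B. p f \<le> ereal C)"
    using L by (auto simp: bounded_in_def)
next
  assume R: "B \<subseteq> V \<and> (\<forall>p\<in>P. \<exists>C. \<forall>f\<in>B. p f \<le> ereal C)"
  have "\<exists>r>0. \<forall>c. r \<le> cmod c \<longrightarrow> B \<subseteq> (\<lambda>g x. c * g x) ` U"
    if U: "openin (seminorm_topology V P) U" "(\<lambda>x. 0) \<in> U" for U
  proof -
    from U obtain F e where F: "finite F" "F \<subseteq> P" "0 < e" "{g\<in>V. \<forall>p\<in>F. p (\<lambda>x. g x - 0) < ereal e} \<subseteq> U"
      unfolding openin_seminorm_topology[OF V P] by (elim conjE) (drule (1) bspec, elim exE conjE)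
    have "\<exists>C>0. \<forall>p\<in>F. \<forall>f\<in>B. p f \<le> ereal C"
      using F(1,2)
    proof (induction F)
      case empty
      then show ?case by (intro exI[of _ 1]) auto
    next
      case (insert p F)
      then obtain C D where C: "C > 0" "\<forall>p\<in>F. \<forall>f\<in>B. p f \<le> ereal C" "\<forall>f\<in>B. p f \<le> ereal D" using R by force
      have "p f \<le> ereal (max C D)" if "f \<in> B" for f using C(3) that by (auto intro: order_trans)
      moreover have "q f \<le> ereal (max C D)" if "f \<in> B" "q \<in> F" for f q
        using C(2) that by (force intro: order_trans)
      ultimately show ?case using C(1) by (intro exI[of _ "max C D"]) auto
    qed
    then obtain C where C: "C > 0" "\<And>p f. p \<in> F \<Longrightarrow> f \<in> B \<Longrightarrow> p f \<le> ereal C" by blast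
    \<comment> \<open>The factor 2 makes C / \<bar>c\<bar> < e strict.\<close>
    have "B \<subseteq> (\<lambda>g x. c * g x) ` U" if c: "2 * C / e \<le> cmod c" for c
    proof
      fix f assume f: "f \<in> B"
      have c0: "cmod c > 0" using c C(1) F(3) by (smt (verit) divide_pos_pos)
      let ?g = "\<lambda>x. inverse c * f x"
      have fV: "f \<in> V" using f R by blast
      have g: "?g \<in> V" using V fV by (simp add: fun_space_def)
      have "p ?g < ereal e" if p: "p \<in> F" for p
      proof -
        have "p ?g = ereal (inverse (cmod c)) * p f" using hom[of p f "inverse c"] p F(2) fV by (auto simp: norm_inverse)
        also have "\<dots> \<le> ereal (inverse (cmod c)) * ereal C" using C(2)[OF p f] by (intro ereal_mult_left_mono) auto
        also have "\<dots> < ereal e"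
        proof -
          have "2 * C \<le> e * cmod c" using c F(3) by (simp add: pos_divide_le_eq mult.commute)
          then have "C < e * cmod c" using C(1) by linarith
          then show ?thesis using c0 by (simp add: field_simps)
        qed
        finally show ?thesis .
      qed
      then have "?g \<in> U" using F(4) g by (auto simp: subset_iff)
      moreover have "f = (\<lambda>x. c * ?g x)" using c0 by (auto simp: fun_eq_iff)
      ultimately show "f \<in> (\<lambda>g x. c * g x) ` U"
        using image_eqI[of f "\<lambda>g x. c * g x" ?g U] by simp
    qed
    then show ?thesis using C(1) F(3) by (intro exI[of _ "2 * C / e"]) auto
  qed
  then show "bounded_in (seminorm_topology V P) B" using R by (auto simp: bounded_in_def)
qed

lemma seminorm_on_add: "seminorm_on V p \<Longrightarrow> f \<in> V \<Longrightarrow> g \<in> V \<Longrightarrow> p (\<lambda>x. f x + g x) \<le> p f + p g"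
  and seminorm_on_cmult: "seminorm_on V p \<Longrightarrow> f \<in> V \<Longrightarrow> p (\<lambda>x. c * f x) = cmod c * p f"
  by (simp_all add: seminorm_on_def)

lemma seminorm_on_0: "seminorm_on V p \<Longrightarrow> fun_space V \<Longrightarrow> p (\<lambda>x. 0) = 0"
  using seminorm_on_cmult[of V p "\<lambda>x. 0" 0] fun_space_0 by auto

lemma seminorm_on_diff:
  assumes "seminorm_on V p" "fun_space V" "f \<in> V" "g \<in> V"
  shows "\<bar>p f - p g\<bar> \<le> p (\<lambda>x. f x - g x)"
proof -
  have d: "(\<lambda>x. f x - g x) \<in> V" "(\<lambda>x. g x - f x) \<in> V" using fun_space_diff assms by blast+
  have "p (\<lambda>x. (f x - g x) + g x) \<le> p (\<lambda>x. f x - g x) + p g" "p (\<lambda>x. (g x - f x) + f x) \<le> p (\<lambda>x. g x - f x) + p f"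
    using d by (intro seminorm_on_add assms(1,3,4); simp)+
  moreover have "p (\<lambda>x. -1 * (f x - g x)) = cmod (-1) * p (\<lambda>x. f x - g x)"
    by (rule seminorm_on_cmult[OF assms(1) d(1)])
  ultimately show ?thesis by simp
qed

section \<open>Continuous seminorms, bounded sets and functionals on \<open>OC_space \<omega>\<close>\<close>

context weight
begin

lemma ON_fun_space: "fun_space (ON n :: (real^'a::finite \<Rightarrow> complex) set)"
proof -
  have "UB m (\<lambda>x. 0 * growth n x) (\<lambda>x::real^'a. 0)" for m
    unfolding UB_def
  proof (intro allI)
    fix w :: "'a list" and x
    have "Dw w (\<lambda>x::real^'a. 0) = (\<lambda>x. 0)" by (induction w) (auto simp: partial_const)
    then show "cmod (Dw w (\<lambda>x::real^'a. 0) x) \<le> 0 * growth n x * W m (length w)" by simp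
  qed
  then have "(\<lambda>x::real^'a. 0) \<in> ON n" unfolding ON_def using smooth_const by blast
  then show ?thesis by (auto simp: fun_space_def ON_add ON_cmult)
qed

lemma OC_fun_space: "fun_space OC"
proof -
  have "(\<lambda>x. 0) \<in> OC" using fun_space_0[OF ON_fun_space[of 1]] by (auto simp: OC_def)
  then show ?thesis unfolding fun_space_def using OC_add OC_cmult by blast
qed

lemma r_norm_subadditive:
  "subadditive_family (ON n :: (real^'a::finite \<Rightarrow> complex) set) {r_norm \<omega> m n | m. 1 \<le> m}"
proof -
  have fin: "\<exists>a. r_norm \<omega> m n f = ereal a" if m: "1 \<le> m" and f: "f \<in> ON n" for m and f :: "real^'a \<Rightarrow> complex"
  proof -
    obtain C where "r_norm \<omega> m n f \<le> ereal C" using ON_D[OF f m] r_norm_le_iff[OF m ON_smooth[OF f]] by blast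
    then show ?thesis using r_norm_nonneg[OF m ON_smooth[OF f], of n] by (cases "r_norm \<omega> m n f") auto
  qed
  have "r_norm \<omega> m n (\<lambda>x. f x + g x) \<le> r_norm \<omega> m n f + r_norm \<omega> m n g"
    if "1 \<le> m" "f \<in> ON n" "g \<in> ON n" for m and f g :: "real^'a \<Rightarrow> complex"
  proof -
    have s: "smooth f" "smooth g" using that ON_smooth by auto
    from fin[OF that(1,2)] obtain a where a: "r_norm \<omega> m n f = ereal a" ..
    from fin[OF that(1,3)] obtain b where b: "r_norm \<omega> m n g = ereal b" ..
    note ab = a b
    then have "UB m (\<lambda>x. a * growth n x) f" "UB m (\<lambda>x. b * growth n x) g"
      using r_norm_le_iff[OF that(1)] s by (metis order_refl)+
    from UB_add[OF s this] have "r_norm \<omega> m n (\<lambda>x. f x + g x) \<le> ereal (a + b)"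
      using r_norm_le_iff[OF that(1) smooth_add[OF s]] by (simp add: distrib_right)
    then show ?thesis by (simp add: ab)
  qed
  moreover have "r_norm \<omega> m n (\<lambda>x::real^'a. 0) \<le> 0" if "1 \<le> m" for m
  proof -
    have "Dw w (\<lambda>x::real^'a. 0) = (\<lambda>x. 0)" for w by (induction w) (auto simp: partial_const)
    then have "UB m (\<lambda>x. 0 * growth n x) (\<lambda>x::real^'a. 0)" by (simp add: UB_def)
    then show ?thesis unfolding zero_ereal_def by (subst r_norm_le_iff[OF that smooth_const])
  qed
  ultimately show ?thesis using fin unfolding subadditive_family_def by fastforce
qed

lemma O_n_space_eq: "O_n_space \<omega> n = seminorm_topology (ON n) {r_norm \<omega> m n | m. 1 \<le> m}"
  unfolding O_n_space_def ON_eq ..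

text \<open>Domination by a multiple of one norm of the step. Quantifying over all bounds A in place
  of the norm itself keeps the statement within the reals.\<close>

definition ON_bound :: "nat \<Rightarrow> ((real^'n::finite \<Rightarrow> complex) \<Rightarrow> real) \<Rightarrow> bool" where
  "ON_bound n p \<longleftrightarrow> (\<exists>m\<ge>1. \<exists>C\<ge>0. \<forall>f\<in>ON n. \<forall>A. UB m (\<lambda>x. A * growth n x) f \<longrightarrow> p f \<le> C * A)"

lemma ON_boundI_open:
  fixes p :: "(real^'n::finite \<Rightarrow> complex) \<Rightarrow> real"
  assumes hom: "\<And>c f. f \<in> ON n \<Longrightarrow> p (\<lambda>x. c * f x) = cmod c * p f"
    and m: "1 \<le> m" and e: "0 < e"
    and *: "\<And>f A. f \<in> ON n \<Longrightarrow> A < e \<Longrightarrow> UB m (\<lambda>x. A * growth n x) f \<Longrightarrow> p f \<le> 1"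
  shows "ON_bound n p"
proof -
  have "p f \<le> (2 / e) * A" if f: "f \<in> ON n" and A: "UB m (\<lambda>x. A * growth n x) f" for f A
  proof (rule field_le_epsilon)
    fix d :: real assume d: "d > 0"
    have A0: "0 \<le> A" by (rule UB_const_nonneg[OF m A])
    \<comment> \<open>The slack d keeps the denominator positive when A = 0; it reappears as the
      error in p f \<le> 1 / c = 2 A / e + d.\<close>
    define c where "c = e / (2 * A + d * e)"
    have c: "c > 0" unfolding c_def using A0 d e by (intro divide_pos_pos add_nonneg_pos) auto
    have "UB m (\<lambda>x. cmod (of_real c) * (A * growth n x)) (\<lambda>x. of_real c * f x)"
      by (rule UB_cmult[OF ON_smooth[OF f] A])
    then have "UB m (\<lambda>x. (c * A) * growth n x) (\<lambda>x. of_real c * f x)" using c by (simp add: mult.assoc)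
    moreover have "c * A < e"
    proof -
      have "c * (2 * A + d * e) = e" using A0 d e unfolding c_def by (simp add: add_nonneg_pos less_imp_neq[symmetric])
      moreover have "0 \<le> c * A" "0 < c * (d * e)" using c A0 d e by auto
      ultimately show ?thesis by (simp add: distrib_left)
    qed
    ultimately have "p (\<lambda>x. of_real c * f x) \<le> 1" using ON_cmult[OF f] by (intro *) auto
    then have "c * p f \<le> 1" using hom[OF f, of "of_real c"] c by simp
    then have "p f \<le> 1 / c" using c by (simp add: pos_le_divide_eq mult.commute)
    then show "p f \<le> 2 / e * A + d" using e by (simp add: c_def field_simps)
  qed
  then show ?thesis unfolding ON_bound_def using m e by (intro exI[of _ m] conjI exI[of _ "2 / e"]) auto
qed

lemma continuous_map_O_n_iff:
  fixes p :: "(real^'n::finite \<Rightarrow> complex) \<Rightarrow> real"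
  assumes p: "seminorm_on (ON n) p"
  shows "continuous_map (O_n_space \<omega> n) euclideanreal p \<longleftrightarrow> ON_bound n p"
proof
  assume "continuous_map (O_n_space \<omega> n) euclideanreal p"
  from continuous_map_seminorm_topology_0[OF ON_fun_space r_norm_subadditive this[unfolded O_n_space_eq] seminorm_on_0[OF p ON_fun_space]]
  obtain F e where F: "finite F" "F \<subseteq> {r_norm \<omega> m n | m. 1 \<le> m}" "0 < e"
    "\<And>g. g \<in> ON n \<Longrightarrow> \<forall>q\<in>F. q g < ereal e \<Longrightarrow> norm (p g) < 1" by blast
  \<comment> \<open>Since \<open>W m k\<close> decreases in m, the norm with the largest index
    dominates the finitely many others.\<close>
  have "\<exists>M\<ge>1. \<forall>q\<in>F. \<exists>m. 1 \<le> m \<and> m \<le> M \<and> q = r_norm \<omega> m n"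
    using F(1,2)
  proof (induction F)
    case (insert q F)
    then obtain M m where "M \<ge> 1" "\<forall>q\<in>F. \<exists>m. 1 \<le> m \<and> m \<le> M \<and> q = r_norm \<omega> m n" "1 \<le> m" "q = r_norm \<omega> m n" by auto
    then show ?case by (intro exI[of _ "max M m"]) (auto simp: le_max_iff_disj)
  qed auto
  then obtain M where M: "M \<ge> 1" "\<forall>q\<in>F. \<exists>m. 1 \<le> m \<and> m \<le> M \<and> q = r_norm \<omega> m n" by blast
  show "ON_bound n p"
  proof (rule ON_boundI_open[OF _ M(1) F(3)])
    fix f :: "real^'n \<Rightarrow> complex" and A assume f: "f \<in> ON n" and A: "A < e" "UB M (\<lambda>x. A * growth n x) f"
    have "q f < ereal e" if "q \<in> F" for q
    proof -
      from bspec[OF M(2) that] obtain m where m: "1 \<le> m" "m \<le> M" "q = r_norm \<omega> m n" by (elim exE conjE)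
      have "UB m (\<lambda>x. A * growth n x) f" by (rule UB_mono[OF m(1,2) A(2)]) simp
      then have "q f \<le> ereal A" using r_norm_le_iff[OF m(1) ON_smooth[OF f]] m(3) by blast
      then show ?thesis using A(1) by (metis ereal_less_eq(3) less_ereal.simps(1) order_le_less_trans)
    qed
    then show "p f \<le> 1" using F(4)[OF f] by auto
  qed (use p in \<open>auto simp: seminorm_on_def\<close>)
next
  assume "ON_bound n p"
  then obtain m C where mC: "m \<ge> 1" "C \<ge> 0" "\<And>f A. f \<in> ON n \<Longrightarrow> UB m (\<lambda>x. A * growth n x) f \<Longrightarrow> p f \<le> C * A"
    unfolding ON_bound_def by blast
  show "continuous_map (O_n_space \<omega> n) euclideanreal p"
    unfolding O_n_space_eq
  proof (rule continuous_map_seminorm_topology[OF ON_fun_space r_norm_subadditive])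
    fix f :: "real^'n \<Rightarrow> complex" and d :: real assume f: "f \<in> ON n" and d: "0 < d"
    have "dist (p g) (p f) < d" if g: "g \<in> ON n" and r: "r_norm \<omega> m n (\<lambda>x. g x - f x) < ereal (d / (C + 1))" for g
    proof -
      have gf: "(\<lambda>x. g x - f x) \<in> ON n" by (rule fun_space_diff[OF ON_fun_space g f])
      have "UB m (\<lambda>x. d / (C + 1) * growth n x) (\<lambda>x. g x - f x)"
        using r r_norm_le_iff[OF mC(1) ON_smooth[OF gf]] less_imp_le by blast
      then have "p (\<lambda>x. g x - f x) \<le> C * (d / (C + 1))" by (rule mC(3)[OF gf])
      also have "\<dots> < d" using mC(2) d by (simp add: field_simps)
      finally show ?thesis using seminorm_on_diff[OF p ON_fun_space g f] by (simp add: dist_real_def)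
    qed
    then show "\<exists>F e. finite F \<and> F \<subseteq> {r_norm \<omega> m n | m. 1 \<le> m} \<and> 0 < e \<and>
      (\<forall>g\<in>ON n. (\<forall>p\<in>F. p (\<lambda>x. g x - f x) < ereal e) \<longrightarrow> dist (p g) (p f) < d)"
      using mC(1,2) d by (intro exI[of _ "{r_norm \<omega> m n}"] exI[of _ "d / (C + 1)"]) auto
  qed
qed

definition OC_seminorm :: "((real^'n::finite \<Rightarrow> complex) \<Rightarrow> real) \<Rightarrow> bool" where
  "OC_seminorm p \<longleftrightarrow> seminorm_on OC p \<and> (\<forall>n\<ge>1. ON_bound n p)"

lemma seminorm_on_subset: "seminorm_on V p \<Longrightarrow> U \<subseteq> V \<Longrightarrow> seminorm_on U p"
  by (auto simp: seminorm_on_def subset_iff)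

lemma OC_space_eq: "(OC_space \<omega> :: (real^'n::finite \<Rightarrow> complex) topology) = seminorm_topology OC {(\<lambda>f. ereal (p f)) | p. OC_seminorm p}"
proof -
  have top: "(\<Union>i\<in>{1..}. topspace (O_n_space \<omega> i)) = (OC :: (real^'n::finite \<Rightarrow> complex) set)"
    by (simp add: O_n_space_eq OC_def)
  have "seminorm_on OC p \<and> (\<forall>i\<in>{1..}. continuous_map (O_n_space \<omega> i) euclideanreal p) \<longleftrightarrow> OC_seminorm p"
    for p :: "(real^'n \<Rightarrow> complex) \<Rightarrow> real"
  proof -
    have "continuous_map (O_n_space \<omega> i) euclideanreal p \<longleftrightarrow> ON_bound i p" if "seminorm_on OC p" "i \<ge> 1" for i
    proof -
      have "ON i \<subseteq> (OC :: (real^'n \<Rightarrow> complex) set)" using that(2) by (auto simp: OC_def)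
      then show ?thesis by (rule continuous_map_O_n_iff[OF seminorm_on_subset[OF that(1)]])
    qed
    then show ?thesis by (auto simp: OC_seminorm_def)
  qed
  then show ?thesis unfolding OC_space_def lc_inductive_limit_def Let_def top by (simp only:)
qed

lemma topspace_OC_space [simp]: "topspace (OC_space \<omega>) = OC"
  by (simp add: OC_space_eq)

lemma OC_seminorm_subadditive:
  "subadditive_family (OC :: (real^'a::finite \<Rightarrow> complex) set) {(\<lambda>f. ereal (p f)) | p. OC_seminorm p}"
proof -
  have "p (\<lambda>x. 0) = 0 \<and> seminorm_on OC p" if "OC_seminorm p" for p :: "(real^'a::finite \<Rightarrow> complex) \<Rightarrow> real"
    using that seminorm_on_0[OF _ OC_fun_space] by (auto simp: OC_seminorm_def)
  then show ?thesis unfolding subadditive_family_def seminorm_on_def by fastforce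
qed

lemma bounded_in_OC_iff: "bounded_in (OC_space \<omega>) B \<longleftrightarrow> B \<subseteq> OC \<and> (\<forall>p. OC_seminorm p \<longrightarrow> (\<exists>C. \<forall>f\<in>B. p f \<le> C))"
proof -
  have "bounded_in (OC_space \<omega>) B \<longleftrightarrow> B \<subseteq> OC \<and> (\<forall>p\<in>{(\<lambda>f. ereal (p f)) | p. OC_seminorm p}. \<exists>C. \<forall>f\<in>B. p f \<le> ereal C)"
    unfolding OC_space_eq
    by (rule bounded_in_seminorm_topology[OF OC_fun_space OC_seminorm_subadditive])
      (auto simp: OC_seminorm_def seminorm_on_def)
  also have "\<dots> \<longleftrightarrow> B \<subseteq> OC \<and> (\<forall>p. OC_seminorm p \<longrightarrow> (\<exists>C. \<forall>f\<in>B. p f \<le> C))"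
    by (simp add: Ball_def ex_simps(1)[symmetric] imp_ex del: ex_simps)
  finally show ?thesis .
qed

text \<open>Continuity on the limit is continuity on each step. In one direction, the finitely many
  seminorms that control T are dominated on a given step by one norm; in the other, \<bar>T\<bar> is
  itself one of the generating seminorms.\<close>

lemma dual_OC_iff:
  fixes T :: "(real^'n::finite \<Rightarrow> complex) \<Rightarrow> complex"
  shows "T \<in> dual_space (OC_space \<omega>) \<longleftrightarrow>
    (\<forall>f\<in>OC. \<forall>g\<in>OC. T (\<lambda>x. f x + g x) = T f + T g) \<and> (\<forall>c. \<forall>f\<in>OC. T (\<lambda>x. c * f x) = c * T f) \<and>
    (\<forall>f. f \<notin> OC \<longrightarrow> T f = 0) \<and> (\<forall>n\<ge>1. ON_bound n (\<lambda>f. cmod (T f)))" (is "_ \<longleftrightarrow> ?R")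
proof
  assume T: "T \<in> dual_space (OC_space \<omega>)"
  have lin: "T (\<lambda>x. c * f x) = c * T f" if "f \<in> OC" for c f using T that by (simp add: dual_space_def)
  have T0: "T (\<lambda>x. 0) = 0" using lin[OF fun_space_0[OF OC_fun_space], of 0] by simp
  have "continuous_map (OC_space \<omega>) euclidean T" using T by (simp add: dual_space_def)
  from continuous_map_seminorm_topology_0[OF OC_fun_space OC_seminorm_subadditive this[unfolded OC_space_eq] T0]
  obtain F e where F: "finite F" "F \<subseteq> {(\<lambda>f. ereal (p f)) | p. OC_seminorm p}" "0 < e"
    "\<And>g. g \<in> OC \<Longrightarrow> \<forall>q\<in>F. q g < ereal e \<Longrightarrow> norm (T g) < 1" by blast
  have "ON_bound n (\<lambda>f. cmod (T f))" if n: "n \<ge> 1" for n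
  proof -
    have "\<exists>M\<ge>1. \<exists>C>0. \<forall>q\<in>F. \<forall>f\<in>ON n. \<forall>A. UB M (\<lambda>x. A * growth n x) f \<longrightarrow> q f \<le> ereal (C * A)"
      using F(1,2)
    proof (induction F)
      case empty
      then show ?case by (intro exI[of _ 1]) (auto intro: exI[of _ 1])
    next
      case (insert q F)
      then have "F \<subseteq> {(\<lambda>f. ereal (p f)) | p. OC_seminorm p}" by simp
      from insert.IH[OF this] obtain M C where MC0: "M \<ge> 1" "C > 0"
        "\<forall>q\<in>F. \<forall>f\<in>ON n. \<forall>A. UB M (\<lambda>x. A * growth n x) f \<longrightarrow> q f \<le> ereal (C * A)"
        by (elim exE conjE)
      note MC = MC0(1,2) MC0(3)[rule_format]
      obtain p where p: "q = (\<lambda>f. ereal (p f))" "OC_seminorm p" using insert by auto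
      then obtain m D where D: "m \<ge> 1" "D \<ge> 0" "\<And>f A. f \<in> ON n \<Longrightarrow> UB m (\<lambda>x. A * growth n x) f \<Longrightarrow> p f \<le> D * A"
        using n unfolding OC_seminorm_def ON_bound_def by blast
      have "q' f \<le> ereal ((C + D) * A)" if q': "q' \<in> insert q F" and f: "f \<in> ON n" and A: "UB (max M m) (\<lambda>x. A * growth n x) f" for q' f A
      proof -
        have A0: "0 \<le> A" by (rule UB_const_nonneg[OF _ A]) (use MC in auto)
        have "UB M (\<lambda>x. A * growth n x) f" "UB m (\<lambda>x. A * growth n x) f"
          by (rule UB_mono[OF _ _ A]; use MC D in simp)+
        then have "q' f \<le> ereal (C * A) \<or> q' f \<le> ereal (D * A)" using MC(3) D(3) f q' p(1) by fastforce
        moreover have "C * A \<le> (C + D) * A" "D * A \<le> (C + D) * A" using A0 MC(2) D(2) by (auto intro: mult_right_mono)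
        ultimately show ?thesis by (meson ereal_less_eq(3) order_trans)
      qed
      then show ?case using MC D by (intro exI[of _ "max M m"] conjI exI[of _ "C + D"]) auto
    qed
    then obtain M C where MC0: "M \<ge> 1" "C > 0"
      "\<forall>q\<in>F. \<forall>f\<in>ON n. \<forall>A. UB M (\<lambda>x. A * growth n x) f \<longrightarrow> q f \<le> ereal (C * A)"
      by (elim exE conjE)
    note MC = MC0(1,2) MC0(3)[rule_format]
    have sub: "f \<in> OC" if "f \<in> ON n" for f :: "real^'n \<Rightarrow> complex" using that n by (auto simp: OC_def)
    show ?thesis
    proof (rule ON_boundI_open[OF _ MC(1)])
      show "0 < e / C" using F(3) MC(2) by simp
      fix f :: "real^'n \<Rightarrow> complex" and A assume f: "f \<in> ON n" and A: "A < e / C" "UB M (\<lambda>x. A * growth n x) f"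
      have "C * A < e" using A(1) MC(2) by (simp add: field_simps)
      then have "\<forall>q\<in>F. q f < ereal e" using MC(3)[OF _ f A(2)] by (meson less_ereal.simps(1) order_le_less_trans)
      then show "cmod (T f) \<le> 1" using F(4)[OF sub[OF f]] by auto
    qed (use lin sub in \<open>auto simp: norm_mult\<close>)
  qed
  then show ?R using T by (auto simp: dual_space_def)
next
  assume R: ?R
  have "seminorm_on OC (\<lambda>f. cmod (T f))" using R by (auto simp: seminorm_on_def norm_mult norm_triangle_ineq)
  then have p: "OC_seminorm (\<lambda>f. cmod (T f))" using R by (simp add: OC_seminorm_def)
  have diff: "T (\<lambda>x. g x - f x) = T g - T f" if "f \<in> OC" "g \<in> OC" for f g
  proof -
    have a: "\<forall>f\<in>OC. \<forall>g\<in>OC. T (\<lambda>x. f x + g x) = T f + T g" and c: "\<forall>c. \<forall>f\<in>OC. T (\<lambda>x. c * f x) = c * T f"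
      using R by auto
    show ?thesis
      using bspec[OF bspec[OF a that(2)] OC_cmult[OF that(1), of "-1"]] bspec[OF spec[OF c, of "-1"] that(1)] by simp
  qed
  have "continuous_map (OC_space \<omega>) euclidean T"
    unfolding OC_space_eq
  proof (rule continuous_map_seminorm_topology[OF OC_fun_space OC_seminorm_subadditive])
    fix f :: "real^'n \<Rightarrow> complex" and d :: real assume "f \<in> OC" "0 < d"
    then show "\<exists>F e. finite F \<and> F \<subseteq> {(\<lambda>f. ereal (p f)) | p. OC_seminorm p} \<and> 0 < e \<and>
      (\<forall>g\<in>OC. (\<forall>p\<in>F. p (\<lambda>x. g x - f x) < ereal e) \<longrightarrow> dist (T g) (T f) < d)"
      using p diff by (intro exI[of _ "{\<lambda>f. ereal (cmod (T f))}"] exI[of _ d]) (auto simp: dist_norm)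
  qed
  then show "T \<in> dual_space (OC_space \<omega>)" using R by (simp add: dual_space_def)
qed

section \<open>Bounded subsets of \<open>OC_space \<omega>\<close>\<close>

definition ON_bdd :: "nat \<Rightarrow> (real^'n::finite \<Rightarrow> complex) set \<Rightarrow> bool" where
  "ON_bdd n B \<longleftrightarrow> B \<subseteq> ON n \<and> (\<forall>m\<ge>1. \<exists>C. \<forall>f\<in>B. UB m (\<lambda>x. C * growth n x) f)"

lemma ON_bdd_bounded:
  fixes B :: "(real^'n::finite \<Rightarrow> complex) set"
  assumes "1 \<le> n" "ON_bdd n B"
  shows "bounded_in (OC_space \<omega>) B"
  unfolding bounded_in_OC_iff
proof (intro conjI allI impI)
  show "B \<subseteq> OC" using assms by (auto simp: ON_bdd_def OC_def)
  fix p :: "(real^'n \<Rightarrow> complex) \<Rightarrow> real" assume "OC_seminorm p"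
  then obtain m C where mC: "m \<ge> 1" "\<And>f A. f \<in> ON n \<Longrightarrow> UB m (\<lambda>x. A * growth n x) f \<Longrightarrow> p f \<le> C * A"
    using assms(1) unfolding OC_seminorm_def ON_bound_def by blast
  obtain A where "\<And>f. f \<in> B \<Longrightarrow> UB m (\<lambda>x. A * growth n x) f" "B \<subseteq> ON n"
    using assms(2) mC(1) unfolding ON_bdd_def by blast
  then show "\<exists>C. \<forall>f\<in>B. p f \<le> C" using mC(2) by blast
qed

text \<open>A uniform boundedness principle built into the topology: a supremum of seminorms with a
  common bound on every step is finite on \<open>OC\<close> and continuous on every step, hence one
  of the generating seminorms, hence bounded on B. Regularity of the limit rests on suitable choices
  of the family q.\<close>

lemma bounded_in_OC_SUP:
  fixes q :: "'i \<Rightarrow> (real^'n::finite \<Rightarrow> complex) \<Rightarrow> real"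
  assumes B: "bounded_in (OC_space \<omega>) B" and I: "I \<noteq> {}"
    and q: "\<And>i. i \<in> I \<Longrightarrow> seminorm_on OC (q i)"
    and bd: "\<And>n. 1 \<le> n \<Longrightarrow> \<exists>m\<ge>1. \<exists>C\<ge>0. \<forall>f\<in>ON n. \<forall>A. UB m (\<lambda>x. A * growth n x) f \<longrightarrow> (\<forall>i\<in>I. q i f \<le> C * A)"
  shows "\<exists>C. \<forall>f\<in>B. \<forall>i\<in>I. q i f \<le> C"
proof -
  define p where "p f = (SUP i\<in>I. q i f)" for f
  have bdd: "bdd_above ((\<lambda>i. q i f) ` I)" if f: "f \<in> OC" for f
  proof -
    obtain n where n: "1 \<le> n" "f \<in> ON n" using f by (auto simp: OC_def)
    obtain m C where mC: "m \<ge> 1" "\<And>A i. UB m (\<lambda>x. A * growth n x) f \<Longrightarrow> i \<in> I \<Longrightarrow> q i f \<le> C * A"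
      using bd[OF n(1)] n(2) by blast
    obtain A where "UB m (\<lambda>x. A * growth n x) f" using ON_D[OF n(2) mC(1)] by blast
    then show ?thesis using mC(2) by (intro bdd_aboveI2) blast
  qed
  have up: "q i f \<le> p f" if "i \<in> I" "f \<in> OC" for i f
    unfolding p_def by (rule cSUP_upper[OF that(1) bdd[OF that(2)]])
  have least: "p f \<le> c" if "\<And>i. i \<in> I \<Longrightarrow> q i f \<le> c" for f c
    unfolding p_def by (rule cSUP_least[OF I that])
  have "seminorm_on OC p"
    unfolding seminorm_on_def
  proof (intro conjI ballI allI)
    fix f g :: "real^'n \<Rightarrow> complex" assume fg: "f \<in> OC" "g \<in> OC"
    show "p (\<lambda>x. f x + g x) \<le> p f + p g"
      by (rule least, rule order_trans[OF seminorm_on_add[OF q fg] add_mono[OF up up]]) (use fg in auto)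
  next
    fix c and f :: "real^'n \<Rightarrow> complex" assume f: "f \<in> OC"
    have cf: "(\<lambda>x. c * f x) \<in> OC" by (rule OC_cmult[OF f])
    show "p (\<lambda>x. c * f x) = cmod c * p f"
    proof (rule antisym)
      show "p (\<lambda>x. c * f x) \<le> cmod c * p f"
        by (rule least) (simp add: seminorm_on_cmult[OF q f] mult_left_mono up f)
      show "cmod c * p f \<le> p (\<lambda>x. c * f x)"
      proof (cases "c = 0")
        case True
        obtain i where i: "i \<in> I" using I by blast
        show ?thesis using up[OF i cf] seminorm_on_cmult[OF q[OF i] f, of c] True by simp
      next
        case False
        have "p f \<le> p (\<lambda>x. c * f x) / cmod c"
          using up[OF _ cf] seminorm_on_cmult[OF q f, of _ c] False by (intro least) (simp add: field_simps)
        then show ?thesis using False by (simp add: field_simps)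
      qed
    qed
  qed
  moreover have "ON_bound n p" if n: "1 \<le> n" for n
  proof -
    obtain m C where "m \<ge> 1" "C \<ge> 0" "\<And>f A i. f \<in> ON n \<Longrightarrow> UB m (\<lambda>x. A * growth n x) f \<Longrightarrow> i \<in> I \<Longrightarrow> q i f \<le> C * A"
      using bd[OF n] by blast
    then show ?thesis unfolding ON_bound_def using least by blast
  qed
  ultimately obtain C where "\<And>f. f \<in> B \<Longrightarrow> p f \<le> C"
    using B unfolding bounded_in_OC_iff OC_seminorm_def by blast
  moreover have "B \<subseteq> OC" using B by (simp add: bounded_in_OC_iff)
  ultimately show ?thesis using up by (meson order_trans subsetD)
qed

section \<open>The short-time Fourier transform on \<open>OC\<close>\<close>

lemma stft_rapid:
  fixes f :: "real^'n::finite \<Rightarrow> complex"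
  assumes "f \<in> OC" shows "(\<lambda>y. f (x + y) * gauss (-1) y) \<in> rapid"
proof -
  obtain n where n: "f \<in> ON n" using assms by (auto simp: OC_def)
  have "(\<lambda>y. gauss (-1) y * f (x + y)) \<in> Q_set" by (rule Q_set_mult_ON[OF gauss_Q_set ON_translate[OF n]])
  then show ?thesis using Q_set_subset_rapid by (auto simp: mult.commute)
qed

lemma stft_add: "f \<in> OC \<Longrightarrow> g \<in> OC \<Longrightarrow> stft (\<lambda>x. f x + g x) x \<xi> = stft f x \<xi> + stft g x \<xi>"
  unfolding stft_def fourier_def
  by (simp only: distrib_left distrib_right,
      intro Bochner_Integration.integral_add integrable_cis_mult rapid_integrable stft_rapid)

lemma stft_cmult: "stft (\<lambda>x. c * f x) x \<xi> = c * stft f x \<xi>"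
  unfolding stft_def fourier_def
  by (subst integral_mult_right_zero[symmetric]) (simp add: mult_ac)

lemma stft_seminorm: "0 \<le> c \<Longrightarrow> seminorm_on OC (\<lambda>f. c * cmod (stft f x \<xi>))"
  unfolding seminorm_on_def
  by (auto simp: stft_add stft_cmult norm_mult distrib_left[symmetric] norm_triangle_ineq mult_left_mono)

text \<open>The window decays at the rate n K + 1, which pays for the growth of f (x + y) in y and
  leaves the factor exp(-\<omega>) that \<open>fourier_decay\<close> asks for. The growth in x
  remains.\<close>

lemma stft_bound:
  assumes "1 \<le> M"
  shows "\<exists>m\<ge>1. \<exists>C\<ge>0. \<forall>(f :: real^'n::finite \<Rightarrow> complex)\<in>ON n. \<forall>A. UB m (\<lambda>x. A * growth n x) f \<longrightarrow>
    (\<forall>x \<xi>. cmod (stft f x \<xi>) \<le> C * A * growth (n * K) x * decay M \<xi>)"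
proof -
  let ?g = "gauss (-1) :: real^'n \<Rightarrow> complex"
  obtain L C where LC: "L \<ge> 1" "C > 0" "\<And>(h :: real^'n \<Rightarrow> complex) A \<xi>. h \<in> rapid \<Longrightarrow> UB L (\<lambda>x. A * exp (- wt x)) h \<Longrightarrow>
     cmod (fourier h \<xi>) \<le> C * A * decay M \<xi>"
    using fourier_decay[OF assms, where 'n='n] by blast
  obtain m D where mD: "m \<ge> L" "D > 0" "\<And>(f :: real^'n \<Rightarrow> complex) g u v. smooth f \<Longrightarrow> smooth g \<Longrightarrow> UB m u f \<Longrightarrow> UB m v g \<Longrightarrow>
     UB L (\<lambda>x. D * (u x * v x)) (\<lambda>x. f x * g x)"
    using UB_mult[OF LC(1), where 'n='n] by blast
  have m: "1 \<le> m" using LC mD by simp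
  obtain E where E: "UB m (\<lambda>x. E * decay (n * K + 1) x) ?g" using Q_set_D[OF gauss_Q_set m] by blast
  have E0: "0 \<le> E" by (rule UB_const_nonneg[OF m E])
  have "cmod (stft f x \<xi>) \<le> (C * (D * exp (real (n * K)) * E)) * A * growth (n * K) x * decay M \<xi>"
    if f: "f \<in> ON n" and A: "UB m (\<lambda>x. A * growth n x) f" for f :: "real^'n \<Rightarrow> complex" and A x \<xi>
  proof -
    have U: "UB L (\<lambda>y. D * ((A * exp (real (n * K)) * growth (n * K) x * growth (n * K) y) *
        (E * decay (n * K + 1) y))) (\<lambda>y. f (x + y) * ?g y)"
      by (rule mD(3)[OF smooth_translate[OF ON_smooth[OF f]] smooth_gauss UB_translate_exp[OF m A] E])
    have e: "growth (n * K) y * decay (n * K + 1) y = exp (- wt y)" for y :: "real^'n"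
      by (simp add: exp_add[symmetric] algebra_simps)
    have Eq: "D * ((A * exp (real (n * K)) * growth (n * K) x * growth (n * K) y) *
        (E * decay (n * K + 1) y)) = (D * A * exp (real (n * K)) * E * growth (n * K) x) * exp (- wt y)"
        for y :: "real^'n"
    proof -
      have "D * ((A * exp (real (n * K)) * growth (n * K) x * growth (n * K) y) * (E * decay (n * K + 1) y)) =
        (D * A * exp (real (n * K)) * E * growth (n * K) x) * (growth (n * K) y * decay (n * K + 1) y)"
        by (simp only: mult_ac)
      then show ?thesis by (simp only: e)
    qed
    have u: "UB L (\<lambda>y. (D * A * exp (real (n * K)) * E * growth (n * K) x) * exp (- wt y)) (\<lambda>y. f (x + y) * ?g y)"
      using U unfolding Eq .
    \<comment> \<open>The step n + 1 is used because \<open>OC\<close> starts at index 1, whereas n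
      may be 0.\<close>
    have "(\<lambda>y. f (x + y) * ?g y) \<in> rapid"
      by (rule stft_rapid) (use f ON_mono[of n "n + 1"] in \<open>auto simp: OC_def intro!: bexI[of _ "n + 1"]\<close>)
    from LC(3)[OF this u] show ?thesis by (simp add: stft_def mult_ac)
  qed
  moreover have "0 \<le> C * (D * exp (real (n * K)) * E)" using LC mD E0 by simp
  ultimately show ?thesis using m by (intro exI[of _ m] conjI exI[of _ "C * (D * exp (real (n * K)) * E)"]) auto
qed

text \<open>First \<open>|f| \<le> C e\<^bsup>n\<omega>\<^esup>\<close> on \<open>B\<close> for a single \<open>n\<close>, by testing with
  a rapidly decreasing sequence of point masses. Where \<open>\<omega>(\<xi>) \<ge> \<omega>(x) / M\<close>, the short-time Fourier transform
  decays in \<open>\<xi>\<close> at any rate, because the supremum over this region is a continuous seminorm; elsewhere the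
  decay is paid for by one factor \<open>e\<^bsup>\<omega>(x)\<^esup>\<close>. So the same \<open>n\<close> works for all \<open>m\<close>.\<close>
lemma bounded_in_OC_regular:
  fixes B :: "(real^'n::finite \<Rightarrow> complex) set"
  assumes B: "bounded_in (OC_space \<omega>) B"
  shows "\<exists>n\<ge>1. ON_bdd n B"
proof -
  let ?g = "gauss (-1) :: real^'n \<Rightarrow> complex" and ?I = "I_wt TYPE('n)"
  have BO: "B \<subseteq> OC" using B by (simp add: bounded_in_OC_iff)
  have "\<exists>n\<ge>1. \<exists>C. \<forall>f\<in>B. \<forall>x. cmod (f x) \<le> C * growth n x"
  proof (rule ccontr)
    assume "\<not> ?thesis"
    then have "\<forall>n\<ge>1. \<exists>f\<in>B. \<exists>x. real n * growth n x < cmod (f x)" by (meson not_le)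
    then obtain f x where fx: "\<And>n::nat. n \<ge> 1 \<Longrightarrow> f n \<in> B \<and> real n * growth n (x n) < cmod (f n (x n))" by metis
    define q where "q n h = decay n (x n) * cmod (h (x n))" for n :: nat and h
    have "\<exists>C. \<forall>h\<in>B. \<forall>n\<in>{1..}. q n h \<le> C"
    proof (rule bounded_in_OC_SUP[OF B])
      show "seminorm_on OC (q n)" for n
        by (auto simp: seminorm_on_def q_def norm_mult distrib_left[symmetric] norm_triangle_ineq mult_left_mono)
      fix n0 :: nat assume "1 \<le> n0"
      \<comment> \<open>For n > n0 the decay of the n-th point mass beats growth n0; the sum covers
        the finitely many remaining indices.\<close>
      define E where "E = 1 + (\<Sum>n\<le>n0. growth n0 (x n))"
      have E: "growth n0 (x n) * decay n (x n) \<le> E" for n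
      proof (cases "n \<le> n0")
        case True
        have "growth n0 (x n) \<le> (\<Sum>n\<le>n0. growth n0 (x n))"
          using True by (intro member_le_sum[of n "{..n0}" "\<lambda>n. growth n0 (x n)"]) auto
        moreover have "growth n0 (x n) * decay n (x n) \<le> growth n0 (x n) * 1"
          using wt_nonneg[of "x n"] by (intro mult_left_mono) auto
        ultimately show ?thesis unfolding E_def by linarith
      next
        case False
        then have "growth n0 (x n) * decay n (x n) \<le> 1"
          using wt_nonneg[of "x n"] by (simp add: exp_add[symmetric] mult_right_mono)
        also have "\<dots> \<le> E" by (simp add: E_def sum_nonneg)
        finally show ?thesis .
      qed
      have "q n h \<le> (E * W 1 0) * A" if A: "UB 1 (\<lambda>x. A * growth n0 x) h" for n h A
      proof -
        have A0: "0 \<le> A" by (rule UB_const_nonneg[OF _ A]) simp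
        have "q n h \<le> decay n (x n) * (A * growth n0 (x n) * W 1 0)"
          unfolding q_def using UB_D[OF A, of "[]" "x n"] by (intro mult_left_mono) auto
        also have "\<dots> = (growth n0 (x n) * decay n (x n)) * (A * W 1 0)" by simp
        also have "\<dots> \<le> E * (A * W 1 0)"
          using A0 W_pos[of 1 0] by (intro mult_right_mono E) auto
        finally show ?thesis by (simp add: mult_ac)
      qed
      moreover have "0 \<le> E * W 1 0" using W_pos[of 1 0] by (simp add: E_def sum_nonneg)
      ultimately show "\<exists>m\<ge>1. \<exists>C\<ge>0. \<forall>f\<in>ON n0. \<forall>A. UB m (\<lambda>x. A * growth n0 x) f \<longrightarrow> (\<forall>i\<in>{1..}. q i f \<le> C * A)"
        by (intro exI[of _ 1] conjI exI[of _ "E * W 1 0"]) auto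
    qed auto
    then obtain C where C: "\<And>h n. h \<in> B \<Longrightarrow> n \<ge> 1 \<Longrightarrow> q n h \<le> C" by auto
    obtain n :: nat where n: "C < real n" "n \<ge> 1" using reals_Archimedean2[of "max C 1"] by force
    have "real n * growth n (x n) * decay n (x n) \<le> cmod (f n (x n)) * decay n (x n)"
      using fx[OF n(2)] by (intro mult_right_mono) auto
    then have "real n * (growth n (x n) * decay n (x n)) \<le> cmod (f n (x n)) * decay n (x n)"
      by (simp only: mult.assoc)
    then have "real n \<le> q n (f n)" by (simp only: q_def exp_minus_inverse mult_1_right mult.commute)
    then show False using C[of "f n" n] fx[OF n(2)] n by auto
  qed
  then obtain n C0 where n: "n \<ge> 1" and C0: "\<And>f x. f \<in> B \<Longrightarrow> cmod (f x) \<le> C0 * growth n x" by blast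
  have g: "?g \<in> rapid" using gauss_Q_set Q_set_subset_rapid by blast
  obtain E where E: "E \<ge> 0" "\<And>x. cmod (?g x) \<le> E * decay (n * K + 1) x" using rapid_bound[OF g] by blast
  have C00: "0 \<le> C0" if "f \<in> B" for f using bound_const_nonneg[OF C0[OF that]] .
  have 1: "cmod (stft f x \<xi>) \<le> (C0 * exp (real (n * K)) * E * ?I) * growth (n * K) x" if f: "f \<in> B" for f x \<xi>
  proof -
    have "cmod (f (x + y) * ?g y) \<le> (C0 * exp (real (n * K)) * E * growth (n * K) x) * exp (- wt y)" for y
    proof -
      have "cmod (f (x + y) * ?g y) \<le> (C0 * (exp (real (n * K)) * growth (n * K) x * growth (n * K) y)) *
          (E * decay (n * K + 1) y)"
        unfolding norm_mult using C00[OF f] E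
        by (intro mult_mono order_trans[OF C0[OF f] mult_left_mono[OF exp_wt_add]]) auto
      also have "\<dots> = (C0 * exp (real (n * K)) * E * growth (n * K) x) * (growth (n * K) y * decay (n * K + 1) y)"
        by (simp only: mult_ac)
      also have "growth (n * K) y * decay (n * K + 1) y = exp (- wt y)"
        by (simp add: exp_add[symmetric] algebra_simps)
      finally show ?thesis .
    qed
    then have "cmod (stft f x \<xi>) \<le> (C0 * exp (real (n * K)) * E * growth (n * K) x) * ?I"
      unfolding stft_def using f BO by (intro fourier_bound_wt rapid_measurable stft_rapid) auto
    then show ?thesis by (simp only: mult_ac)
  qed
  have 2: "\<exists>C. \<forall>f\<in>B. \<forall>(x, \<xi>)\<in>{(x, \<xi>). wt x \<le> real M * wt \<xi>}. growth M \<xi> * cmod (stft f x \<xi>) \<le> C" if M: "1 \<le> M" for M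
  proof -
    have "\<exists>C. \<forall>f\<in>B. \<forall>i\<in>{(x, \<xi>). wt x \<le> real M * wt \<xi>}. growth M (snd i) * cmod (stft f (fst i) (snd i)) \<le> C"
    proof (rule bounded_in_OC_SUP[OF B])
      have "(0, 0) \<in> {(x :: real^'n, \<xi> :: real^'n). wt x \<le> real M * wt \<xi>}" by (simp add: \<omega>_zero)
      then show "{(x :: real^'n, \<xi> :: real^'n). wt x \<le> real M * wt \<xi>} \<noteq> {}" by blast
      show "seminorm_on OC (\<lambda>f. growth M (snd i) * cmod (stft f (fst i) (snd i)))" for i :: "(real^'n) \<times> (real^'n)"
        by (rule stft_seminorm) simp
      fix k :: nat assume "1 \<le> k"
      \<comment> \<open>On the region \<omega>(x) \<le> M \<omega>(\<xi>), growth k K in x is at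
        most growth k K M in \<xi>; the remaining M cancels the factor \<open>growth M \<xi>\<close>
        of the seminorm.\<close>
      have "1 \<le> M + k * K * M" using M by simp
      from stft_bound[OF this, of k, where 'n='n] obtain m C where mC: "m \<ge> 1" "C \<ge> 0"
        "\<And>(f :: real^'n \<Rightarrow> complex) A x \<xi>. f \<in> ON k \<Longrightarrow> UB m (\<lambda>x. A * growth k x) f \<Longrightarrow>
         cmod (stft f x \<xi>) \<le> C * A * growth (k * K) x * decay (M + k * K * M) \<xi>" by blast
      have "growth M \<xi> * cmod (stft f x \<xi>) \<le> C * A"
        if f: "f \<in> ON k" and A: "UB m (\<lambda>x. A * growth k x) f" and x: "wt x \<le> real M * wt \<xi>"
        for f :: "real^'n \<Rightarrow> complex" and A x \<xi>
      proof -
        have A0: "0 \<le> A" by (rule UB_const_nonneg[OF mC(1) A])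
        have "real (k * K) * wt x \<le> real (k * K) * (real M * wt \<xi>)" using x by (intro mult_left_mono) auto
        then have "growth M \<xi> * (growth (k * K) x * decay (M + k * K * M) \<xi>) \<le> 1"
          by (simp add: exp_add[symmetric] algebra_simps)
        then have "(C * A) * (growth M \<xi> * (growth (k * K) x * decay (M + k * K * M) \<xi>)) \<le> (C * A) * 1"
          using A0 mC(2) by (intro mult_left_mono) auto
        moreover have "growth M \<xi> * cmod (stft f x \<xi>) \<le>
           growth M \<xi> * (C * A * growth (k * K) x * decay (M + k * K * M) \<xi>)"
          by (intro mult_left_mono mC(3) f A) auto
        ultimately show ?thesis by (simp only: mult_ac mult_1_right)
      qed
      then show "\<exists>m\<ge>1. \<exists>C\<ge>0. \<forall>f\<in>ON k. \<forall>A. UB m (\<lambda>x. A * growth k x) f \<longrightarrow>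
         (\<forall>i\<in>{(x :: real^'n, \<xi> :: real^'n). wt x \<le> real M * wt \<xi>}. growth M (snd i) * cmod (stft f (fst i) (snd i)) \<le> C * A)"
        using mC(1,2) by (intro exI[of _ m] conjI exI[of _ C]) auto
    qed
    then show ?thesis by (simp add: case_prod_unfold)
  qed
  have "\<exists>C. \<forall>f\<in>B. UB m (\<lambda>x. C * growth (n * K + 1) x) f" if m: "1 \<le> m" for m
  proof -
    obtain M C where MC: "M \<ge> 1" "C > 0" "\<And>(f :: real^'n \<Rightarrow> complex) x A w. smooth f \<Longrightarrow> (\<lambda>y. f (x + y) * gauss (-1) y) \<in> rapid \<Longrightarrow>
     (\<And>\<xi>. cmod (stft f x \<xi>) \<le> A * decay M \<xi>) \<Longrightarrow> cmod (Dw w f x) \<le> C * A * W m (length w)"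
      using reconstruct[OF m, where 'n='n] by blast
    obtain D where D: "\<And>f x \<xi>. f \<in> B \<Longrightarrow> wt x \<le> real M * wt \<xi> \<Longrightarrow> growth M \<xi> * cmod (stft f x \<xi>) \<le> D"
      using 2[OF MC(1)] by blast
    define D' where "D' = \<bar>D\<bar> + C0 * exp (real (n * K)) * E * ?I"
    have "UB m (\<lambda>x. C * D' * growth (n * K + 1) x) f" if f: "f \<in> B" for f
    proof (rule UB_I)
      fix w :: "'n list" and x
      have D'0: "0 \<le> C0 * exp (real (n * K)) * E * ?I" using C00[OF f] E(1) I_wt_nonneg[where 'n='n] by simp
      have "cmod (stft f x \<xi>) \<le> (D' * growth (n * K + 1) x) * decay M \<xi>" for \<xi>
      proof (cases "wt x \<le> real M * wt \<xi>")
        case True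
        have "cmod (stft f x \<xi>) \<le> D * decay M \<xi>"
          using D[OF f True] by (simp add: exp_minus field_simps)
        also have "\<dots> \<le> (D' * growth (n * K + 1) x) * decay M \<xi>"
        proof (rule mult_right_mono)
          have "D * 1 \<le> D' * growth (n * K + 1) x"
            using D'0 wt_nonneg[of x] by (intro mult_mono) (auto simp: D'_def)
          then show "D \<le> D' * growth (n * K + 1) x" by simp
        qed simp
        finally show ?thesis .
      next
        case False
        have "cmod (stft f x \<xi>) \<le> (C0 * exp (real (n * K)) * E * ?I) * growth (n * K) x" by (rule 1[OF f])
        also have "\<dots> \<le> D' * exp (real (n * K + 1) * wt x - real M * wt \<xi>)"
          using False D'0 by (intro mult_mono) (auto simp: D'_def algebra_simps)
        finally show ?thesis by (simp add: mult.assoc exp_add[symmetric])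
      qed
      from MC(3)[OF OC_smooth stft_rapid this] f BO
      show "cmod (Dw w f x) \<le> C * D' * growth (n * K + 1) x * W m (length w)" by (auto simp: mult.assoc)
    qed
    then show ?thesis by blast
  qed
  then have "ON_bdd (n * K + 1) B" using BO OC_smooth unfolding ON_bdd_def ON_def by blast
  then show ?thesis by (intro exI[of _ "n * K + 1"]) auto
qed

section \<open>Convolution\<close>

text \<open>The convolution of the reflected T with f: the reflection in \<open>reflect_dual\<close>
  undoes the one in \<open>star\<close>. For T in the dual of \<open>OC_space \<omega>\<close> it
  makes sense for every f in \<open>OC\<close>.\<close>

definition corr :: "((real^'n::finite \<Rightarrow> complex) \<Rightarrow> complex) \<Rightarrow> (real^'n \<Rightarrow> complex) \<Rightarrow> real^'n \<Rightarrow> complex" where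
  "corr T f x = T (\<lambda>y. f (x + y))"

lemma star_reflect_dual: "star (reflect_dual T) f = corr T f"
  by (simp add: star_def reflect_dual_def reflect_def corr_def fun_eq_iff)

lemma dual_add: "T \<in> dual_space (OC_space \<omega>) \<Longrightarrow> f \<in> OC \<Longrightarrow> g \<in> OC \<Longrightarrow> T (\<lambda>x. f x + g x) = T f + T g"
  and dual_cmult: "T \<in> dual_space (OC_space \<omega>) \<Longrightarrow> f \<in> OC \<Longrightarrow> T (\<lambda>x. c * f x) = c * T f"
  and dual_outside: "T \<in> dual_space (OC_space \<omega>) \<Longrightarrow> f \<notin> OC \<Longrightarrow> T f = 0"
  and dual_ON_bound: "T \<in> dual_space (OC_space \<omega>) \<Longrightarrow> 1 \<le> n \<Longrightarrow> ON_bound n (\<lambda>f. cmod (T f))"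
  by (simp_all add: dual_OC_iff)

lemma dual_diff:
  assumes "T \<in> dual_space (OC_space \<omega>)" "f \<in> OC" "g \<in> OC"
  shows "T (\<lambda>x. f x - g x) = T f - T g"
  using dual_add[OF assms(1,2) OC_cmult[OF assms(3), of "-1"]] dual_cmult[OF assms(1,3), of "-1"] by simp

lemma dual_bound:
  assumes "T \<in> dual_space (OC_space \<omega>)" "1 \<le> n"
  obtains m C where "1 \<le> m" "0 \<le> C"
    "\<And>f A. f \<in> ON n \<Longrightarrow> UB m (\<lambda>x. A * growth n x) f \<Longrightarrow> cmod (T f) \<le> C * A"
  using dual_ON_bound[OF assms] unfolding ON_bound_def by blast

lemma ON_subset_OC: "1 \<le> n \<Longrightarrow> ON n \<subseteq> OC"
  by (auto simp: OC_def)

text \<open>T is applied to the second-order remainder of f in direction i. For this the remainder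
  must be O(t^2) in a norm of the step n K, that is, uniformly after any further derivatives; two
  additional derivatives of f are separated from the order of w by \<open>W_add_le\<close>.\<close>

lemma corr_has_vector_derivative:
  fixes T :: "(real^'n::finite \<Rightarrow> complex) \<Rightarrow> complex"
  assumes T: "T \<in> dual_space (OC_space \<omega>)" and f: "f \<in> OC"
  shows "((\<lambda>t. corr T f (x + t *\<^sub>R axis i 1)) has_vector_derivative corr T (partial i f) x) (at 0)"
proof -
  let ?e = "axis i (1::real)"
  obtain n where n: "1 \<le> n" "f \<in> ON n" using f by (auto simp: OC_def)
  have nK: "1 \<le> n * K" using n(1) K(1) by simp
  have fs: "smooth f" by (rule OC_smooth[OF f])
  obtain m C where mC: "1 \<le> m" "0 \<le> C" "\<And>f A. f \<in> ON (n * K) \<Longrightarrow> UB m (\<lambda>x. A * growth (n * K) x) f \<Longrightarrow> cmod (T f) \<le> C * A"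
    using dual_bound[OF T nK] by blast
  obtain A where A: "UB (2 * m) (\<lambda>x. A * growth n x) f" using ON_D[OF n(2), of "2 * m"] mC(1) by auto
  have A0: "0 \<le> A" by (rule UB_const_nonneg[OF _ A]) (use mC(1) in simp)
  \<comment> \<open>A bounds f. The exponentials come from splitting the argument into x + s e and
    y, where \<bar>s\<bar> \<le> 1 contributes no weight of its own, and W m 2 accounts for the two
    derivatives in the remainder.\<close>
  define D where "D = A * (exp (real (n * K)) * exp (real (n * K) * (real K * (1 + wt x)))) * W m 2"
  show ?thesis
  proof (rule has_vector_derivative_quadratic)
    fix t :: real assume t: "\<bar>t\<bar> \<le> 1"
    let ?R = "\<lambda>y. f (x + t *\<^sub>R ?e + y) - f (x + y) - of_real t * partial i f (x + y)"
    have p: "partial i f \<in> OC" using OC_Dw[OF f, of "[i]"] by simp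
    have O: "(\<lambda>y. f (x + t *\<^sub>R ?e + y)) \<in> OC" "(\<lambda>y. f (x + y)) \<in> OC" "(\<lambda>y. partial i f (x + y)) \<in> OC"
      by (intro OC_translate f p)+
    have "(\<lambda>y. f (x + t *\<^sub>R ?e + y)) \<in> ON (n * K)" "(\<lambda>y. f (x + y)) \<in> ON (n * K)" "(\<lambda>y. partial i f (x + y)) \<in> ON (n * K)"
      using ON_translate n(2) ON_Dw[OF n(2), of "[i]"] by auto
    then have RO: "?R \<in> ON (n * K)"
      by (intro fun_space_diff[OF ON_fun_space] ON_cmult)
    have "UB m (\<lambda>y. (D * t\<^sup>2) * growth (n * K) y) ?R"
    proof (rule UB_I)
      fix w :: "'n list" and y
      let ?F = "Dw w f"
      have "Dw w ?R y = ?F (x + y + t *\<^sub>R ?e) - ?F (x + y) - of_real t * partial i ?F (x + y)"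
      proof -
        have s: "smooth (\<lambda>y. f (x + t *\<^sub>R ?e + y))" "smooth (\<lambda>y. f (x + y))" "smooth (\<lambda>y. partial i f (x + y))"
          by (intro smooth_translate fs smooth_partial)+
        have "Dw w ?R = (\<lambda>y. ?F (x + t *\<^sub>R ?e + y) - ?F (x + y) - of_real t * Dw w (partial i f) (x + y))"
          using s by (simp add: Dw_diff smooth_diff smooth_cmult Dw_cmult Dw_translate)
        then show ?thesis by (simp add: Dw_partial_commute[OF fs] algebra_simps)
      qed
      also have "cmod \<dots> \<le> (D * growth (n * K) y * W m (length w)) * t\<^sup>2"
      proof (rule partial_remainder_bound[OF smooth_Dw[OF fs]])
        fix s assume s: "\<bar>s\<bar> \<le> \<bar>t\<bar>"
        have 1: "cmod (Dw ([i, i] @ w) f (x + y + s *\<^sub>R ?e)) \<le> A * growth n (x + y + s *\<^sub>R ?e) * W (2 * m) (length ([i, i] @ w))"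
          by (rule UB_D[OF A])
        have 2: "W (2 * m) (length ([i, i] @ w)) \<le> W m 2 * W m (length w)"
          using W_add_le[OF mC(1), of 2 "length w"] by simp
        have 3: "growth n (x + y + s *\<^sub>R ?e) \<le>
            exp (real (n * K)) * exp (real (n * K) * (real K * (1 + wt x))) * growth (n * K) y"
        proof -
          have "wt (x + s *\<^sub>R ?e) \<le> real K * (1 + wt x)" using s t by (intro wt_add_unit) auto
          then have "real (n * K) * wt (x + s *\<^sub>R ?e) \<le> real (n * K) * (real K * (1 + wt x))" by (intro mult_left_mono) auto
          then have "exp (real (n * K)) * growth (n * K) (x + s *\<^sub>R ?e) * growth (n * K) y \<le>
            exp (real (n * K)) * exp (real (n * K) * (real K * (1 + wt x))) * growth (n * K) y"
            by (intro mult_right_mono mult_left_mono) auto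
          moreover have "x + y + s *\<^sub>R ?e = (x + s *\<^sub>R ?e) + y" by simp
          ultimately show ?thesis using exp_wt_add[of n "x + s *\<^sub>R ?e" y] by (simp only:)
        qed
        have "A * growth n (x + y + s *\<^sub>R ?e) * W (2 * m) (length ([i, i] @ w)) \<le>
            A * (exp (real (n * K)) * exp (real (n * K) * (real K * (1 + wt x))) * growth (n * K) y) * (W m 2 * W m (length w))"
          using A0 W_pos[of "2 * m" "length ([i, i] @ w)"] mC(1) by (intro mult_mono mult_left_mono 2 3) auto
        also have "\<dots> = D * growth (n * K) y * W m (length w)"
          unfolding D_def by (simp only: mult_ac)
        finally show "cmod (partial i (partial i ?F) (x + y + s *\<^sub>R ?e)) \<le> D * growth (n * K) y * W m (length w)"
          using 1 by simp
      qed
      finally show "cmod (Dw w ?R y) \<le> (D * t\<^sup>2) * growth (n * K) y * W m (length w)" by (simp add: mult_ac)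
    qed
    then have "cmod (T ?R) \<le> C * (D * t\<^sup>2)" by (rule mC(3)[OF RO])
    also have "T ?R = corr T f (x + t *\<^sub>R ?e) - corr T f x - of_real t * corr T (partial i f) x"
      using O by (simp add: dual_diff[OF T] dual_cmult[OF T] OC_diff OC_cmult corr_def)
    finally show "cmod (corr T f (x + t *\<^sub>R ?e) - corr T f (x + 0 *\<^sub>R ?e) - of_real t * corr T (partial i f) x) \<le> (C * D) * t\<^sup>2"
      by (simp add: mult_ac)
  qed
qed

lemma partial_corr:
  "T \<in> dual_space (OC_space \<omega>) \<Longrightarrow> f \<in> OC \<Longrightarrow> partial i (corr T f) = corr T (partial i f)"
  by (rule partial_eqI[OF corr_has_vector_derivative])

lemma Dw_corr:
  "T \<in> dual_space (OC_space \<omega>) \<Longrightarrow> f \<in> OC \<Longrightarrow> Dw w (corr T f) = corr T (Dw w f)"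
  by (induction w) (auto simp: partial_corr OC_Dw)

text \<open>As a function of y, \<open>Dw w f (x + y)\<close> lies in the step n K with norm at most
  a constant times \<open>growth (n * K) x * W m (length w)\<close>. The claim is about T applied to
  derivatives of f, so it is available before smoothness of \<open>corr T f\<close>, whose proof
  takes its local bounds from it.\<close>

lemma corr_pointwise_bound:
  fixes T :: "(real^'n::finite \<Rightarrow> complex) \<Rightarrow> complex"
  assumes T: "T \<in> dual_space (OC_space \<omega>)" and n: "1 \<le> n" and m: "1 \<le> m"
  shows "\<exists>M\<ge>1. \<exists>C\<ge>0. \<forall>f\<in>ON n. \<forall>A. UB M (\<lambda>x. A * growth n x) f \<longrightarrow>
    (\<forall>w x. cmod (corr T (Dw w f) x) \<le> C * A * growth (n * K) x * W m (length w))"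
proof -
  have nK: "1 \<le> n * K" using n K(1) by simp
  obtain l C where lC: "1 \<le> l" "0 \<le> C" "\<And>f A. f \<in> ON (n * K) \<Longrightarrow> UB l (\<lambda>x. A * growth (n * K) x) f \<Longrightarrow> cmod (T f) \<le> C * A"
    using dual_bound[OF T nK] by blast
  define M where "M = max l m"
  have M: "1 \<le> M" "l \<le> M" "m \<le> M" using m by (auto simp: M_def)
  have "cmod (corr T (Dw w f) x) \<le> (C * exp (real (n * K))) * A * growth (n * K) x * W m (length w)"
    if f: "f \<in> ON n" and A: "UB (2 * M) (\<lambda>x. A * growth n x) f" for f :: "real^'n \<Rightarrow> complex" and A w x
  proof -
    have A0: "0 \<le> A" by (rule UB_const_nonneg[OF _ A]) (use M in simp)
    have "UB l (\<lambda>x. (W m (length w) * A) * growth n x) (Dw w f)"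
      by (rule UB_mono[OF lC(1) M(2) UB_Dw[OF M(1) A]])
        (use W_antimono[OF m M(3), of "length w"] A0 in \<open>simp add: mult.assoc mult_right_mono\<close>)
    from UB_translate_exp[OF lC(1) this]
    have "UB l (\<lambda>y. (W m (length w) * A * exp (real (n * K)) * growth (n * K) x) * growth (n * K) y) (\<lambda>y. Dw w f (x + y))" .
    from lC(3)[OF ON_translate[OF ON_Dw[OF f]] this] show ?thesis by (simp add: corr_def mult_ac)
  qed
  then show ?thesis using M lC(2) by (intro exI[of _ "2 * M"] conjI exI[of _ "C * exp (real (n * K))"]) auto
qed

lemma smooth_corr:
  fixes T :: "(real^'n::finite \<Rightarrow> complex) \<Rightarrow> complex"
  assumes T: "T \<in> dual_space (OC_space \<omega>)" and f: "f \<in> OC"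
  shows "smooth (corr T f)"
proof (rule smooth_coinduct_bounded[of _ "corr T ` OC"])
  fix F assume "F \<in> corr T ` OC"
  then obtain g where g: "g \<in> OC" "F = corr T g" by auto
  show "axis_diff F" unfolding g(2) by (rule axis_diffI[OF corr_has_vector_derivative[OF T g(1)]])
  show "partial i F \<in> corr T ` OC" for i
    unfolding g(2) partial_corr[OF T g(1)] using OC_Dw[OF g(1), of "[i]"] by auto
  obtain n where n: "1 \<le> n" "g \<in> ON n" using g(1) by (auto simp: OC_def)
  obtain M C where MC: "M \<ge> 1" "C \<ge> 0" "\<And>A x w. UB M (\<lambda>x. A * growth n x) g \<Longrightarrow>
      cmod (corr T (Dw w g) x) \<le> C * A * growth (n * K) x * W 1 (length w)"
    using corr_pointwise_bound[OF T n(1), of 1] n(2) by blast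
  obtain A where A: "UB M (\<lambda>x. A * growth n x) g" using ON_D[OF n(2) MC(1)] by blast
  show "\<exists>B. \<forall>y. dist x y < 1 \<longrightarrow> cmod (F y) \<le> B" for x
  proof (intro exI[of _ "C * A * exp (real (n * K) * \<omega> (norm x + 1)) * W 1 0"] allI impI)
    fix y assume "dist x y < 1"
    then have "norm y \<le> norm x + 1" using norm_triangle_ineq2[of y x] by (simp add: dist_norm norm_minus_commute)
    then have "wt y \<le> \<omega> (norm x + 1)" by (intro \<omega>_mono) auto
    then have "real (n * K) * wt y \<le> real (n * K) * \<omega> (norm x + 1)" by (intro mult_left_mono) auto
    then have "C * A * growth (n * K) y * W 1 0 \<le> C * A * exp (real (n * K) * \<omega> (norm x + 1)) * W 1 0"
      using MC(2) UB_const_nonneg[OF MC(1) A] W_pos[of 1 0] by (intro mult_right_mono mult_left_mono) auto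
    then show "cmod (F y) \<le> C * A * exp (real (n * K) * \<omega> (norm x + 1)) * W 1 0"
      using MC(3)[OF A, of "[]" y] by (simp add: g(2))
  qed
qed (use f in auto)

lemma corr_UB:
  fixes T :: "(real^'n::finite \<Rightarrow> complex) \<Rightarrow> complex"
  assumes T: "T \<in> dual_space (OC_space \<omega>)" and n: "1 \<le> n" and m: "1 \<le> m"
  shows "\<exists>M\<ge>1. \<exists>C\<ge>0. \<forall>f\<in>ON n. \<forall>A. UB M (\<lambda>x. A * growth n x) f \<longrightarrow>
    UB m (\<lambda>x. (C * A) * growth (n * K) x) (corr T f)"
proof -
  obtain M C where MC: "M \<ge> 1" "C \<ge> 0" "\<And>f A w x. f \<in> ON n \<Longrightarrow> UB M (\<lambda>x. A * growth n x) f \<Longrightarrow>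
      cmod (corr T (Dw w f) x) \<le> C * A * growth (n * K) x * W m (length w)"
    using corr_pointwise_bound[OF assms] by blast
  have "UB m (\<lambda>x. (C * A) * growth (n * K) x) (corr T f)"
    if "f \<in> ON n" "UB M (\<lambda>x. A * growth n x) f" for f A
    using MC(3)[OF that] by (intro UB_I) (simp add: Dw_corr[OF T subsetD[OF ON_subset_OC[OF n] that(1)]])
  then show ?thesis using MC(1,2) by blast
qed

lemma corr_ON:
  assumes T: "T \<in> dual_space (OC_space \<omega>)" and n: "1 \<le> n" and f: "f \<in> ON n"
  shows "corr T f \<in> ON (n * K)"
proof -
  have "\<exists>C. UB m (\<lambda>x. C * growth (n * K) x) (corr T f)" if m: "1 \<le> m" for m
  proof -
    obtain M C where MC: "M \<ge> 1" "\<And>A. UB M (\<lambda>x. A * growth n x) f \<Longrightarrow> UB m (\<lambda>x. (C * A) * growth (n * K) x) (corr T f)"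
      using corr_UB[OF T n m] f by blast
    obtain A where "UB M (\<lambda>x. A * growth n x) f" using ON_D[OF f MC(1)] by blast
    then show ?thesis using MC(2) by blast
  qed
  then show ?thesis using smooth_corr[OF T subsetD[OF ON_subset_OC[OF n] f]] by (simp add: ON_def)
qed

lemma corr_OC:
  assumes T: "T \<in> dual_space (OC_space \<omega>)" and f: "f \<in> OC"
  shows "corr T f \<in> OC"
proof -
  obtain n where n: "1 \<le> n" "f \<in> ON n" using f by (auto simp: OC_def)
  then show ?thesis using corr_ON[OF T n] ON_subset_OC[of "n * K"] K(1) by (auto simp: Suc_le_eq)
qed

text \<open>Decay of f at the rate p K splits under translation into decay p in x and growth p K in
  y. The growth is tolerated by T, and the decay is inherited by the result.\<close>

lemma corr_Q_set:
  fixes T :: "(real^'n::finite \<Rightarrow> complex) \<Rightarrow> complex"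
  assumes T: "T \<in> dual_space (OC_space \<omega>)" and f: "f \<in> Q_set"
  shows "corr T f \<in> Q_set"
proof -
  have fO: "f \<in> OC" using f Q_set_subset_OC by blast
  have "\<exists>C. UB m (\<lambda>x. C * decay q x) (corr T f)" if m: "1 \<le> m" for m q
  proof -
    \<comment> \<open>One more than q, because functionals are bounded on steps of positive index
      and q may be 0.\<close>
    define p where "p = Suc q"
    have pK: "1 \<le> p * K" using K(1) by (simp add: p_def)
    obtain l C where lC: "1 \<le> l" "0 \<le> C" "\<And>f A. f \<in> ON (p * K) \<Longrightarrow> UB l (\<lambda>x. A * growth (p * K) x) f \<Longrightarrow> cmod (T f) \<le> C * A"
      using dual_bound[OF T pK] by blast
    define M where "M = max l m"
    have M: "1 \<le> M" "l \<le> M" "m \<le> M" using m by (auto simp: M_def)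
    obtain A where A: "UB (2 * M) (\<lambda>x. A * decay (p * K) x) f" using Q_set_D[OF f, of "2 * M" "p * K"] M(1) by (auto simp del: of_nat_mult)
    have A0: "0 \<le> A" by (rule UB_const_nonneg[OF _ A]) (use M in simp)
    have "UB m (\<lambda>x. (C * A * exp (real (p * K))) * decay q x) (corr T f)"
    proof (rule UB_I)
      fix w :: "'n list" and x
      have "UB l (\<lambda>x. (W m (length w) * A) * decay (p * K) x) (Dw w f)"
        by (rule UB_mono[OF lC(1) M(2) UB_Dw[OF M(1) A]])
          (use W_antimono[OF m M(3), of "length w"] A0 in \<open>simp add: mult.assoc mult_right_mono\<close>)
      from UB_translate[OF this, of x]
      have "UB l (\<lambda>y. (W m (length w) * A * exp (real (p * K)) * decay p x) * growth (p * K) y) (\<lambda>y. Dw w f (x + y))"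
      proof (rule UB_mono[OF lC(1) order.refl])
        fix y
        have "W m (length w) * A * decay (p * K) (x + y) \<le> W m (length w) * A * (exp (real (p * K)) * growth (p * K) y * decay p x)"
          using A0 W_pos[OF m, of "length w"] by (intro mult_left_mono exp_wt_translate') auto
        then show "W m (length w) * A * decay (p * K) (x + y) \<le> W m (length w) * A * exp (real (p * K)) * decay p x * growth (p * K) y"
          by (simp only: mult_ac)
      qed
      from lC(3)[OF ON_translate[OF subsetD[OF Q_set_subset_ON[of p] Q_set_Dw[OF f]]] this]
      have "cmod (corr T (Dw w f) x) \<le> C * (W m (length w) * A * exp (real (p * K)) * decay p x)"
        by (simp add: corr_def)
      also have "\<dots> \<le> C * (W m (length w) * A * exp (real (p * K)) * decay q x)"
        using lC(2) A0 W_pos[OF m, of "length w"] wt_nonneg[of x]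
        by (intro mult_left_mono) (auto simp: p_def mult_right_mono)
      finally show "cmod (Dw w (corr T f) x) \<le> C * A * exp (real (p * K)) * decay q x * W m (length w)"
        by (simp add: Dw_corr[OF T fO] mult_ac)
    qed
    then show ?thesis by blast
  qed
  then show ?thesis using smooth_corr[OF T fO] by (simp add: Q_set_def)
qed

lemma norm_le_exp_wt: "\<exists>P>0. \<forall>x. 1 + norm x \<le> P * exp (wt x)"
proof -
  obtain P where "P > 0" "\<And>t. t \<ge> 0 \<Longrightarrow> (1 + t) ^ 1 \<le> P * exp (\<omega> t)" using power_le_exp_\<omega> by blast
  then show ?thesis by (intro exI[of _ P]) auto
qed

text \<open>\<open>Q_set\<close> is dense: \<open>f \<cdot> gauss (-1) (\<epsilon> x)\<close> tends to \<open>f\<close> at rate \<open>\<epsilon>\<close>, at the cost of one factor \<open>e\<^sup>\<omega>\<close>.\<close>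
lemma dual_zero_of_Q_set:
  fixes T :: "(real^'n::finite \<Rightarrow> complex) \<Rightarrow> complex"
  assumes T: "T \<in> dual_space (OC_space \<omega>)" and 0: "\<And>f. f \<in> Q_set \<Longrightarrow> T f = 0" and f: "f \<in> OC"
  shows "T f = 0"
proof -
  obtain n where n: "1 \<le> n" "f \<in> ON n" using f by (auto simp: OC_def)
  have fs: "smooth f" by (rule OC_smooth[OF f])
  have n1: "1 \<le> n + 1" by simp
  obtain m C where mC: "1 \<le> m" "0 \<le> C" "\<And>f A. f \<in> ON (n + 1) \<Longrightarrow> UB m (\<lambda>x. A * growth (n + 1) x) f \<Longrightarrow> cmod (T f) \<le> C * A"
    using dual_bound[OF T n1] by blast
  obtain M D where MD: "M \<ge> m" "D > 0" "\<And>(f :: real^'n \<Rightarrow> complex) g u v. smooth f \<Longrightarrow> smooth g \<Longrightarrow> UB M u f \<Longrightarrow> UB M v g \<Longrightarrow>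
     UB m (\<lambda>x. D * (u x * v x)) (\<lambda>x. f x * g x)"
    using UB_mult[OF mC(1), where 'n='n] by blast
  have M: "1 \<le> M" using MD mC by simp
  obtain A where A: "UB M (\<lambda>x. A * growth n x) f" using ON_D[OF n(2) M] by blast
  have A0: "0 \<le> A" by (rule UB_const_nonneg[OF M A])
  obtain E where E: "E > 0" "\<And>\<epsilon>. 0 < \<epsilon> \<Longrightarrow> \<epsilon> \<le> 1 \<Longrightarrow> UB M (\<lambda>x. E * \<epsilon> * (1 + norm x)) (\<lambda>x::real^'n. 1 - gauss (-1) (\<epsilon> *\<^sub>R x))"
    using UB_one_minus_gauss[OF M] by blast
  obtain P where P: "P > 0" "\<And>x::real^'n. 1 + norm x \<le> P * exp (wt x)" using norm_le_exp_wt by blast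
  have bound: "cmod (T f) \<le> (C * (D * A * E * P)) * \<epsilon>" if e: "0 < \<epsilon>" "\<epsilon> \<le> 1" for \<epsilon>
  proof -
    let ?\<chi> = "\<lambda>x::real^'n. gauss (-1) (\<epsilon> *\<^sub>R x)"
    have q: "(\<lambda>x. ?\<chi> x * f x) \<in> Q_set" by (rule Q_set_mult_ON[OF gauss_scale_Q_set[OF e] n(2)])
    then have qO: "(\<lambda>x. ?\<chi> x * f x) \<in> OC" "(\<lambda>x. ?\<chi> x * f x) \<in> ON (n + 1)"
      using Q_set_subset_OC Q_set_subset_ON by blast+
    have d: "(\<lambda>x. f x - ?\<chi> x * f x) \<in> ON (n + 1)"
      by (rule fun_space_diff[OF ON_fun_space _ qO(2)]) (use ON_mono[of n "n + 1"] n in auto)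
    have "UB m (\<lambda>x. (D * A * E * P * \<epsilon>) * growth (n + 1) x) (\<lambda>x. f x * (1 - ?\<chi> x))"
    proof (rule UB_mono[OF mC(1) order.refl MD(3)[OF fs _ A E(2)[OF e]]])
      show "smooth (\<lambda>x. 1 - ?\<chi> x)" by (intro smooth_diff smooth_const smooth_scale smooth_gauss)
      fix x :: "real^'n"
      have "D * (A * growth n x * (E * \<epsilon> * (1 + norm x))) \<le> D * (A * growth n x * (E * \<epsilon> * (P * exp (wt x))))"
        using MD(2) A0 E(1) e by (intro mult_left_mono P(2)) auto
      also have "\<dots> = (D * A * E * P * \<epsilon>) * (growth n x * exp (wt x))" by (simp only: mult_ac)
      also have "growth n x * exp (wt x) = growth (n + 1) x"
        by (simp add: exp_add[symmetric] algebra_simps)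
      finally show "D * (A * growth n x * (E * \<epsilon> * (1 + norm x))) \<le> (D * A * E * P * \<epsilon>) * growth (n + 1) x" .
    qed
    then have "UB m (\<lambda>x. (D * A * E * P * \<epsilon>) * growth (n + 1) x) (\<lambda>x. f x - ?\<chi> x * f x)"
      by (simp add: algebra_simps)
    from mC(3)[OF d this] have "cmod (T f - T (\<lambda>x. ?\<chi> x * f x)) \<le> C * (D * A * E * P * \<epsilon>)"
      by (simp add: dual_diff[OF T f qO(1)])
    then show ?thesis using 0[OF q] by (simp add: mult_ac)
  qed
  define Z where "Z = C * (D * A * E * P)"
  have Z0: "0 \<le> Z" using mC(2) MD(2) A0 E(1) P(1) by (simp add: Z_def)
  have "cmod (T f) \<le> 0 + e" if "e > 0" for e
  proof -
    let ?\<epsilon> = "min 1 (e / (Z + 1))"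
    have "cmod (T f) \<le> Z * ?\<epsilon>" using bound[of ?\<epsilon>] that Z0 by (simp add: Z_def)
    also have "\<dots> \<le> Z * (e / (Z + 1))" using Z0 by (intro mult_left_mono) auto
    also have "\<dots> \<le> e" using Z0 that by (simp add: field_simps)
    finally show ?thesis by simp
  qed
  then have "cmod (T f) \<le> 0" by (rule field_le_epsilon)
  then show ?thesis by simp
qed

section \<open>The convolution as a functional on \<open>OC\<close>\<close>

lemma corr_add:
  "R \<in> dual_space (OC_space \<omega>) \<Longrightarrow> f \<in> OC \<Longrightarrow> g \<in> OC \<Longrightarrow> corr R (\<lambda>x. f x + g x) = (\<lambda>x. corr R f x + corr R g x)"
  unfolding corr_def by (rule ext, rule dual_add[OF _ OC_translate OC_translate])

lemma corr_cmult:
  "R \<in> dual_space (OC_space \<omega>) \<Longrightarrow> f \<in> OC \<Longrightarrow> corr R (\<lambda>x. c * f x) = (\<lambda>x. c * corr R f x)"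
  unfolding corr_def by (rule ext, rule dual_cmult[OF _ OC_translate])

definition conv_ext :: "((real^'n::finite \<Rightarrow> complex) \<Rightarrow> complex) \<Rightarrow> ((real^'n \<Rightarrow> complex) \<Rightarrow> complex) \<Rightarrow> (real^'n \<Rightarrow> complex) \<Rightarrow> complex" where
  "conv_ext T S f = (if f \<in> OC then S (corr T f) else 0)"

lemma conv_ext_dual:
  fixes T S :: "(real^'n::finite \<Rightarrow> complex) \<Rightarrow> complex"
  assumes T: "T \<in> dual_space (OC_space \<omega>)" and S: "S \<in> dual_space (OC_space \<omega>)"
  shows "conv_ext T S \<in> dual_space (OC_space \<omega>)"
  unfolding dual_OC_iff
proof (intro conjI ballI allI impI)
  fix f g :: "real^'n \<Rightarrow> complex" assume fg: "f \<in> OC" "g \<in> OC"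
  show "conv_ext T S (\<lambda>x. f x + g x) = conv_ext T S f + conv_ext T S g"
    using fg by (simp add: conv_ext_def OC_add corr_add[OF T fg] dual_add[OF S] corr_OC[OF T])
next
  fix c and f :: "real^'n \<Rightarrow> complex" assume f: "f \<in> OC"
  show "conv_ext T S (\<lambda>x. c * f x) = c * conv_ext T S f"
    using f by (simp add: conv_ext_def OC_cmult corr_cmult[OF T f] dual_cmult[OF S] corr_OC[OF T])
next
  fix f :: "real^'n \<Rightarrow> complex" assume "f \<notin> OC"
  then show "conv_ext T S f = 0" by (simp add: conv_ext_def)
next
  fix n :: nat assume n: "1 \<le> n"
  then have nK: "1 \<le> n * K" using K(1) by simp
  obtain m C where mC: "1 \<le> m" "0 \<le> C" "\<And>f A. f \<in> ON (n * K) \<Longrightarrow> UB m (\<lambda>x. A * growth (n * K) x) f \<Longrightarrow> cmod (S f) \<le> C * A"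
    using dual_bound[OF S nK] by blast
  obtain M D where MD: "M \<ge> 1" "D \<ge> 0" "\<And>f A. f \<in> ON n \<Longrightarrow> UB M (\<lambda>x. A * growth n x) f \<Longrightarrow>
      UB m (\<lambda>x. (D * A) * growth (n * K) x) (corr T f)"
    using corr_UB[OF T n mC(1)] by blast
  have "cmod (conv_ext T S f) \<le> (C * D) * A" if "f \<in> ON n" "UB M (\<lambda>x. A * growth n x) f" for f A
    using mC(3)[OF corr_ON[OF T n that(1)] MD(3)[OF that]] ON_subset_OC[OF n] that(1) by (auto simp: conv_ext_def mult_ac)
  then show "ON_bound n (\<lambda>f. cmod (conv_ext T S f))"
    unfolding ON_bound_def using MD mC by (intro exI[of _ M] conjI exI[of _ "C * D"]) auto
qed

lemma dual_zero_mem: "(\<lambda>f. 0) \<in> dual_space (OC_space \<omega>)"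
proof -
  have "ON_bound n (\<lambda>f :: real^'a::finite \<Rightarrow> complex. cmod 0)" for n
    unfolding ON_bound_def by (rule exI[of _ 1], simp, rule exI[of _ 0], simp)
  then show ?thesis unfolding dual_OC_iff by simp
qed

lemma dual_lincomb:
  assumes U: "U \<in> dual_space (OC_space \<omega>)" and V: "V \<in> dual_space (OC_space \<omega>)"
  shows "(\<lambda>f. U f + c * V f) \<in> dual_space (OC_space \<omega>)"
  unfolding dual_OC_iff
proof (intro conjI ballI allI impI)
  fix n :: nat assume n: "1 \<le> n"
  obtain m C where mC: "1 \<le> m" "0 \<le> C" "\<And>f A. f \<in> ON n \<Longrightarrow> UB m (\<lambda>x. A * growth n x) f \<Longrightarrow> cmod (U f) \<le> C * A"
    using dual_bound[OF U n] by blast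
  obtain k D where kD: "1 \<le> k" "0 \<le> D" "\<And>f A. f \<in> ON n \<Longrightarrow> UB k (\<lambda>x. A * growth n x) f \<Longrightarrow> cmod (V f) \<le> D * A"
    using dual_bound[OF V n] by blast
  have "cmod (U f + c * V f) \<le> (C + cmod c * D) * A" if f: "f \<in> ON n" and A: "UB (max m k) (\<lambda>x. A * growth n x) f" for f A
  proof -
    have "cmod (U f) \<le> C * A" by (rule mC(3)[OF f UB_mono[OF mC(1) _ A]]) auto
    moreover have "cmod (V f) \<le> D * A" by (rule kD(3)[OF f UB_mono[OF kD(1) _ A]]) auto
    then have "cmod c * cmod (V f) \<le> cmod c * (D * A)" by (rule mult_left_mono) simp
    ultimately show ?thesis using norm_triangle_ineq[of "U f" "c * V f"] by (simp add: norm_mult algebra_simps)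
  qed
  then show "ON_bound n (\<lambda>f. cmod (U f + c * V f))"
    unfolding ON_bound_def using mC(1,2) kD(1,2) by (intro exI[of _ "max m k"] conjI exI[of _ "C + cmod c * D"]) auto
qed (auto simp: dual_add[OF U] dual_add[OF V] dual_cmult[OF U] dual_cmult[OF V] dual_outside[OF U] dual_outside[OF V] algebra_simps)

lemma restr_S_conv_ext:
  assumes T: "T \<in> dual_space (OC_space \<omega>)"
  shows "restr_S \<omega> (conv_ext T S) = conv \<omega> T (restr_S \<omega> S)"
proof
  fix f
  show "restr_S \<omega> (conv_ext T S) f = conv \<omega> T (restr_S \<omega> S) f"
    using corr_Q_set[OF T, of f] Q_set_subset_OC by (auto simp: restr_S_def conv_def conv_ext_def star_reflect_dual S_set_eq_Q_set)
qed

lemma restr_S_inj: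
  fixes U V :: "(real^'n::finite \<Rightarrow> complex) \<Rightarrow> complex"
  assumes U: "U \<in> dual_space (OC_space \<omega>)" and V: "V \<in> dual_space (OC_space \<omega>)" and "restr_S \<omega> U = restr_S \<omega> V"
  shows "U = V"
proof
  fix f :: "real^'n \<Rightarrow> complex"
  let ?D = "\<lambda>f. U f + (-1) * V f"
  have eq: "U f = V f" if "f \<in> Q_set" for f
    using fun_cong[OF assms(3), of f] that by (simp add: restr_S_def S_set_eq_Q_set)
  have "?D \<in> dual_space (OC_space \<omega>)" by (rule dual_lincomb[OF U V])
  then have "f \<in> OC \<Longrightarrow> ?D f = 0" by (rule dual_zero_of_Q_set) (simp add: eq)
  then show "U f = V f" using dual_outside[OF U, of f] dual_outside[OF V, of f] by (cases "f \<in> OC") auto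
qed

lemma conv_OC_eq:
  assumes T: "T \<in> dual_space (OC_space \<omega>)" and S: "S \<in> dual_space (OC_space \<omega>)"
  shows "conv_OC \<omega> T S = conv_ext T S"
  unfolding conv_OC_def
proof (rule the_equality)
  show "conv_ext T S \<in> topspace (OC_dual \<omega>) \<and> restr_S \<omega> (conv_ext T S) = conv \<omega> T (restr_S \<omega> S)"
    using conv_ext_dual[OF T S] restr_S_conv_ext[OF T] by (simp add: OC_dual_def)
  fix U assume U: "U \<in> topspace (OC_dual \<omega>) \<and> restr_S \<omega> U = conv \<omega> T (restr_S \<omega> S)"
  then have "U \<in> dual_space (OC_space \<omega>)" by (simp add: OC_dual_def)
  then show "U = conv_ext T S"
    by (rule restr_S_inj[OF _ conv_ext_dual[OF T S]]) (simp add: U restr_S_conv_ext[OF T])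
qed

section \<open>Restriction to \<open>S_space \<omega>\<close>\<close>

lemma q_norm_subadditive: "subadditive_family (S_set \<omega> :: (real^'n::finite \<Rightarrow> complex) set) {q_norm \<omega> m n | m n. 1 \<le> m \<and> 1 \<le> n}"
proof -
  have fin: "\<exists>a. q_norm \<omega> m n f = ereal a" if m: "1 \<le> m" and f: "f \<in> Q_set" for m n and f :: "real^'n \<Rightarrow> complex"
  proof -
    have "0 \<le> q_norm \<omega> m n f"
    proof (rule ereal_le_real)
      fix C assume "q_norm \<omega> m n f \<le> ereal C"
      then show "0 \<le> ereal C" using UB_const_nonneg[OF m] by (auto simp: q_norm_le_iff[OF m Q_set_smooth[OF f]])
    qed
    moreover obtain C where "q_norm \<omega> m n f \<le> ereal C" using Q_set_D[OF f m] q_norm_le_iff[OF m Q_set_smooth[OF f]] by blast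
    ultimately show ?thesis by (cases "q_norm \<omega> m n f") auto
  qed
  have "q_norm \<omega> m n (\<lambda>x. f x + g x) \<le> q_norm \<omega> m n f + q_norm \<omega> m n g"
    if "1 \<le> m" "f \<in> Q_set" "g \<in> Q_set" for m n and f g :: "real^'n \<Rightarrow> complex"
  proof -
    have s: "smooth f" "smooth g" using that Q_set_smooth by auto
    from fin[OF that(1,2)] obtain a where a: "q_norm \<omega> m n f = ereal a" ..
    from fin[OF that(1,3)] obtain b where b: "q_norm \<omega> m n g = ereal b" ..
    have "UB m (\<lambda>x. a * decay n x) f" "UB m (\<lambda>x. b * decay n x) g"
      using q_norm_le_iff[OF that(1)] s a b by (metis order_refl)+
    from UB_add[OF s this] have "q_norm \<omega> m n (\<lambda>x. f x + g x) \<le> ereal (a + b)"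
      using q_norm_le_iff[OF that(1) smooth_add[OF s]] by (simp add: distrib_right)
    then show ?thesis by (simp add: a b)
  qed
  moreover have "q_norm \<omega> m n (\<lambda>x::real^'n. 0) \<le> 0" if "1 \<le> m" for m n
  proof -
    have "Dw w (\<lambda>x::real^'n. 0) = (\<lambda>x. 0)" for w by (induction w) (auto simp: partial_const)
    then have "UB m (\<lambda>x. 0 * decay n x) (\<lambda>x::real^'n. 0)" by (simp add: UB_def)
    then show ?thesis unfolding zero_ereal_def by (subst q_norm_le_iff[OF that smooth_const])
  qed
  moreover have "q_norm \<omega> m n f < \<infinity>" if "1 \<le> m" "f \<in> Q_set" for m n and f :: "real^'n \<Rightarrow> complex"
    using fin[OF that, of n] by auto
  ultimately show ?thesis unfolding subadditive_family_def S_set_eq_Q_set by auto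
qed

lemma Q_set_fun_space: "fun_space Q_set"
proof -
  have "(\<lambda>x. 0 * gauss (-1) x) \<in> Q_set" by (rule Q_set_cmult[OF gauss_Q_set])
  then show ?thesis by (simp add: fun_space_def Q_set_add Q_set_cmult)
qed

text \<open>The inclusion factors through the step 1, whose norm with index m is dominated by
  \<open>q_norm \<omega> m 1\<close>, since decay is at most growth.\<close>

lemma restr_S_dual:
  fixes U :: "(real^'n::finite \<Rightarrow> complex) \<Rightarrow> complex"
  assumes U: "U \<in> dual_space (OC_space \<omega>)"
  shows "restr_S \<omega> U \<in> dual_space (S_space \<omega>)"
proof -
  obtain m C where mC: "1 \<le> m" "0 \<le> C" "\<And>f A. f \<in> ON 1 \<Longrightarrow> UB m (\<lambda>x. A * growth 1 x) f \<Longrightarrow> cmod (U f) \<le> C * A"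
    using dual_bound[OF U order.refl] by blast
  have QO: "f \<in> OC" if "f \<in> Q_set" for f :: "real^'n \<Rightarrow> complex" using that Q_set_subset_OC by blast
  have "continuous_map (S_space \<omega>) euclidean (restr_S \<omega> U)"
    unfolding S_space_def
  proof (rule continuous_map_seminorm_topology[OF _ q_norm_subadditive])
    show "fun_space (S_set \<omega> :: (real^'n \<Rightarrow> complex) set)" by (simp add: S_set_eq_Q_set Q_set_fun_space)
    fix f :: "real^'n \<Rightarrow> complex" and d :: real assume f: "f \<in> S_set \<omega>" and d: "0 < d"
    have "dist (restr_S \<omega> U g) (restr_S \<omega> U f) < d"
      if g: "g \<in> S_set \<omega>" and q: "q_norm \<omega> m 1 (\<lambda>x. g x - f x) < ereal (d / (C + 1))" for g
    proof -
      have fg: "f \<in> Q_set" "g \<in> Q_set" using f g by (auto simp: S_set_eq_Q_set)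
      have gf: "(\<lambda>x. g x - f x) \<in> Q_set" by (rule fun_space_diff[OF Q_set_fun_space fg(2,1)])
      have "UB m (\<lambda>x. d / (C + 1) * decay 1 x) (\<lambda>x. g x - f x)"
        using q q_norm_le_iff[OF mC(1) Q_set_smooth[OF gf]] less_imp_le by blast
      then have "UB m (\<lambda>x. d / (C + 1) * growth 1 x) (\<lambda>x. g x - f x)"
      proof (rule UB_mono[OF mC(1) order.refl])
        fix x :: "real^'n"
        have "decay 1 x \<le> growth 1 x" using wt_nonneg[of x] by simp
        then show "d / (C + 1) * decay 1 x \<le> d / (C + 1) * growth 1 x"
          by (rule mult_left_mono) (use d mC(2) in simp)
      qed
      then have "cmod (U (\<lambda>x. g x - f x)) \<le> C * (d / (C + 1))"
        by (rule mC(3)[OF subsetD[OF Q_set_subset_ON gf]])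
      also have "\<dots> < d" using mC(2) d by (simp add: field_simps)
      finally show ?thesis using f g by (simp add: restr_S_def dist_norm dual_diff[OF U QO[OF fg(2)] QO[OF fg(1)]])
    qed
    then show "\<exists>F e. finite F \<and> F \<subseteq> {q_norm \<omega> m n | m n. 1 \<le> m \<and> 1 \<le> n} \<and> 0 < e \<and>
      (\<forall>g\<in>S_set \<omega>. (\<forall>p\<in>F. p (\<lambda>x. g x - f x) < ereal e) \<longrightarrow> dist (restr_S \<omega> U g) (restr_S \<omega> U f) < d)"
      using mC(1,2) d by (intro exI[of _ "{q_norm \<omega> m 1}"] exI[of _ "d / (C + 1)"]) auto
  qed
  then show ?thesis
    by (simp add: dual_space_def S_space_def restr_S_def S_set_eq_Q_set Q_set_add Q_set_cmult QO dual_add[OF U] dual_cmult[OF U])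
qed

subsection \<open>Joint continuity\<close>

lemma dual_bounded_set:
  assumes T: "T \<in> dual_space (OC_space \<omega>)" and B: "bounded_in (OC_space \<omega>) B"
  shows "\<exists>C>0. \<forall>f\<in>B. cmod (T f) \<le> C"
proof -
  have "OC_seminorm (\<lambda>f. cmod (T f))"
    using dual_ON_bound[OF T]
    by (auto simp: OC_seminorm_def seminorm_on_def dual_add[OF T] dual_cmult[OF T] norm_mult norm_triangle_ineq)
  then obtain C where C: "\<And>f. f \<in> B \<Longrightarrow> cmod (T f) \<le> C" using B unfolding bounded_in_OC_iff by blast
  \<comment> \<open>A positive bound, as \<open>convolution_estimate\<close> divides by a.\<close>
  show ?thesis by (rule exI[of _ "max C 1"]) (use C in \<open>auto simp: le_max_iff_disj\<close>)
qed

text \<open>The weights \<open>d k = inf\<^sub>m E m W m k\<close> dominate all derivatives of order \<open>j + k\<close> on \<open>B\<close> by \<open>d j d k\<close>.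
  This splits a bound that holds for all \<open>m\<close> simultaneously into two such bounds, which is what one
  bounded set for \<open>T\<close> and one for \<open>S\<close> require.\<close>
lemma convolution_estimate:
  fixes B :: "(real^'n::finite \<Rightarrow> complex) set"
  assumes B: "bounded_in (OC_space \<omega>) B"
  shows "\<exists>B1 B2. bounded_in (OC_space \<omega>) B1 \<and> bounded_in (OC_space \<omega>) B2 \<and>
    (\<forall>T\<in>dual_space (OC_space \<omega>). \<forall>S\<in>dual_space (OC_space \<omega>). \<forall>f\<in>B. \<forall>a b. 0 < a \<longrightarrow>
      (\<forall>h\<in>B1. cmod (T h) \<le> a) \<longrightarrow> (\<forall>h\<in>B2. cmod (S h) \<le> b) \<longrightarrow> cmod (S (corr T f)) \<le> a * b)"
proof -
  obtain n where n: "1 \<le> n" "ON_bdd n B" using bounded_in_OC_regular[OF B] by blast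
  have nK: "1 \<le> n * K" using n(1) K(1) by simp
  have BO: "B \<subseteq> ON n" "B \<subseteq> OC" using n ON_subset_OC by (auto simp: ON_bdd_def)
  obtain c where c: "\<And>m f. 1 \<le> m \<Longrightarrow> f \<in> B \<Longrightarrow> UB m (\<lambda>x. c m * growth n x) f"
    using n(2) unfolding ON_bdd_def by metis
  \<comment> \<open>The index 2 i anticipates the halving in \<open>W_add_le\<close>; the summand 1
    gives E \<ge> 1 and hence E (max m m') \<le> E m * E m'.\<close>
  define E where "E m = 1 + (\<Sum>i\<le>m. \<bar>c (2 * i)\<bar>)" for m
  have E1: "1 \<le> E m" for m by (simp add: E_def sum_nonneg)
  have Ec: "c (2 * m) \<le> E m" for m
    using member_le_sum[of m "{..m}" "\<lambda>i. \<bar>c (2 * i)\<bar>"] by (simp add: E_def)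
  define d where "d k = (INF m\<in>{1..}. E m * W m k)" for k
  have EW1: "1 \<le> E m * W m k" if "1 \<le> m" for m k
    using mult_mono[OF E1[of m] W_ge_1[OF that, of k]] E1[of m] by auto
  have d_le: "d k \<le> E m * W m k" if "1 \<le> m" for m k
    unfolding d_def by (rule cINF_lower) (use that EW1 in \<open>auto intro!: bdd_belowI2\<close>)
  have d_ge: "z \<le> d k" if "\<And>m. 1 \<le> m \<Longrightarrow> z \<le> E m * W m k" for z k
    unfolding d_def by (rule cINF_greatest) (use that in auto)
  have d1: "1 \<le> d k" for k by (rule d_ge[OF EW1])
  have dpos: "0 < d k" for k using d1[of k] by linarith
  have split: "cmod (Dw u f x) \<le> d j * d k * growth n x" if f: "f \<in> B" and u: "length u = j + k" for f u x j k
  proof -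
    let ?z = "cmod (Dw u f x) * decay n x"
    have z: "?z \<le> (E m * W m j) * (E m' * W m' k)" if m: "1 \<le> m" "1 \<le> m'" for m m'
    proof -
      let ?M = "max m m'"
      have M: "1 \<le> ?M" "1 \<le> 2 * ?M" using m by auto
      have "cmod (Dw u f x) \<le> c (2 * ?M) * growth n x * W (2 * ?M) (j + k)"
        using UB_D[OF c[OF M(2) f], of u x] u by simp
      also have "\<dots> \<le> (E ?M * growth n x) * (W ?M j * W ?M k)"
        using Ec[of ?M] E1[of ?M] W_pos[OF M(2)] by (intro mult_mono mult_right_mono W_add_le M) (auto intro: less_imp_le)
      finally have "?z \<le> (E ?M * growth n x) * (W ?M j * W ?M k) * decay n x"
        by (rule mult_right_mono) simp
      also have "\<dots> = (E ?M * (W ?M j * W ?M k)) * (growth n x * decay n x)" by (simp only: mult_ac)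
      also have "\<dots> = E ?M * (W ?M j * W ?M k)" by (simp only: exp_minus_inverse mult_1_right)
      also have "\<dots> \<le> (E m * E m') * (W m j * W m' k)"
      proof (intro mult_mono W_antimono m)
        show "E ?M \<le> E m * E m'"
          using mult_mono[OF order.refl E1[of m'], of "E m"] mult_mono[OF E1[of m] order.refl, of "E m'"] E1[of m] E1[of m']
          by (simp add: max_def)
      qed (use M E1[of m] E1[of m'] W_pos[OF M(1)] W_pos[OF m(1)] W_pos[OF m(2)] in \<open>auto intro!: mult_nonneg_nonneg less_imp_le\<close>)
      finally show ?thesis by (simp only: mult_ac)
    qed
    have pos: "0 < E m * W m i" if "1 \<le> m" for m i using EW1[OF that, of i] by linarith
    have "?z \<le> d j * (E m' * W m' k)" if m': "1 \<le> m'" for m'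
    proof -
      have "?z / (E m' * W m' k) \<le> d j"
        using z[OF _ m'] by (intro d_ge) (simp only: pos_divide_le_eq[OF pos[OF m']])
      then show ?thesis by (simp only: pos_divide_le_eq[OF pos[OF m']])
    qed
    then have "?z / d j \<le> d k" by (intro d_ge) (simp add: pos_divide_le_eq[OF dpos] mult.commute)
    then have "?z \<le> d j * d k" by (simp add: pos_divide_le_eq[OF dpos] mult.commute)
    then have "?z * growth n x \<le> d j * d k * growth n x" by (rule mult_right_mono) simp
    moreover have "?z * growth n x = cmod (Dw u f x) * (growth n x * decay n x)"
      by (simp only: mult_ac)
    ultimately show ?thesis by (simp only: exp_minus_inverse mult_1_right)
  qed
  \<comment> \<open>The scalar cancels the factor \<open>d (length w)\<close> from
    \<open>split\<close> and the growth in x caused by the translation. What is left of a derivative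
    of order j is d j times growth in y, independently of f, w and x.\<close>
  define h where "h f w x = (\<lambda>y. complex_of_real (decay (n * K) x / d (length w)) * Dw w f (x + y))"
    for f :: "real^'n \<Rightarrow> complex" and w x
  define B1 where "B1 = {h f w x | f w x. f \<in> B}"
  \<comment> \<open>Designed to contain \<open>corr T f\<close> divided by a whenever \<bar>T\<bar>
    \<le> a on B1. It is bounded because d k \<le> E m * W m k for every m.\<close>
  define B2 where "B2 = {g :: real^'n \<Rightarrow> complex. smooth g \<and> (\<forall>w x. cmod (Dw w g x) \<le> d (length w) * growth (n * K) x)}"
  have "ON_bdd (n * K) B1"
    unfolding ON_bdd_def
  proof (intro conjI allI impI)
    have "h f w x \<in> ON (n * K)" if "f \<in> B" for f w x
      unfolding h_def using BO(1) that by (intro ON_cmult ON_translate ON_Dw) auto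
    then show "B1 \<subseteq> ON (n * K)" unfolding B1_def by blast
    fix m :: nat assume m: "1 \<le> m"
    have "UB m (\<lambda>y. (E m * exp (real (n * K))) * growth (n * K) y) (h f w x)" if f: "f \<in> B" for f w x
    proof (rule UB_I)
      fix v :: "'n list" and y
      have fs: "smooth f" using f BO(2) OC_smooth by blast
      let ?e = "decay (n * K) x / d (length w)"
      have e0: "0 \<le> ?e" using dpos[of "length w"] by simp
      have "Dw v (h f w x) y = of_real ?e * Dw (v @ w) f (x + y)"
        unfolding h_def by (subst Dw_cmult[OF smooth_translate[OF smooth_Dw[OF fs]]]) (simp add: Dw_translate)
      then have "cmod (Dw v (h f w x) y) = ?e * cmod (Dw (v @ w) f (x + y))"
        using e0 by (simp only: norm_mult norm_of_real abs_of_nonneg)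
      also have "\<dots> \<le> ?e * (d (length v) * d (length w) * growth n (x + y))"
        using e0 by (intro mult_left_mono split f) auto
      also have "\<dots> \<le> ?e * (d (length v) * d (length w) * (exp (real (n * K)) * growth (n * K) x * growth (n * K) y))"
        using e0 dpos by (intro mult_left_mono exp_wt_add) (auto intro!: mult_nonneg_nonneg less_imp_le)
      also have "\<dots> = (growth (n * K) x * decay (n * K) x) * (d (length v) * (exp (real (n * K)) * growth (n * K) y))"
        using dpos[of "length w"] by (simp add: field_simps)
      also have "\<dots> = d (length v) * (exp (real (n * K)) * growth (n * K) y)"
        by (simp only: exp_minus_inverse mult_1)
      also have "\<dots> \<le> (E m * W m (length v)) * (exp (real (n * K)) * growth (n * K) y)"
        by (intro mult_right_mono d_le m) auto
      finally show "cmod (Dw v (h f w x) y) \<le> (E m * exp (real (n * K))) * growth (n * K) y * W m (length v)"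
        by (simp only: mult_ac)
    qed
    then show "\<exists>C. \<forall>f\<in>B1. UB m (\<lambda>y. C * growth (n * K) y) f" unfolding B1_def by blast
  qed
  then have bB1: "bounded_in (OC_space \<omega>) B1" by (rule ON_bdd_bounded[OF nK])
  have B2: "UB m (\<lambda>x. E m * growth (n * K) x) g" if m: "1 \<le> m" and g: "g \<in> B2" for m g
  proof (rule UB_I)
    fix w :: "'n list" and x
    have "cmod (Dw w g x) \<le> d (length w) * growth (n * K) x" using g by (simp add: B2_def)
    also have "\<dots> \<le> (E m * W m (length w)) * growth (n * K) x" by (intro mult_right_mono d_le m) auto
    finally show "cmod (Dw w g x) \<le> E m * growth (n * K) x * W m (length w)" by (simp only: mult_ac)
  qed
  then have "ON_bdd (n * K) B2"
  proof -
    have "smooth g" if "g \<in> B2" for g using that by (simp add: B2_def)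
    then show ?thesis unfolding ON_bdd_def ON_def using B2 by blast
  qed
  then have bB2: "bounded_in (OC_space \<omega>) B2" by (rule ON_bdd_bounded[OF nK])
  have "cmod (S (corr T f)) \<le> a * b"
    if T: "T \<in> dual_space (OC_space \<omega>)" and S: "S \<in> dual_space (OC_space \<omega>)" and f: "f \<in> B" and a: "0 < a"
      and T1: "\<And>h. h \<in> B1 \<Longrightarrow> cmod (T h) \<le> a" and S1: "\<And>h. h \<in> B2 \<Longrightarrow> cmod (S h) \<le> b" for T S f a b
  proof -
    have fO: "f \<in> OC" using f BO by blast
    let ?g = "\<lambda>x. complex_of_real (inverse a) * corr T f x"
    have sm: "smooth (corr T f)" by (rule smooth_corr[OF T fO])
    have "?g \<in> B2"
      unfolding B2_def
    proof (intro CollectI conjI allI)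
      show "smooth ?g" by (rule smooth_cmult[OF sm])
      fix w :: "'n list" and x
      have "h f w x \<in> B1" using f by (auto simp: B1_def)
      then have "cmod (T (h f w x)) \<le> a" by (rule T1)
      moreover have "T (h f w x) = of_real (decay (n * K) x / d (length w)) * corr T (Dw w f) x"
        unfolding h_def corr_def by (rule dual_cmult[OF T OC_translate[OF OC_Dw[OF fO]]])
      ultimately have "decay (n * K) x / d (length w) * cmod (corr T (Dw w f) x) \<le> a"
        using dpos[of "length w"] by (simp add: norm_mult norm_divide)
      then have "inverse a * cmod (corr T (Dw w f) x) \<le> d (length w) * growth (n * K) x"
        using a dpos[of "length w"] by (simp add: exp_minus field_simps)
      then show "cmod (Dw w ?g x) \<le> d (length w) * growth (n * K) x"
        using a by (simp add: Dw_cmult[OF sm] Dw_corr[OF T fO] norm_mult norm_inverse)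
    qed
    then have "cmod (S ?g) \<le> b" by (rule S1)
    then show ?thesis
      unfolding dual_cmult[OF S corr_OC[OF T fO]] norm_mult norm_of_real using a by (simp add: field_simps)
  qed
  note est = this
  show ?thesis
    by (rule exI[of _ B1], rule exI[of _ B2], intro conjI ballI allI impI bB1 bB2) (rule est; blast)
qed

lemma dual_fun_space: "fun_space (dual_space (OC_space \<omega>) :: ((real^'n::finite \<Rightarrow> complex) \<Rightarrow> complex) set)"
  unfolding fun_space_def
proof (intro conjI ballI allI)
  fix T S :: "(real^'n::finite \<Rightarrow> complex) \<Rightarrow> complex" and c
  assume T: "T \<in> dual_space (OC_space \<omega>)"
  show "(\<lambda>f. c * T f) \<in> dual_space (OC_space \<omega>)" using dual_lincomb[OF dual_zero_mem T, of c] by simp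
  assume S: "S \<in> dual_space (OC_space \<omega>)"
  show "(\<lambda>f. T f + S f) \<in> dual_space (OC_space \<omega>)" using dual_lincomb[OF T S, of 1] by simp
qed (rule dual_zero_mem)

section \<open>The strong dual topology and its neighbourhoods\<close>

abbreviation OC_dual_seminorms :: "(((real^'n::finite \<Rightarrow> complex) \<Rightarrow> complex) \<Rightarrow> ereal) set" where
  "OC_dual_seminorms \<equiv> {(\<lambda>T. SUP f\<in>B. ereal (cmod (T f))) | B. bounded_in (OC_space \<omega>) B}"

lemma OC_dual_eq: "OC_dual \<omega> = seminorm_topology (dual_space (OC_space \<omega>)) OC_dual_seminorms"
  by (simp add: OC_dual_def strong_dual_def)

lemma OC_dual_subadditive:
  "subadditive_family (dual_space (OC_space \<omega>) :: ((real^'n::finite \<Rightarrow> complex) \<Rightarrow> complex) set) OC_dual_seminorms"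
  unfolding subadditive_family_def
proof safe
  fix B :: "(real^'n \<Rightarrow> complex) set" assume B: "bounded_in (OC_space \<omega>) B"
  show "(SUP f\<in>B. ereal (cmod 0)) \<le> 0" by (rule SUP_least) simp
  fix T :: "(real^'n \<Rightarrow> complex) \<Rightarrow> complex" assume T: "T \<in> dual_space (OC_space \<omega>)"
  obtain C where C: "\<And>f. f \<in> B \<Longrightarrow> cmod (T f) \<le> C" using dual_bounded_set[OF T B] by blast
  have "(SUP f\<in>B. ereal (cmod (T f))) \<le> ereal C" by (rule SUP_least) (simp add: C)
  then show "(SUP f\<in>B. ereal (cmod (T f))) < \<infinity>" by (rule order_le_less_trans) simp
  fix S :: "(real^'n \<Rightarrow> complex) \<Rightarrow> complex"
  show "(SUP f\<in>B. ereal (cmod (T f + S f))) \<le> (SUP f\<in>B. ereal (cmod (T f))) + (SUP f\<in>B. ereal (cmod (S f)))"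
  proof (rule SUP_least)
    fix f assume f: "f \<in> B"
    have "ereal (cmod (T f + S f)) \<le> ereal (cmod (T f)) + ereal (cmod (S f))" by (simp add: norm_triangle_ineq)
    also have "\<dots> \<le> (SUP f\<in>B. ereal (cmod (T f))) + (SUP f\<in>B. ereal (cmod (S f)))"
      using f by (intro add_mono SUP_upper)
    finally show "ereal (cmod (T f + S f)) \<le> (SUP f\<in>B. ereal (cmod (T f))) + (SUP f\<in>B. ereal (cmod (S f)))" .
  qed
qed

lemma openin_OC_dual_ball:
  assumes T0: "T0 \<in> dual_space (OC_space \<omega>)" and B: "bounded_in (OC_space \<omega>) B" and e: "0 < e"
  shows "openin (OC_dual \<omega>) {T \<in> dual_space (OC_space \<omega>). (SUP f\<in>B. ereal (cmod (T f - T0 f))) < ereal e}"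
    and "T0 \<in> {T \<in> dual_space (OC_space \<omega>). (SUP f\<in>B. ereal (cmod (T f - T0 f))) < ereal e}"
proof -
  have "{T \<in> dual_space (OC_space \<omega>). (\<lambda>T. SUP f\<in>B. ereal (cmod (T f))) (\<lambda>f. T f - T0 f) < ereal e} \<in>
     insert (dual_space (OC_space \<omega>)) {{g \<in> dual_space (OC_space \<omega>). p (\<lambda>x. g x - f x) < ereal e} | f p e.
       f \<in> dual_space (OC_space \<omega>) \<and> p \<in> OC_dual_seminorms \<and> 0 < e}"
    by (rule insertI2, rule CollectI, rule exI[of _ T0], rule exI[of _ "\<lambda>T. SUP f\<in>B. ereal (cmod (T f))"], rule exI[of _ e])
      (use assms in auto)
  then show "openin (OC_dual \<omega>) {T \<in> dual_space (OC_space \<omega>). (SUP f\<in>B. ereal (cmod (T f - T0 f))) < ereal e}"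
    unfolding OC_dual_eq seminorm_topology_def by (intro topology_generated_by_Basis) simp
  have "(SUP f\<in>B. ereal (cmod (T0 f - T0 f))) \<le> 0" by (rule SUP_least) simp
  also have "0 < ereal e" using e by simp
  finally show "T0 \<in> {T \<in> dual_space (OC_space \<omega>). (SUP f\<in>B. ereal (cmod (T f - T0 f))) < ereal e}"
    using T0 by simp
qed

text \<open>With increments dT and dS, bilinearity splits the difference into the products of dT
  with dS, of T0 with dS and of dT with S0. The same pair of bounded sets from
  \<open>convolution_estimate\<close> controls all three.\<close>

lemma conv_ext_continuous_at:
  fixes B :: "(real^'n::finite \<Rightarrow> complex) set"
  assumes B: "bounded_in (OC_space \<omega>) B" and e: "0 < e"
    and T0: "T0 \<in> dual_space (OC_space \<omega>)" and S0: "S0 \<in> dual_space (OC_space \<omega>)"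
  shows "\<exists>N1 N2. openin (OC_dual \<omega>) N1 \<and> openin (OC_dual \<omega>) N2 \<and> T0 \<in> N1 \<and> S0 \<in> N2 \<and>
    (\<forall>T\<in>N1. \<forall>S\<in>N2. (SUP f\<in>B. ereal (cmod (conv_ext T S f - conv_ext T0 S0 f))) < ereal e)"
proof -
  let ?D = "dual_space (OC_space \<omega>) :: ((real^'n \<Rightarrow> complex) \<Rightarrow> complex) set"
  have BO: "B \<subseteq> OC" using B by (simp add: bounded_in_OC_iff)
  from convolution_estimate[OF B] obtain B1 B2 where B12: "bounded_in (OC_space \<omega>) B1" "bounded_in (OC_space \<omega>) B2"
    and est: "\<forall>T\<in>?D. \<forall>S\<in>?D. \<forall>f\<in>B. \<forall>a b. 0 < a \<longrightarrow> (\<forall>h\<in>B1. cmod (T h) \<le> a) \<longrightarrow> (\<forall>h\<in>B2. cmod (S h) \<le> b) \<longrightarrow>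
       cmod (S (corr T f)) \<le> a * b" by (elim exE conjE)
  have est: "cmod (S (corr T f)) \<le> a * b"
    if "T \<in> ?D" "S \<in> ?D" "f \<in> B" "0 < a" "\<forall>h\<in>B1. cmod (T h) \<le> a" "\<forall>h\<in>B2. cmod (S h) \<le> b" for T S f a b
    using est that by simp
  obtain a0 where a0: "a0 > 0" "\<forall>h\<in>B1. cmod (T0 h) \<le> a0" using dual_bounded_set[OF T0 B12(1)] by blast
  obtain b0 where b0: "b0 > 0" "\<forall>h\<in>B2. cmod (S0 h) \<le> b0" using dual_bounded_set[OF S0 B12(2)] by blast
  \<comment> \<open>The bound 1 gives d * d \<le> d, so the three terms sum to at most d (1 + a0 +
    b0) \<le> e / 2. The target is e / 2 because the supremum over B has to stay strictly below
    e.\<close>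
  define d where "d = min 1 (e / (2 * (1 + a0 + b0)))"
  have d: "0 < d" "d \<le> 1" using e a0 b0 by (auto simp: d_def)
  have de: "d * d + a0 * d + d * b0 \<le> e / 2"
  proof -
    have "d * d \<le> d * 1" using d by (intro mult_left_mono) auto
    then have "d * d + a0 * d + d * b0 \<le> d * (1 + a0 + b0)" by (simp add: algebra_simps)
    also have "\<dots> \<le> e / (2 * (1 + a0 + b0)) * (1 + a0 + b0)"
      using a0 b0 by (intro mult_right_mono) (auto simp: d_def)
    also have "\<dots> = e / 2" using a0 b0 by (simp add: field_simps)
    finally show ?thesis .
  qed
  let ?N1 = "{T \<in> ?D. (SUP f\<in>B1. ereal (cmod (T f - T0 f))) < ereal d}"
  let ?N2 = "{S \<in> ?D. (SUP f\<in>B2. ereal (cmod (S f - S0 f))) < ereal d}"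
  have "(SUP f\<in>B. ereal (cmod (conv_ext T S f - conv_ext T0 S0 f))) < ereal e" if T: "T \<in> ?N1" and S: "S \<in> ?N2" for T S
  proof -
    have TD: "T \<in> ?D" and SD: "S \<in> ?D" using T S by auto
    let ?T = "\<lambda>f. T f - T0 f" and ?S = "\<lambda>f. S f - S0 f"
    have dT: "?T \<in> ?D" and dS: "?S \<in> ?D" using fun_space_diff[OF dual_fun_space] TD SD T0 S0 by blast+
    have T1: "\<forall>h\<in>B1. cmod (?T h) \<le> d"
    proof
      fix h assume "h \<in> B1"
      then have "ereal (cmod (?T h)) \<le> (SUP f\<in>B1. ereal (cmod (?T f)))" by (rule SUP_upper)
      also have "\<dots> < ereal d" using T by simp
      finally show "cmod (?T h) \<le> d" by simp
    qed
    have S1: "\<forall>h\<in>B2. cmod (?S h) \<le> d"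
    proof
      fix h assume "h \<in> B2"
      then have "ereal (cmod (?S h)) \<le> (SUP f\<in>B2. ereal (cmod (?S f)))" by (rule SUP_upper)
      also have "\<dots> < ereal d" using S by simp
      finally show "cmod (?S h) \<le> d" by simp
    qed
    have "cmod (conv_ext T S f - conv_ext T0 S0 f) \<le> e / 2" if f: "f \<in> B" for f
    proof -
      have fO: "f \<in> OC" using f BO by blast
      have split: "corr T f = (\<lambda>x. corr ?T f x + corr T0 f x)" by (simp add: corr_def fun_eq_iff)
      have "S (corr T f) = S (corr ?T f) + S (corr T0 f)"
        unfolding split by (rule dual_add[OF SD corr_OC[OF dT fO] corr_OC[OF T0 fO]])
      then have "conv_ext T S f - conv_ext T0 S0 f = ?S (corr ?T f) + ?S (corr T0 f) + S0 (corr ?T f)"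
        using fO by (simp add: conv_ext_def)
      then have "cmod (conv_ext T S f - conv_ext T0 S0 f) \<le> cmod (?S (corr ?T f)) + cmod (?S (corr T0 f)) + cmod (S0 (corr ?T f))"
        by (simp only:) (intro norm_triangle_le add_right_mono norm_triangle_ineq)
      also have "\<dots> \<le> d * d + a0 * d + d * b0"
        using est[OF dT dS f d(1) T1 S1] est[OF T0 dS f a0(1,2) S1] est[OF dT S0 f d(1) T1 b0(2)] by linarith
      finally show ?thesis using de by linarith
    qed
    then have "(SUP f\<in>B. ereal (cmod (conv_ext T S f - conv_ext T0 S0 f))) \<le> ereal (e / 2)" by (intro SUP_least) simp
    also have "\<dots> < ereal e" using e by simp
    finally show ?thesis .
  qed
  then show ?thesis
    using openin_OC_dual_ball[OF T0 B12(1) d(1)] openin_OC_dual_ball[OF S0 B12(2) d(1)]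
    by (intro exI[of _ ?N1] exI[of _ ?N2] conjI ballI)
qed

lemma conv_OC_continuous:
  "continuous_map (prod_topology (OC_dual \<omega>) (OC_dual \<omega>)) (OC_dual \<omega> :: ((real^'n::finite \<Rightarrow> complex) \<Rightarrow> complex) topology)
     (\<lambda>(T, S). conv_OC \<omega> T S)"
proof -
  let ?D = "dual_space (OC_space \<omega>) :: ((real^'n \<Rightarrow> complex) \<Rightarrow> complex) set"
  have top: "topspace (OC_dual \<omega>) = ?D" by (simp add: OC_dual_def)
  have "continuous_map (prod_topology (OC_dual \<omega>) (OC_dual \<omega>)) (OC_dual \<omega> :: ((real^'n \<Rightarrow> complex) \<Rightarrow> complex) topology)
     (\<lambda>(T, S). conv_ext T S)"
    unfolding continuous_map_def
  proof (intro conjI allI impI)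
    show "(\<lambda>(T, S). conv_ext T S) \<in> topspace (prod_topology (OC_dual \<omega>) (OC_dual \<omega>)) \<rightarrow> topspace (OC_dual \<omega> :: ((real^'n \<Rightarrow> complex) \<Rightarrow> complex) topology)"
      by (auto simp: top conv_ext_dual)
    fix U :: "((real^'n \<Rightarrow> complex) \<Rightarrow> complex) set" assume U: "openin (OC_dual \<omega>) U"
    show "openin (prod_topology (OC_dual \<omega>) (OC_dual \<omega>)) {x \<in> topspace (prod_topology (OC_dual \<omega>) (OC_dual \<omega>)). (case x of (T, S) \<Rightarrow> conv_ext T S) \<in> U}"
      unfolding openin_prod_topology_alt
    proof (intro allI impI)
      fix T0 S0 assume "(T0, S0) \<in> {x \<in> topspace (prod_topology (OC_dual \<omega>) (OC_dual \<omega>)). (case x of (T, S) \<Rightarrow> conv_ext T S) \<in> U}"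
      then have T0: "T0 \<in> ?D" and S0: "S0 \<in> ?D" and TS: "conv_ext T0 S0 \<in> U" by (auto simp: top)
      from U TS obtain F e where F: "finite F" "F \<subseteq> OC_dual_seminorms" "0 < e"
        "{g\<in>?D. \<forall>p\<in>F. p (\<lambda>x. g x - conv_ext T0 S0 x) < ereal e} \<subseteq> U"
        unfolding OC_dual_eq openin_seminorm_topology[OF dual_fun_space OC_dual_subadditive]
        by (elim conjE) (drule (1) bspec, elim exE conjE)
      have "\<exists>N1 N2. openin (OC_dual \<omega>) N1 \<and> openin (OC_dual \<omega>) N2 \<and> T0 \<in> N1 \<and> S0 \<in> N2 \<and>
        (\<forall>T\<in>N1. \<forall>S\<in>N2. \<forall>p\<in>F. p (\<lambda>x. conv_ext T S x - conv_ext T0 S0 x) < ereal e)"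
        using F(1,2)
      proof (induction F)
        case empty
        have "openin (OC_dual \<omega>) (topspace (OC_dual \<omega> :: ((real^'n \<Rightarrow> complex) \<Rightarrow> complex) topology))"
          by (rule openin_topspace)
        then have "openin (OC_dual \<omega>) ?D" by (simp only: top)
        then show ?case using T0 S0 by (intro exI[of _ ?D]) auto
      next
        case (insert p F)
        from insert obtain B where B: "bounded_in (OC_space \<omega>) B" "p = (\<lambda>T. SUP f\<in>B. ereal (cmod (T f)))" by auto
        from insert obtain N1 N2 where N: "openin (OC_dual \<omega>) N1" "openin (OC_dual \<omega>) N2" "T0 \<in> N1" "S0 \<in> N2"
          "\<forall>T\<in>N1. \<forall>S\<in>N2. \<forall>p\<in>F. p (\<lambda>x. conv_ext T S x - conv_ext T0 S0 x) < ereal e" by auto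
        from conv_ext_continuous_at[OF B(1) F(3) T0 S0]
        obtain M1 M2 where M: "openin (OC_dual \<omega>) M1" "openin (OC_dual \<omega>) M2" "T0 \<in> M1" "S0 \<in> M2"
          "\<forall>T\<in>M1. \<forall>S\<in>M2. (SUP f\<in>B. ereal (cmod (conv_ext T S f - conv_ext T0 S0 f))) < ereal e" by (elim exE conjE)
        show ?case
          using N M B(2) by (intro exI[of _ "N1 \<inter> M1"] exI[of _ "N2 \<inter> M2"]) (auto intro: openin_Int)
      qed
      then obtain N1 N2 where N: "openin (OC_dual \<omega>) N1" "openin (OC_dual \<omega>) N2" "T0 \<in> N1" "S0 \<in> N2"
        "\<forall>T\<in>N1. \<forall>S\<in>N2. \<forall>p\<in>F. p (\<lambda>x. conv_ext T S x - conv_ext T0 S0 x) < ereal e" by (elim exE conjE)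
      have sub: "N1 \<subseteq> ?D" "N2 \<subseteq> ?D" using openin_subset[OF N(1)] openin_subset[OF N(2)] by (auto simp: top)
      have "N1 \<times> N2 \<subseteq> {x \<in> topspace (prod_topology (OC_dual \<omega>) (OC_dual \<omega>)). (case x of (T, S) \<Rightarrow> conv_ext T S) \<in> U}"
      proof safe
        fix T S assume T: "T \<in> N1" and S: "S \<in> N2"
        then have D: "T \<in> ?D" "S \<in> ?D" using sub by auto
        then show "(T, S) \<in> topspace (prod_topology (OC_dual \<omega>) (OC_dual \<omega>))" by (simp add: top)
        show "conv_ext T S \<in> U" by (rule subsetD[OF F(4)]) (use N(5) T S conv_ext_dual[OF D] in simp)
      qed
      then show "\<exists>N1 N2. openin (OC_dual \<omega>) N1 \<and> openin (OC_dual \<omega>) N2 \<and> T0 \<in> N1 \<and> S0 \<in> N2 \<and>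
        N1 \<times> N2 \<subseteq> {x \<in> topspace (prod_topology (OC_dual \<omega>) (OC_dual \<omega>)). (case x of (T, S) \<Rightarrow> conv_ext T S) \<in> U}"
        using N(1-4) by blast
    qed
  qed
  then show ?thesis by (rule continuous_map_eq) (auto simp: top conv_OC_eq)
qed

text \<open>Correlation commutes with translations, so the convolution of R and S on a translate of
  f is S on the same translate of \<open>corr R f\<close>. Associativity is this identity evaluated
  under a third functional.\<close>

lemma corr_conv_ext:
  assumes R: "R \<in> dual_space (OC_space \<omega>)" and f: "f \<in> OC"
  shows "corr (conv_ext R S) f = corr S (corr R f)"
  using OC_translate[OF f] by (simp add: corr_def[abs_def] conv_ext_def fun_eq_iff add.assoc)

lemma conv_OC_algebra:
  "complex_algebra_on (dual_space (OC_space \<omega>) :: ((real^'n::finite \<Rightarrow> complex) \<Rightarrow> complex) set) (conv_OC \<omega>)"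
proof -
  let ?D = "dual_space (OC_space \<omega>) :: ((real^'n \<Rightarrow> complex) \<Rightarrow> complex) set"
  have add: "(\<lambda>f. S f + T f) \<in> ?D" if "S \<in> ?D" "T \<in> ?D" for S T by (rule fun_space_add[OF dual_fun_space that])
  have cm: "(\<lambda>f. c * T f) \<in> ?D" if "T \<in> ?D" for c T by (rule fun_space_cmult[OF dual_fun_space that])
  have ldist: "conv_ext (\<lambda>f. R f + S f) T = (\<lambda>f. conv_ext R T f + conv_ext S T f)" if "R \<in> ?D" "S \<in> ?D" "T \<in> ?D" for R S T
  proof
    fix f
    have "corr (\<lambda>f. R f + S f) f = (\<lambda>x. corr R f x + corr S f x)" by (simp add: corr_def fun_eq_iff)
    then show "conv_ext (\<lambda>f. R f + S f) T f = conv_ext R T f + conv_ext S T f"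
      using that by (simp add: conv_ext_def dual_add[OF that(3)] corr_OC)
  qed
  have rdist: "conv_ext R (\<lambda>f. S f + T f) = (\<lambda>f. conv_ext R S f + conv_ext R T f)"
    and rcm: "conv_ext R (\<lambda>f. c * S f) = (\<lambda>f. c * conv_ext R S f)" for R S T :: "(real^'n \<Rightarrow> complex) \<Rightarrow> complex" and c
    by (simp_all add: conv_ext_def fun_eq_iff)
  have lcm: "conv_ext (\<lambda>f. c * S f) T = (\<lambda>f. c * conv_ext S T f)" if "S \<in> ?D" "T \<in> ?D" for c S T
  proof
    fix f
    have "corr (\<lambda>f. c * S f) f = (\<lambda>x. c * corr S f x)" by (simp add: corr_def fun_eq_iff)
    then show "conv_ext (\<lambda>f. c * S f) T f = c * conv_ext S T f"
      using that by (simp add: conv_ext_def dual_cmult[OF that(2)] corr_OC)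
  qed
  have assoc: "conv_ext (conv_ext R S) T = conv_ext R (conv_ext S T)" if "R \<in> ?D" "S \<in> ?D" "T \<in> ?D" for R S T
  proof
    fix f
    show "conv_ext (conv_ext R S) T f = conv_ext R (conv_ext S T) f"
      using corr_conv_ext[OF that(1)] corr_OC[OF that(1)] by (simp add: conv_ext_def)
  qed
  show ?thesis
    unfolding complex_algebra_on_def
    by (simp add: conv_OC_eq conv_ext_dual dual_zero_mem add cm ldist lcm rdist rcm assoc)
qed

end

theorem theorem3p11:
  fixes \<omega> :: "real \<Rightarrow> real"
  defines "A \<equiv> (OC_dual \<omega> :: ((real^'n::finite \<Rightarrow> complex) \<Rightarrow> complex) topology)"
  assumes "nonquasianalytic_weight \<omega>"
    and "(\<lambda>t. ln (1 + t)) \<in> o[at_top](\<omega>)"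
  shows "(\<forall>T\<in>topspace A. \<forall>S\<in>topspace A.
            conv \<omega> T (restr_S \<omega> S) \<in> topspace (S_dual \<omega>) \<and>
            (\<exists>!U. U \<in> topspace A \<and> restr_S \<omega> U = conv \<omega> T (restr_S \<omega> S))) \<and>
         complex_algebra_on (topspace A) (conv_OC \<omega>) \<and>
         continuous_map (prod_topology A A) A (\<lambda>(T, S). conv_OC \<omega> T S)"
proof -
  interpret weight \<omega> by unfold_locales (rule assms)+
  have top: "topspace A = dual_space (OC_space \<omega>)" by (simp add: A_def OC_dual_def)
  show ?thesis
  proof (intro conjI ballI)
    fix T S assume "T \<in> topspace A" "S \<in> topspace A"
    then have T: "T \<in> dual_space (OC_space \<omega>)" and S: "S \<in> dual_space (OC_space \<omega>)" by (simp_all add: top)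
    note U = conv_ext_dual[OF T S] and restr = restr_S_conv_ext[OF T, of S]
    show "conv \<omega> T (restr_S \<omega> S) \<in> topspace (S_dual \<omega>)"
      using restr_S_dual[OF U] by (simp add: S_dual_def restr)
    show "\<exists>!U. U \<in> topspace A \<and> restr_S \<omega> U = conv \<omega> T (restr_S \<omega> S)"
    proof (rule ex1I)
      show "conv_ext T S \<in> topspace A \<and> restr_S \<omega> (conv_ext T S) = conv \<omega> T (restr_S \<omega> S)" using U restr by (simp add: top)
      show "V = conv_ext T S" if "V \<in> topspace A \<and> restr_S \<omega> V = conv \<omega> T (restr_S \<omega> S)" for V
        by (rule restr_S_inj[OF _ U]) (use that restr in \<open>simp_all add: top\<close>)
    qed
  next
    show "complex_algebra_on (topspace A) (conv_OC \<omega>)" unfolding top by (rule conv_OC_algebra)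
    show "continuous_map (prod_topology A A) A (\<lambda>(T, S). conv_OC \<omega> T S)" unfolding A_def by (rule conv_OC_continuous)
  qed
qed

end
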